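(* Let $N\ge3$, $R>0$, and let $B_R\subset\mathbb{R}^N$ be the open ball of radius $R$ centered at the origin. Let $u\in H_r(B_R)$ and set $$w(t)=|x|^{\frac{N-2}{2}}u(|x|),\qquad t=\left(-\log\frac{|x|}{R}\right)^{-\frac1{N-2}},$$ where $w$ is regarded as a radial function on $\mathbb{R}^N$ with radial variable $t$. Then $w\in D_r^{1,2}(\mathbb{R}^N)$ and $$\|u\|^2_{H_r(B_R)}=(N-2)^{-1}\,\|w\|^2_{D_r^{1,2}(\mathbb{R}^N)}.$$
   Context: $D^{1,2}(\mathbb{R}^N)$ is the closure of $C_0^\infty(\mathbb{R}^N)$ under the norm $\|\phi\|^2=\int_{\mathbb{R}^N}|\nabla\phi|^2dx$; $D_r^{1,2}(\mathbb{R}^N)$ is its subspace of radial functions. $H(B_R)$ is the completion of the set $\{|x|^{-\frac{N-2}{2}}\phi(x):\phi\in C_0^\infty(B_R)\}$ under the norm $$\|u\|_{H(B_R)}^2=\int_{B_R}|\nabla u|^2dx-\left(\frac{N-2}{2}\right)^2\int_{B_R}\frac{u^2}{|x|^2}dx-L^2(u),$$ and $H_r(B_R)$ is its subspace of radial functions, with the same norm. Here $L(u)=\left(\frac{N(N-2)}{2}\omega_N\right)^{1/2}\lim_{|x|\to0}|x|^{\frac{N-2}{2}}u_r(|x|)$, where $\omega_N$ is the Lebesgue measure of the unit ball of $\mathbb{R}^N$ and $u_r(\rho)=\frac1{|\partial B_\rho|}\int_{\partial B_\rho}u\,ds$ is the radial part of $u$. The difference of the two integrals in the norm is understood as the limit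 as $\varepsilon\to0$ of the same difference over $B_R\setminus B_\varepsilon(0)$ for $u$ in the dense set above, and the whole expression is extended to $H(B_R)$ by completion. *)

theory Defs
  imports "HOL-Analysis.Analysis"
begin

text \<open>
  Throughout, \<open>\<real>\<^sup>N\<close> is an arbitrary euclidean space \<open>'a\<close> with \<open>N = DIM('a)\<close>.
\<close>

section \<open>Smooth functions and test functions\<close>

fun C_fun :: "nat \<Rightarrow> ('a::euclidean_space \<Rightarrow> real) \<Rightarrow> bool" where
  "C_fun 0 f \<longleftrightarrow> continuous_on UNIV f"
| "C_fun (Suc k) f \<longleftrightarrow> (\<forall>x. f differentiable (at x)) \<and>
     (\<forall>b\<in>Basis. C_fun k (\<lambda>x. frechet_derivative f (at x) b))"

text \<open>
  \<open>C\<^sub>0\<^sup>\<infinity>(\<Omega>)\<close>; its elements are regarded as functions on the whole space, extended by zero.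
\<close>

definition test_functions :: "'a::euclidean_space set \<Rightarrow> ('a \<Rightarrow> real) set" where
  "test_functions \<Omega> = {\<phi>. (\<forall>k. C_fun k \<phi>) \<and>
     compact (closure {x. \<phi> x \<noteq> 0}) \<and> closure {x. \<phi> x \<noteq> 0} \<subseteq> \<Omega>}"

definition grad :: "('a::euclidean_space \<Rightarrow> real) \<Rightarrow> 'a \<Rightarrow> 'a" where
  "grad f x = (\<Sum>b\<in>Basis. frechet_derivative f (at x) b *\<^sub>R b)"

section \<open>Completions realised as function spaces\<close>

text \<open>
  The completion of a space \<open>V\<close> of functions under a norm \<open>q\<close> is taken as a space of functions
  modulo equality \<open>M\<close>-almost everywhere: an abstract element, represented by a \<open>q\<close>-Cauchy
  sequence in \<open>V\<close>, is identified with its pointwise a.e. limit (every class contains an a.e.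
  convergent sequence in the two cases used below, and the limit determines the class).
  The norm of the completion is the limit of the norms along such a sequence.
\<close>

definition approximates ::
  "'a measure \<Rightarrow> (('a \<Rightarrow> real) \<Rightarrow> real) \<Rightarrow> ('a \<Rightarrow> real) set \<Rightarrow> (nat \<Rightarrow> 'a \<Rightarrow> real) \<Rightarrow> ('a \<Rightarrow> real) \<Rightarrow> bool"
  where
  "approximates M q V s u \<longleftrightarrow>
     (\<forall>n. s n \<in> V) \<and>
     (\<forall>e>0. \<exists>n0. \<forall>m\<ge>n0. \<forall>n\<ge>n0. q (\<lambda>x. s m x - s n x) < e) \<and>
     (AE x in M. (\<lambda>n. s n x) \<longlonglongrightarrow> u x)"

definition fun_completion ::
  "'a measure \<Rightarrow> (('a \<Rightarrow> real) \<Rightarrow> real) \<Rightarrow> ('a \<Rightarrow> real) set \<Rightarrow> ('a \<Rightarrow> real) set" where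
  "fun_completion M q V = {u. \<exists>s. approximates M q V s u}"

definition fun_completion_norm ::
  "'a measure \<Rightarrow> (('a \<Rightarrow> real) \<Rightarrow> real) \<Rightarrow> ('a \<Rightarrow> real) set \<Rightarrow> ('a \<Rightarrow> real) \<Rightarrow> real" where
  "fun_completion_norm M q V u =
     (THE l. \<exists>s. approximates M q V s u \<and> (\<lambda>n. q (s n)) \<longlonglongrightarrow> l)"

text \<open>\<open>U\<close> is a radial profile of (the a.e.-class of) \<open>u\<close>, i.e. \<open>u(x) = U(|x|)\<close>.\<close>

definition radial_profile ::
  "'a::euclidean_space measure \<Rightarrow> ('a \<Rightarrow> real) \<Rightarrow> (real \<Rightarrow> real) \<Rightarrow> bool" where
  "radial_profile M u U \<longleftrightarrow> (AE x in M. u x = U (norm x))"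

section \<open>The spaces \<open>D\<^sup>1\<^sup>,\<^sup>2\<close> and \<open>D\<^sub>r\<^sup>1\<^sup>,\<^sup>2\<close>\<close>

definition dirichlet_norm :: "('a::euclidean_space \<Rightarrow> real) \<Rightarrow> real" where
  "dirichlet_norm \<phi> = sqrt (LINT x|lborel. (norm (grad \<phi> x))\<^sup>2)"

definition D12 :: "('a::euclidean_space \<Rightarrow> real) set" where
  "D12 = fun_completion lebesgue dirichlet_norm (test_functions UNIV)"

definition D12_norm :: "('a::euclidean_space \<Rightarrow> real) \<Rightarrow> real" where
  "D12_norm = fun_completion_norm lebesgue dirichlet_norm (test_functions UNIV)"

definition D12_radial :: "('a::euclidean_space \<Rightarrow> real) set" where
  "D12_radial = {w \<in> D12. \<exists>W. radial_profile lebesgue w W}"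

section \<open>The spaces \<open>H(B\<^sub>R)\<close> and \<open>H\<^sub>r(B\<^sub>R)\<close>\<close>

text \<open>
  Surface measure on the sphere of radius \<open>\<rho>\<close>, as the normalised cone measure:
  the image of Lebesgue measure on the unit ball under radial projection, times \<open>N \<rho>\<^bsup>N-1\<^esup>\<close>.
\<close>

definition surface_measure :: "real \<Rightarrow> 'a::euclidean_space measure" where
  "surface_measure \<rho> =
     scale_measure (ennreal (real DIM('a) * \<rho> ^ (DIM('a) - 1)))
       (distr (restrict_space lborel (ball 0 1)) borel (\<lambda>x. (\<rho> / norm x) *\<^sub>R x))"

definition radial_part :: "('a::euclidean_space \<Rightarrow> real) \<Rightarrow> real \<Rightarrow> real" where
  "radial_part u \<rho> =
     (LINT x|surface_measure \<rho>. u x) / measure (surface_measure \<rho> :: 'a measure) (sphere 0 \<rho>)"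

definition hardy_exp :: "'a::euclidean_space itself \<Rightarrow> real" where
  "hardy_exp _ = (real DIM('a) - 2) / 2"

definition L_fun :: "('a::euclidean_space \<Rightarrow> real) \<Rightarrow> real" where
  "L_fun u =
     sqrt (real DIM('a) * (real DIM('a) - 2) / 2 * measure lborel (ball (0::'a) 1)) *
     Lim (at_right 0) (\<lambda>\<rho>. \<rho> powr hardy_exp TYPE('a) * radial_part u \<rho>)"

text \<open>
  The value at the origin is immaterial: \<open>0 powr a = 0\<close>, and \<open>{0}\<close> is a null set.
\<close>

definition H_dense :: "real \<Rightarrow> ('a::euclidean_space \<Rightarrow> real) set" where
  "H_dense R = {(\<lambda>x. norm x powr (- hardy_exp TYPE('a)) * \<phi> x) |\<phi>. \<phi> \<in> test_functions (ball 0 R)}"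

definition H_quad :: "real \<Rightarrow> ('a::euclidean_space \<Rightarrow> real) \<Rightarrow> real" where
  "H_quad R u =
     Lim (at_right 0) (\<lambda>\<epsilon>.
       (LINT x:ball 0 R - ball 0 \<epsilon>|lborel. (norm (grad u x))\<^sup>2) -
       (hardy_exp TYPE('a))\<^sup>2 * (LINT x:ball 0 R - ball 0 \<epsilon>|lborel. (u x)\<^sup>2 / (norm x)\<^sup>2))
     - (L_fun u)\<^sup>2"

text \<open>Elements of \<open>H(B\<^sub>R)\<close> are total functions of which only the values on the ball matter.\<close>

definition H_space :: "real \<Rightarrow> ('a::euclidean_space \<Rightarrow> real) set" where
  "H_space R = fun_completion (lebesgue_on (ball 0 R)) (\<lambda>u. sqrt (H_quad R u)) (H_dense R)"

definition H_norm :: "real \<Rightarrow> ('a::euclidean_space \<Rightarrow> real) \<Rightarrow> real" where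
  "H_norm R = fun_completion_norm (lebesgue_on (ball 0 R)) (\<lambda>u. sqrt (H_quad R u)) (H_dense R)"

definition H_radial :: "real \<Rightarrow> ('a::euclidean_space \<Rightarrow> real) set" where
  "H_radial R = {u \<in> H_space R. \<exists>U. radial_profile (lebesgue_on (ball 0 R)) u U}"

end

theory Submission
  imports Defs
begin

text \<open>
  Writing \<open>u = |x|\<^bsup>-(N-2)/2\<^esup> \<phi>\<close>, integration of \<open>|x|\<^bsup>-N\<^esup> x \<bullet> \<nabla>(\<phi>\<^sup>2)\<close> along rays produces a boundary
  term at the origin that is exactly \<open>L(u)\<^sup>2\<close>, so the norm of \<open>H(B\<^sub>R)\<close> is the weighted Dirichlet
  norm \<open>\<integral> |x|\<^bsup>-(N-2)\<^esup> |\<nabla>\<phi>|\<^sup>2\<close>. In the variable \<open>s = - ln (|x| / R)\<close> this is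
  \<open>N \<omega>\<^sub>N \<integral> V'(s)\<^sup>2 ds\<close> for radial \<open>\<phi>\<close>, and in the variable \<open>s = t\<^bsup>-(N-2)\<^esup>\<close> the Dirichlet norm of
  \<open>w\<close> is \<open>N - 2\<close> times the same integral. If \<open>V'\<close> is smooth with compact support in \<open>(0, \<infinity>)\<close>,
  then both \<open>\<phi>\<close> and \<open>w\<close> are test functions; restricting an approximating sequence of \<open>u\<close> to a
  suitable ray yields such \<open>V\<close> approximating the profile of \<open>u\<close>. Since both norms are closable
  (Fatou's lemma applied to difference quotients), the norms of \<open>u\<close> and \<open>w\<close> may be computed along
  these particular sequences.
\<close>

section \<open>Smooth functions of one real variable and of the square of the norm\<close>

text \<open>The endpoints explain the class of profiles: \<open>s = 0\<close> is both the sphere |x|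
  = R and t = infinity, while s = infinity is both origins. If V' vanishes near 0 and for large s,
  then V is zero at the first end and constant at the second, so the singularities of logarithm and
  power at the origin do no harm. The factor N - 2 comes from |ds/dt| = (N-2) t^(-(N-1)). It enters
  the Dirichlet integral squared; one copy turns dt into ds, and in the other the power of t cancels
  the radial density t^(N-1), so one N - 2 survives. Two obstacles shape the argument. The functions
  approximating u need not be radial, and the restriction of one to a ray need not be even in r, so
  it gives no smooth radial function. Only its s-derivative is kept, replaced by a nearby smooth
  function of compact support, and integrated again. Moreover the norm of a completion is a definite
  description: it has a value only once all approximating sequences of a function are known to give
  the same limit. The weight, singular at the origin, is the delicate point there.\<close>

lemma C_fun_SucI:
  assumes "\<And>x. (f has_derivative f' x) (at x)"
    and "\<And>b. b \<in> Basis \<Longrightarrow> C_fun k (\<lambda>x. f' x b)"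
  shows "C_fun (Suc k) f"
proof -
  have "frechet_derivative f (at x) = f' x" for x
    using frechet_derivative_at[OF assms(1)] by metis
  then show ?thesis
    using assms by (auto simp: differentiable_def)
qed

lemma C_fun_SucD: "C_fun (Suc k) f \<Longrightarrow> C_fun k f"
proof (induction k arbitrary: f)
  case 0
  then show ?case
    by (auto simp: continuous_on_eq_continuous_at intro: differentiable_imp_continuous_within)
next
  case (Suc k)
  then show ?case by (metis C_fun.simps(2))
qed

lemma C_fun_frechet:
  assumes "C_fun (Suc k) f"
  shows "(f has_derivative frechet_derivative f (at x)) (at x)"
  using assms by (simp add: frechet_derivative_works)

lemma C_fun_const: "C_fun k (\<lambda>x. c)"
proof (induction k arbitrary: c)
  case 0
  then show ?case by simp
next
  case (Suc k)
  show ?case by (rule C_fun_SucI[where f' = "\<lambda>x h. 0"]) (auto intro!: derivative_eq_intros Suc)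
qed

lemma C_fun_add: "C_fun k f \<Longrightarrow> C_fun k g \<Longrightarrow> C_fun k (\<lambda>x. f x + g x)"
proof (induction k arbitrary: f g)
  case 0
  then show ?case by (auto intro: continuous_intros)
next
  case (Suc k)
  show ?case
    by (rule C_fun_SucI[OF has_derivative_add[OF C_fun_frechet[OF Suc.prems(1)] C_fun_frechet[OF Suc.prems(2)]]])
      (use Suc in auto)
qed

lemma C_fun_mult: "C_fun k f \<Longrightarrow> C_fun k g \<Longrightarrow> C_fun k (\<lambda>x. f x * g x)"
proof (induction k arbitrary: f g)
  case 0
  then show ?case by (auto intro: continuous_intros)
next
  case (Suc k)
  show ?case
    by (rule C_fun_SucI[OF has_derivative_mult[OF C_fun_frechet[OF Suc.prems(1)] C_fun_frechet[OF Suc.prems(2)]]])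
      (use Suc C_fun_SucD in \<open>auto intro!: C_fun_add Suc.IH\<close>)
qed

lemma C_fun_diff: "C_fun k f \<Longrightarrow> C_fun k g \<Longrightarrow> C_fun k (\<lambda>x. f x - g x)"
  using C_fun_add[OF _ C_fun_mult[OF C_fun_const[of k "-1"]], of f g] by simp

lemma C_fun_inner: "C_fun k (\<lambda>x. x \<bullet> b)"
proof (cases k)
  case 0
  then show ?thesis by (auto intro: continuous_intros)
next
  case (Suc m)
  show ?thesis unfolding Suc
    by (rule C_fun_SucI[where f' = "\<lambda>x h. h \<bullet> b"]) (auto intro!: derivative_eq_intros C_fun_const)
qed

text \<open>Smoothness relative to a set, which \<open>C_fun\<close> cannot express: the variables
  \<open>ln\<close> and \<open>powr\<close> are smooth only on the positive half-line. As
  \<open>deriv\<close> is local, the recursion behaves well on open \<open>S\<close>.\<close>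

primrec D_fun :: "real set \<Rightarrow> nat \<Rightarrow> (real \<Rightarrow> real) \<Rightarrow> bool" where
  "D_fun S 0 f \<longleftrightarrow> continuous_on S f"
| "D_fun S (Suc k) f \<longleftrightarrow> (\<forall>x\<in>S. f field_differentiable at x) \<and> D_fun S k (deriv f)"

lemma D_fun_cong:
  assumes "open S" "\<And>x. x \<in> S \<Longrightarrow> f x = g x" "D_fun S k f"
  shows "D_fun S k g"
  using assms(2,3)
proof (induction k arbitrary: f g)
  case 0
  then show ?case using continuous_on_cong by force
next
  case (Suc k)
  have d: "(g has_field_derivative deriv f x) (at x)" if "x \<in> S" for x
    using Suc.prems that assms(1)
    by (metis DERIV_deriv_iff_field_differentiable has_field_derivative_transform_within_open D_fun.simps(2))
  have "D_fun S k (deriv g)"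
    using Suc.IH[of "deriv f" "deriv g"] DERIV_imp_deriv[OF d] Suc.prems(2) by simp
  then show ?case using d by (auto simp: field_differentiable_def)
qed

lemma D_fun_SucI:
  assumes "open S" "\<And>x. x \<in> S \<Longrightarrow> (f has_field_derivative f' x) (at x)" "D_fun S k f'"
  shows "D_fun S (Suc k) f"
  using D_fun_cong[OF assms(1) DERIV_imp_deriv[OF assms(2), symmetric] assms(3)] assms(2)
  by (auto simp: field_differentiable_def)

lemma D_fun_deriv:
  "D_fun S (Suc k) f \<Longrightarrow> x \<in> S \<Longrightarrow> (f has_field_derivative deriv f x) (at x)"
  by (simp add: DERIV_deriv_iff_field_differentiable)

lemma D_fun_SucD: "D_fun S (Suc k) f \<Longrightarrow> D_fun S k f"
proof (induction k arbitrary: f)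
  case 0
  then show ?case
    by (auto intro!: continuous_at_imp_continuous_on field_differentiable_imp_continuous_at)
next
  case (Suc k)
  then show ?case by (metis D_fun.simps(2))
qed

lemma D_fun_const: "open S \<Longrightarrow> D_fun S k (\<lambda>x. c)"
proof (induction k arbitrary: c)
  case (Suc k)
  show ?case by (rule D_fun_SucI[where f' = "\<lambda>x. 0"]) (auto intro!: derivative_eq_intros Suc)
qed simp

lemma D_fun_ident: "open S \<Longrightarrow> D_fun S k (\<lambda>x. x)"
proof (cases k)
  case (Suc m)
  show "open S \<Longrightarrow> ?thesis" unfolding Suc
    by (rule D_fun_SucI[where f' = "\<lambda>x. 1"]) (auto intro!: derivative_eq_intros D_fun_const)
qed simp

lemma D_fun_add: "open S \<Longrightarrow> D_fun S k f \<Longrightarrow> D_fun S k g \<Longrightarrow> D_fun S k (\<lambda>x. f x + g x)"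
proof (induction k arbitrary: f g)
  case 0
  then show ?case by (auto intro: continuous_intros)
next
  case (Suc k)
  show ?case
    by (rule D_fun_SucI[OF Suc.prems(1) DERIV_add[OF D_fun_deriv[OF Suc.prems(2)] D_fun_deriv[OF Suc.prems(3)]]])
      (use Suc in auto)
qed

lemma D_fun_mult: "open S \<Longrightarrow> D_fun S k f \<Longrightarrow> D_fun S k g \<Longrightarrow> D_fun S k (\<lambda>x. f x * g x)"
proof (induction k arbitrary: f g)
  case 0
  then show ?case by (auto intro: continuous_intros)
next
  case (Suc k)
  show ?case
    by (rule D_fun_SucI[OF Suc.prems(1) DERIV_mult[OF D_fun_deriv[OF Suc.prems(2)] D_fun_deriv[OF Suc.prems(3)]]])
      (use Suc D_fun_SucD in \<open>auto intro!: D_fun_add Suc.IH\<close>)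
qed

lemma D_fun_compose:
  "open S \<Longrightarrow> D_fun S k g \<Longrightarrow> D_fun T k f \<Longrightarrow> g ` S \<subseteq> T \<Longrightarrow> D_fun S k (\<lambda>x. f (g x))"
proof (induction k arbitrary: f)
  case 0
  then show ?case by (auto intro: continuous_on_compose2)
next
  case (Suc k)
  show ?case
  proof (rule D_fun_SucI[OF Suc.prems(1), where f' = "\<lambda>x. deriv f (g x) * deriv g x"])
    show "((\<lambda>x. f (g x)) has_field_derivative deriv f (g x) * deriv g x) (at x)" if "x \<in> S" for x
      by (rule DERIV_chain2[OF D_fun_deriv[OF Suc.prems(3)] D_fun_deriv[OF Suc.prems(2) that]])
        (use that Suc.prems in auto)
    show "D_fun S k (\<lambda>x. deriv f (g x) * deriv g x)"
      by (rule D_fun_mult[OF Suc.prems(1) Suc.IH]) (use Suc.prems D_fun_SucD in auto)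
  qed
qed

text \<open>Serves to glue a constant piece near the origin to a composition that is controlled only
  on the positive half-line.\<close>

lemma D_fun_Un:
  "open S \<Longrightarrow> open T \<Longrightarrow> D_fun S k f \<Longrightarrow> D_fun T k f \<Longrightarrow> D_fun (S \<union> T) k f"
  by (induction k arbitrary: f) (auto intro: continuous_on_open_Un)

lemma D_fun_powr: "D_fun {0<..} k (\<lambda>x. x powr c)"
proof (induction k arbitrary: c)
  case 0
  then show ?case by (auto intro!: continuous_intros)
next
  case (Suc k)
  show ?case
    by (rule D_fun_SucI[where f' = "\<lambda>x. c * x powr (c - 1)"])
      (auto intro!: D_fun_mult D_fun_const Suc has_real_derivative_powr)
qed

lemma D_fun_ln: "D_fun {0<..} k ln"
proof (cases k)
  case 0
  then show ?thesis by (auto intro!: continuous_intros)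
next
  case (Suc m)
  show ?thesis unfolding Suc
    by (rule D_fun_SucI[OF _ _ D_fun_powr[of m "-1"]])
      (auto intro!: derivative_eq_intros simp: powr_minus divide_simps)
qed

lemma D_fun_real_polynomial: "real_polynomial_function p \<Longrightarrow> D_fun UNIV k p"
proof (induction rule: real_polynomial_function.induct)
  case (linear f)
  obtain c where "f = (\<lambda>x. x * c)"
    using linear by (auto simp: real_bounded_linear)
  then show ?case
    using D_fun_mult[OF _ D_fun_ident[of UNIV] D_fun_const[of UNIV k c]] by simp
qed (auto intro: D_fun_const D_fun_add D_fun_mult)

text \<open>The case \<open>j = 0\<close> is the classical smooth function that is flat at 0.
  Dividing by \<open>x ^ j\<close> makes the family closed under differentiation up to linear
  combinations, so one induction gives smoothness of all members.\<close>

definition flat_exp :: "nat \<Rightarrow> real \<Rightarrow> real" where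
  "flat_exp j x = (if x > 0 then exp (- 1 / x) / x ^ j else 0)"

lemma flat_exp_deriv:
  "(flat_exp j has_field_derivative flat_exp (j + 2) x - real j * flat_exp (j + 1) x) (at x)"
proof -
  consider "x > 0" | "x = 0" | "x < 0" by linarith
  then show ?thesis
  proof cases
    case 1
    have "((\<lambda>x. exp (- 1 / x) / x ^ j) has_field_derivative flat_exp (j + 2) x - real j * flat_exp (j + 1) x) (at x)"
      using 1 
      apply (auto intro!: derivative_eq_intros simp: flat_exp_def)
      apply (cases j)
      apply (auto simp: divide_simps power2_eq_square)
      apply (simp add: algebra_simps)
      done
    then show ?thesis
      by (rule has_field_derivative_transform_within_open[of _ _ _ "{0<..}"])
        (use 1 in \<open>auto simp: flat_exp_def\<close>)
  next
    case 2
    \<comment> \<open>From the right, the substitution \<open>h = inverse t\<close> turns the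
      quotient into \<open>t ^ Suc j / exp t\<close>; from the left it is identically zero.\<close>
    have "(\<lambda>h. flat_exp j h / h) \<midarrow>0\<rightarrow> 0"
    proof -
      have "((\<lambda>t::real. t ^ Suc j / exp t) \<longlongrightarrow> 0) at_top"
        by (rule tendsto_power_div_exp_0)
      then have "((\<lambda>h. (inverse h) ^ Suc j / exp (inverse h)) \<longlongrightarrow> (0::real)) (at_right 0)"
        by (rule filterlim_compose[OF _ filterlim_inverse_at_top_right])
      then have "((\<lambda>h. flat_exp j h / h) \<longlongrightarrow> 0) (at_right 0)"
        by (rule Lim_transform_eventually)
          (auto simp: eventually_at_right_field flat_exp_def exp_minus field_simps intro!: exI[of _ 1])
      moreover have "((\<lambda>h. flat_exp j h / h) \<longlongrightarrow> 0) (at_left 0)"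
        by (rule tendsto_eventually)
          (auto simp: eventually_at_left_field flat_exp_def intro!: exI[of _ "-1"])
      ultimately show ?thesis
        using filterlim_split_at_real by blast
    qed
    then show ?thesis using 2 by (auto simp: DERIV_def flat_exp_def)
  next
    case 3
    have "((\<lambda>x. 0) has_field_derivative flat_exp (j + 2) x - real j * flat_exp (j + 1) x) (at x)"
      using 3 by (auto simp: flat_exp_def)
    then show ?thesis
      by (rule has_field_derivative_transform_within_open[of _ _ _ "{..<0}"])
        (use 3 in \<open>auto simp: flat_exp_def\<close>)
  qed
qed

lemma D_fun_flat_exp: "D_fun UNIV k (flat_exp j)"
proof (induction k arbitrary: j)
  case 0
  show ?case
    using DERIV_isCont[OF flat_exp_deriv] by (auto simp: continuous_on_eq_continuous_at)
next
  case (Suc k)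
  have "D_fun UNIV k (\<lambda>x. flat_exp (j + 2) x + (- real j) * flat_exp (j + 1) x)"
    by (intro D_fun_add D_fun_mult D_fun_const Suc) auto
  then show ?case
    by (intro D_fun_SucI[OF _ flat_exp_deriv]) auto
qed

text \<open>The polynomial \<open>x \<bullet> x\<close> replaces the norm, which is not
  differentiable at the origin. A partial derivative is again of the form
  \<open>G' (x \<bullet> x)\<close> times a linear function, so the induction runs over all
  \<open>G\<close> at once.\<close>

lemma C_fun_radial:
  fixes G :: "real \<Rightarrow> real"
  shows "D_fun UNIV k G \<Longrightarrow> C_fun k (\<lambda>x::'a::euclidean_space. G (x \<bullet> x))"
proof (induction k arbitrary: G)
  case 0
  then show ?case by (auto intro!: continuous_intros continuous_on_compose2[of UNIV G])
next
  case (Suc k)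
  show ?case
  proof (rule C_fun_SucI)
    show "((\<lambda>x::'a. G (x \<bullet> x)) has_derivative (\<lambda>h. deriv G (x \<bullet> x) * (2 * (x \<bullet> h)))) (at x)" for x
      by (rule DERIV_compose_FDERIV[OF D_fun_deriv[OF Suc.prems], THEN has_derivative_eq_rhs])
        (auto intro!: derivative_eq_intros simp: inner_commute)
    show "C_fun k (\<lambda>x::'a. deriv G (x \<bullet> x) * (2 * (x \<bullet> b)))" for b
      using Suc by (intro C_fun_mult C_fun_const C_fun_inner Suc.IH) auto
  qed
qed

section \<open>Polar coordinates\<close>

lemma nn_integral_scale:
  fixes F :: "'a::euclidean_space \<Rightarrow> ennreal"
  assumes [measurable]: "F \<in> borel_measurable borel" and "c > 0"
  shows "(\<integral>\<^sup>+x. F x \<partial>lborel) = ennreal (c ^ DIM('a)) * (\<integral>\<^sup>+x. F (c *\<^sub>R x) \<partial>lborel)"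
proof -
  have "(\<integral>\<^sup>+x. F x \<partial>lborel) = (\<integral>\<^sup>+x. F x \<partial>density (distr lborel borel (\<lambda>x::'a. 0 + c *\<^sub>R x)) (\<lambda>_. ennreal (\<bar>c\<bar> ^ DIM('a))))"
    using lborel_affine[of c "0::'a"] \<open>c > 0\<close> by simp
  also have "\<dots> = ennreal (c ^ DIM('a)) * (\<integral>\<^sup>+x. F (c *\<^sub>R x) \<partial>lborel)"
    using \<open>c > 0\<close> by (simp add: nn_integral_density nn_integral_distr nn_integral_cmult)
  finally show ?thesis .
qed

text \<open>Read with \<open>a = norm x\<close>, the right-hand side is the inverse of the factor
  \<open>norm x ^ n\<close> that rescaling produces in \<open>nn_integral_polar\<close>; this
  cancellation closes that proof.\<close>

lemma nn_integral_power_tail: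
  assumes "n > 0" "a > 0"
  shows "(\<integral>\<^sup>+r. ennreal (real n * inverse (r ^ Suc n)) * indicator {a<..} r \<partial>lborel) = ennreal (inverse (a ^ n))"
proof -
  have "(\<integral>\<^sup>+r. ennreal (real n * inverse (r ^ Suc n)) * indicator {a<..} r \<partial>lborel) =
      (\<integral>\<^sup>+r. ennreal (real n * inverse (r ^ Suc n)) * indicator {a..} r \<partial>lborel)"
    by (rule nn_integral_cong_AE) (use AE_lborel_singleton[of a] in \<open>auto split: split_indicator\<close>)
  also have "\<dots> = ennreal (0 - (- inverse (a ^ n)))"
  proof (rule nn_integral_FTC_atLeast)
    show "((\<lambda>r. - inverse (r ^ n)) has_real_derivative real n * inverse (x ^ Suc n)) (at x)" if "a \<le> x" for x
    proof -
      obtain m where m: "n = Suc m" using assms(1) gr0_implies_Suc by blast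
      have "((\<lambda>r. - inverse (r ^ n)) has_real_derivative inverse (x ^ n) * (real n * x ^ m) * inverse (x ^ n)) (at x)"
        using that assms m by (auto intro!: derivative_eq_intros simp del: power_Suc)
      moreover have "inverse (x ^ n) * (real n * x ^ m) * inverse (x ^ n) = real n * inverse (x ^ Suc n)"
        using that assms m by (simp add: divide_simps)
      ultimately show ?thesis by simp
    qed
    show "((\<lambda>r::real. - inverse (r ^ n)) \<longlongrightarrow> 0) at_top"
      using tendsto_minus[OF tendsto_inverse_0_at_top[OF filterlim_pow_at_top[OF assms(1) filterlim_ident]]] by simp
  qed (use assms in auto)
  finally show ?thesis by simp
qed

lemma sgn_measurable [measurable]: "(sgn :: 'a::euclidean_space \<Rightarrow> 'a) \<in> borel_measurable borel"
  unfolding sgn_div_norm[abs_def] by measurable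

text \<open>
  The radial integral is rescaled by \<open>|x|\<close> and the two integrations are exchanged twice, so that
  no surface measure is needed.
\<close>

lemma nn_integral_polar:
  fixes F :: "'a::euclidean_space \<Rightarrow> ennreal"
  assumes [measurable]: "F \<in> borel_measurable borel"
  shows "(\<integral>\<^sup>+x. F x \<partial>lborel) =
    (\<integral>\<^sup>+x. (\<integral>\<^sup>+r. F (r *\<^sub>R sgn x) * ennreal (real DIM('a) * r ^ (DIM('a) - 1)) * indicator {0<..} r \<partial>lborel)
      * indicator (ball 0 1) x \<partial>lborel)"
proof -
  define n where "n = DIM('a)"
  have n: "n > 0" by (simp add: n_def)
  have [measurable]: "ball (0::'a) 1 \<in> sets borel" by simp
  \<comment> \<open>\<open>?A\<close> is the integrand after \<open>r\<close> is replaced by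
    \<open>norm x * r\<close>, which removes \<open>sgn\<close>. \<open>?B\<close> arises from it by
    replacing \<open>x\<close> by \<open>x / r\<close> in the inner integral: the condition
    \<open>norm x < 1\<close> becomes \<open>norm x < r\<close>.\<close>
  let ?A = "\<lambda>r x. F (r *\<^sub>R x) * ennreal (real n * r ^ (n - 1)) * indicator {0<..} r * ennreal (norm x ^ n) * indicator (ball 0 1) x"
  let ?B = "\<lambda>r x. F x * ennreal (norm x ^ n) * (ennreal (real n * inverse (r ^ Suc n)) * indicator {norm x<..} r)"
  have AE0: "AE x in lborel. x \<noteq> (0::'a)" by (rule AE_lborel_singleton)
  have "(\<integral>\<^sup>+x. (\<integral>\<^sup>+r. F (r *\<^sub>R sgn x) * ennreal (real n * r ^ (n - 1)) * indicator {0<..} r \<partial>lborel)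
      * indicator (ball 0 1) x \<partial>lborel) =
    (\<integral>\<^sup>+x. (\<integral>\<^sup>+r. ?A r x \<partial>lborel)
       \<partial>lborel)"
  proof (rule nn_integral_cong_AE, use AE0 in eventually_elim)
    fix x :: 'a assume x: "x \<noteq> 0"
    have "(\<integral>\<^sup>+r. F (r *\<^sub>R sgn x) * ennreal (real n * r ^ (n - 1)) * indicator {0<..} r \<partial>lborel) =
       ennreal (norm x ^ DIM(real)) * (\<integral>\<^sup>+r. F ((norm x *\<^sub>R r) *\<^sub>R sgn x) * ennreal (real n * (norm x *\<^sub>R r) ^ (n - 1)) * indicator {0<..} (norm x *\<^sub>R r) \<partial>lborel)"
      by (rule nn_integral_scale) (use x in auto)
    also have "\<dots> = ennreal (norm x) * (\<integral>\<^sup>+r. F (r *\<^sub>R x) * ennreal (real n * (norm x * r) ^ (n - 1)) * indicator {0<..} r \<partial>lborel)"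
    proof -
      have "(norm x * r) *\<^sub>R sgn x = r *\<^sub>R x" for r
        using x by (simp add: sgn_div_norm)
      then show ?thesis
        using x by (simp add: zero_less_mult_iff indicator_def)
    qed
    also have "\<dots> = (\<integral>\<^sup>+r. F (r *\<^sub>R x) * ennreal (real n * r ^ (n - 1)) * indicator {0<..} r * ennreal (norm x ^ n) \<partial>lborel)"
    proof -
      have *: "ennreal (norm x) * ennreal (real n * (norm x * r) ^ (n - 1)) = ennreal (real n * r ^ (n - 1)) * ennreal (norm x ^ n)" if "r > 0" for r
        using that n by (cases n) (auto simp: ennreal_mult[symmetric] power_mult_distrib algebra_simps)
      have **: "ennreal (norm x) * (y * ennreal (real n * (norm x * r) ^ (n - 1))) = y * (ennreal (real n * r ^ (n - 1)) * ennreal (norm x ^ n))" if "r > 0" for r y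
        by (subst mult.left_commute) (simp only: *[OF that])
      show ?thesis
        by (subst nn_integral_cmult[symmetric], simp, rule nn_integral_cong)
          (use ** in \<open>auto simp: indicator_def mult.assoc\<close>)
    qed
    finally show "(\<integral>\<^sup>+r. F (r *\<^sub>R sgn x) * ennreal (real n * r ^ (n - 1)) * indicator {0<..} r \<partial>lborel) * indicator (ball 0 1) x =
      (\<integral>\<^sup>+r. ?A r x \<partial>lborel)"
      by (simp add: nn_integral_multc)
  qed
  also have "\<dots> = (\<integral>\<^sup>+r. (\<integral>\<^sup>+x. ?A r x \<partial>lborel) \<partial>lborel)"
    by (rule lborel_pair.Fubini') measurable
  also have "\<dots> = (\<integral>\<^sup>+r. (\<integral>\<^sup>+x. ?B r x \<partial>lborel) \<partial>lborel)"
  proof (rule nn_integral_cong)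
    fix r :: real
    show "(\<integral>\<^sup>+x. ?A r x \<partial>lborel) =
      (\<integral>\<^sup>+x. ?B r x \<partial>lborel)"
    proof (cases "r > 0")
      case True
      have "(\<integral>\<^sup>+x. ?B r x \<partial>lborel) =
        ennreal (r ^ n) * (\<integral>\<^sup>+x. F (r *\<^sub>R x) * ennreal (norm (r *\<^sub>R x) ^ n) * (ennreal (real n * inverse (r ^ Suc n)) * indicator {norm (r *\<^sub>R x)<..} r) \<partial>lborel)"
        unfolding n_def by (rule nn_integral_scale[OF _ True]) (unfold indicator_def greaterThan_iff, measurable)
      also have "\<dots> = (\<integral>\<^sup>+x. ?A r x \<partial>lborel)"
      proof -
        have *: "ennreal (r ^ n) * (ennreal (norm (r *\<^sub>R x) ^ n) * ennreal (real n * inverse (r ^ Suc n)))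
            = ennreal (real n * r ^ (n - 1)) * ennreal (norm x ^ n)" for x :: 'a
        proof -
          have "r ^ n * (norm (r *\<^sub>R x) ^ n * (real n * inverse (r ^ Suc n))) = (real n * r ^ (n - 1)) * norm x ^ n"
            using True n by (cases n) (simp_all add: power_mult_distrib divide_simps del: of_nat_Suc)
          moreover have "0 \<le> r ^ n" "0 \<le> norm (r *\<^sub>R x) ^ n" "0 \<le> real n * inverse (r ^ Suc n)" "0 \<le> real n * r ^ (n - 1)" "0 \<le> norm x ^ n"
            using True by auto
          ultimately show ?thesis
            by (metis ennreal_mult mult_nonneg_nonneg)
        qed
        have ***: "ennreal (r ^ n) * (y * (ennreal (norm (r *\<^sub>R x) ^ n) * ennreal (real n * inverse (r ^ Suc n))))
            = y * (ennreal (real n * r ^ (n - 1)) * ennreal (norm x ^ n))" for x :: 'a and y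
          by (subst mult.left_commute) (simp only: *)
        have **: "indicator {norm (r *\<^sub>R x)<..} r = (indicator (ball 0 1) x :: ennreal)" for x :: 'a
          using True by (auto simp: indicator_def)
        show ?thesis unfolding **
          by (subst nn_integral_cmult[symmetric], measurable, rule nn_integral_cong)
            (use *** True in \<open>auto simp: mult.assoc simp del: norm_scaleR power_Suc split: split_indicator\<close>)
      qed
      finally show ?thesis by simp
    next
      case False
      then have "indicator {norm x<..} r = (0::ennreal)" for x :: 'a
        using norm_ge_zero[of x] by (auto simp: indicator_def simp del: norm_ge_zero)
      then show ?thesis using False by simp
    qed
  qed
  also have "\<dots> = (\<integral>\<^sup>+x. (\<integral>\<^sup>+r. ?B r x \<partial>lborel) \<partial>lborel)"
    by (rule lborel_pair.Fubini'[symmetric]) (unfold indicator_def greaterThan_iff, measurable)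
  also have "\<dots> = (\<integral>\<^sup>+x. F x \<partial>lborel)"
  proof (rule nn_integral_cong_AE, use AE0 in eventually_elim)
    fix x :: 'a assume x: "x \<noteq> 0"
    have "(\<integral>\<^sup>+r. ?B r x \<partial>lborel)
      = F x * ennreal (norm x ^ n) * ennreal (inverse (norm x ^ n))"
      using x n by (subst nn_integral_cmult, simp, subst nn_integral_power_tail) auto
    also have "\<dots> = F x" using x by (simp add: mult.assoc ennreal_mult[symmetric])
    finally show "(\<integral>\<^sup>+r. ?B r x \<partial>lborel) = F x" .
  qed
  finally show ?thesis by (simp add: n_def)
qed

text \<open>Surface measure of the unit sphere divided by \<open>DIM('a)\<close>: its total mass is
  the volume of the unit ball, and the missing factor \<open>DIM('a)\<close> sits in the radial
  density. As a measure on the whole space it needs no type of spheres.\<close>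

definition cone_measure :: "'a::euclidean_space measure" where
  "cone_measure = distr (restrict_space lborel (ball 0 1)) borel sgn"

lemma sets_cone_measure [measurable_cong, simp]: "sets cone_measure = sets borel"
  and space_cone_measure [simp]: "space cone_measure = UNIV"
  by (simp_all add: cone_measure_def)

lemma sgn_measurable_ball [measurable]:
  "(sgn :: 'a::euclidean_space \<Rightarrow> 'a) \<in> measurable (restrict_space lborel (ball 0 1)) borel"
  by (rule measurable_restrict_space1) measurable

lemma nn_integral_cone_measure:
  assumes [measurable]: "f \<in> borel_measurable (borel :: 'a::euclidean_space measure)"
  shows "(\<integral>\<^sup>+x. f x \<partial>cone_measure) = (\<integral>\<^sup>+x. f (sgn x) * indicator (ball 0 1) x \<partial>lborel)"
  unfolding cone_measure_def
  by (subst nn_integral_distr) (auto simp: nn_integral_restrict_space)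

lemma emeasure_cone_measure_UNIV:
  "emeasure (cone_measure :: 'a::euclidean_space measure) UNIV = ennreal (measure lborel (ball (0::'a) 1))"
  unfolding cone_measure_def
  using emeasure_lborel_ball_finite[of "0::'a" 1]
  by (subst emeasure_distr) (auto simp: emeasure_restrict_space space_restrict_space emeasure_eq_ennreal_measure measure_restrict_space)

lemma finite_cone_measure: "finite_measure (cone_measure :: 'a::euclidean_space measure)"
  by (rule finite_measureI) (simp add: emeasure_cone_measure_UNIV)

lemma AE_cone_measure_norm: "AE x in (cone_measure :: 'a::euclidean_space measure). norm x = 1"
  unfolding cone_measure_def
proof (subst AE_distr_iff)
  have "AE x in lborel. x \<noteq> (0::'a)" by (rule AE_lborel_singleton)
  then show "AE x in restrict_space lborel (ball (0::'a) 1). norm (sgn x) = 1"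
    by (subst AE_restrict_space_iff) (auto simp: norm_sgn)
qed auto

lemma nn_integral_polar':
  fixes F :: "'a::euclidean_space \<Rightarrow> ennreal"
  assumes [measurable]: "F \<in> borel_measurable borel"
  shows "(\<integral>\<^sup>+x. F x \<partial>lborel) =
    (\<integral>\<^sup>+x. (\<integral>\<^sup>+r. F (r *\<^sub>R x) * ennreal (real DIM('a) * r ^ (DIM('a) - 1)) * indicator {0<..} r \<partial>lborel)
      \<partial>cone_measure)"
  by (subst nn_integral_cone_measure) (measurable, subst nn_integral_polar, auto)

text \<open>Writing polar coordinates as an identity of measures makes them available for signed
  integrands, as in the boundary term of the Hardy identity.\<close>

definition polar_measure :: "(real \<times> 'a::euclidean_space) measure" where
  "polar_measure = density (lborel \<Otimes>\<^sub>M cone_measure)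
     (\<lambda>(r, x). ennreal (real DIM('a) * r ^ (DIM('a) - 1)) * indicator {0<..} r)"

lemma lborel_eq_polar:
  "(lborel :: 'a::euclidean_space measure) = distr polar_measure borel (\<lambda>(r, x). r *\<^sub>R x)"
proof (rule measure_eqI)
  interpret finite_measure "cone_measure :: 'a measure" by (rule finite_cone_measure)
  interpret pair_sigma_finite lborel "cone_measure :: 'a measure" ..
  fix A :: "'a set" assume "A \<in> sets lborel"
  then have [measurable]: "A \<in> sets borel" by simp
  have "emeasure (distr polar_measure borel (\<lambda>(r, x). r *\<^sub>R x)) A = (\<integral>\<^sup>+z. indicator A z \<partial>distr polar_measure borel (\<lambda>(r, x::'a). r *\<^sub>R x))"
    by simp
  also have "\<dots> = (\<integral>\<^sup>+p. indicator A (fst p *\<^sub>R snd p) \<partial>polar_measure)"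
    by (subst nn_integral_distr) (auto simp: polar_measure_def case_prod_beta)
  also have "\<dots> = (\<integral>\<^sup>+p. indicator A (fst p *\<^sub>R snd p) * (ennreal (real DIM('a) * fst p ^ (DIM('a) - 1)) * indicator {0<..} (fst p)) \<partial>(lborel \<Otimes>\<^sub>M cone_measure))"
    unfolding polar_measure_def by (subst nn_integral_density) (auto simp: case_prod_beta mult.commute)
  also have "\<dots> = (\<integral>\<^sup>+x. (\<integral>\<^sup>+r. indicator A (r *\<^sub>R x) * (ennreal (real DIM('a) * r ^ (DIM('a) - 1)) * indicator {0<..} r) \<partial>lborel) \<partial>cone_measure)"
    by (subst nn_integral_snd[symmetric]) auto
  also have "\<dots> = (\<integral>\<^sup>+x. indicator A x \<partial>lborel)"
    by (subst nn_integral_polar') (auto simp: mult.assoc)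
  finally show "emeasure lborel A = emeasure (distr polar_measure borel (\<lambda>(r, x). r *\<^sub>R x)) A"
    by simp
qed simp

section \<open>Change of variables on the line for nonnegative integrals\<close>

lemma absolutely_integral_iff_nn_integral:
  fixes f :: "'a::euclidean_space \<Rightarrow> real"
  assumes [measurable]: "f \<in> borel_measurable borel" "A \<in> sets borel" and f0: "\<And>x. 0 \<le> f x"
  shows "f absolutely_integrable_on A \<and> integral A f = b \<longleftrightarrow>
    0 \<le> b \<and> (\<integral>\<^sup>+x. ennreal (f x) * indicator A x \<partial>lborel) = ennreal b"
proof
  assume *: "f absolutely_integrable_on A \<and> integral A f = b"
  then have "(f has_integral b) A"
    using set_lebesgue_integral_eq_integral(1) by blast
  then have "integral\<^sup>N lborel (\<lambda>x. ennreal (indicator A x * f x)) = ennreal b"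
    using f0 by (intro nn_integral_has_integral_lebesgue) auto
  moreover have "ennreal (indicator A x * f x) = ennreal (f x) * indicator A x" for x
    by (auto split: split_indicator)
  moreover have "0 \<le> b" using * f0 by (auto intro: integral_nonneg set_lebesgue_integral_eq_integral(1))
  ultimately show "0 \<le> b \<and> (\<integral>\<^sup>+x. ennreal (f x) * indicator A x \<partial>lborel) = ennreal b"
    by simp
next
  assume *: "0 \<le> b \<and> (\<integral>\<^sup>+x. ennreal (f x) * indicator A x \<partial>lborel) = ennreal b"
  have "ennreal (if x \<in> A then f x else 0) = ennreal (f x) * indicator A x" for x
    by (auto split: split_indicator)
  then have "((\<lambda>x. if x \<in> A then f x else 0) has_integral b) UNIV"
    using f0 * by (intro nn_integral_has_integral) auto
  then have "(f has_integral b) A"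
    by (simp add: has_integral_restrict_UNIV)
  then show "f absolutely_integrable_on A \<and> integral A f = b"
    using f0 absolutely_integrable_on_iff_nonneg[of A f] by (auto simp: has_integral_iff)
qed

text \<open>An infinite value is recognised by being equal to no finite one. This matches the
  change-of-variables theorem, which speaks only of finite integrals.\<close>

lemma ennreal_eqI:
  assumes "\<And>b. 0 \<le> b \<Longrightarrow> x = ennreal b \<longleftrightarrow> y = ennreal b"
  shows "x = y"
proof (cases "x = top \<and> y = top")
  case False
  then obtain b where "0 \<le> b" "x = ennreal b \<or> y = ennreal b"
    by (metis ennreal_cases)
  then show ?thesis using assms by blast
qed simp

text \<open>Change of variables applied to indicators of Borel sets says that two measures coincide;
  integrating \<open>f\<close> against both gives the formula, also when the integrals are
  infinite.\<close>

lemma nn_integral_substitution_inj: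
  fixes f :: "real \<Rightarrow> ennreal" and g g' :: "real \<Rightarrow> real"
  assumes [measurable]: "f \<in> borel_measurable borel" "g \<in> borel_measurable borel"
      "g' \<in> borel_measurable borel" "A \<in> sets borel" "g ` A \<in> sets borel"
    and der: "\<And>x. x \<in> A \<Longrightarrow> (g has_field_derivative g' x) (at x)"
    and inj: "inj_on g A"
  shows "(\<integral>\<^sup>+y. f y * indicator (g ` A) y \<partial>lborel) = (\<integral>\<^sup>+x. ennreal \<bar>g' x\<bar> * f (g x) * indicator A x \<partial>lborel)"
proof -
  have eq: "density lborel (indicator (g ` A)) = distr (density lborel (\<lambda>x. ennreal \<bar>g' x\<bar> * indicator A x)) borel g"
  proof (rule measure_eqI)
    fix E assume "E \<in> sets (density lborel (indicator (g ` A)))"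
    then have [measurable]: "E \<in> sets borel" by simp
    then have [simp]: "g -` E \<in> sets borel" using measurable_sets[OF assms(2)] by simp
    have "0 \<le> b \<and> (\<integral>\<^sup>+x. ennreal (\<bar>g' x\<bar> * indicator E (g x)) * indicator A x \<partial>lborel) = ennreal b \<longleftrightarrow>
       0 \<le> b \<and> (\<integral>\<^sup>+y. ennreal (indicator E y) * indicator (g ` A) y \<partial>lborel) = ennreal b" for b
    proof -
      have "(\<lambda>x. \<bar>g' x\<bar> * indicator E (g x)) absolutely_integrable_on A \<and>
          integral A (\<lambda>x. \<bar>g' x\<bar> * indicator E (g x)) = b \<longleftrightarrow>
        (indicator E :: real \<Rightarrow> real) absolutely_integrable_on (g ` A) \<and> integral (g ` A) (indicator E) = b"
        by (intro has_absolute_integral_change_of_variables_1' DERIV_subset[OF der] inj) auto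
      moreover have "(\<lambda>x. \<bar>g' x\<bar> * indicator E (g x)) absolutely_integrable_on A \<and>
          integral A (\<lambda>x. \<bar>g' x\<bar> * indicator E (g x)) = b \<longleftrightarrow>
          0 \<le> b \<and> (\<integral>\<^sup>+x. ennreal (\<bar>g' x\<bar> * indicator E (g x)) * indicator A x \<partial>lborel) = ennreal b"
        by (rule absolutely_integral_iff_nn_integral) auto
      moreover have "(indicator E :: real \<Rightarrow> real) absolutely_integrable_on (g ` A) \<and> integral (g ` A) (indicator E) = b \<longleftrightarrow>
          0 \<le> b \<and> (\<integral>\<^sup>+y. ennreal (indicator E y) * indicator (g ` A) y \<partial>lborel) = ennreal b"
        by (rule absolutely_integral_iff_nn_integral) auto
      ultimately show ?thesis by blast
    qed
    then have "(\<integral>\<^sup>+y. ennreal (indicator E y) * indicator (g ` A) y \<partial>lborel) =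
      (\<integral>\<^sup>+x. ennreal (\<bar>g' x\<bar> * indicator E (g x)) * indicator A x \<partial>lborel)"
      by (intro ennreal_eqI) blast
    moreover have "emeasure (density lborel (indicator (g ` A))) E = (\<integral>\<^sup>+y. ennreal (indicator E y) * indicator (g ` A) y \<partial>lborel)"
      by (subst emeasure_density) (auto intro!: nn_integral_cong simp: mult.commute ennreal_indicator)
    moreover have "emeasure (distr (density lborel (\<lambda>x. ennreal \<bar>g' x\<bar> * indicator A x)) borel g) E
      = (\<integral>\<^sup>+x. ennreal (\<bar>g' x\<bar> * indicator E (g x)) * indicator A x \<partial>lborel)"
      by (subst emeasure_distr, simp, simp, subst emeasure_density)
        (auto intro!: nn_integral_cong split: split_indicator)
    ultimately show "emeasure (density lborel (indicator (g ` A))) E = emeasure (distr (density lborel (\<lambda>x. ennreal \<bar>g' x\<bar> * indicator A x)) borel g) E"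
      by simp
  qed simp
  have "(\<integral>\<^sup>+y. f y * indicator (g ` A) y \<partial>lborel) = (\<integral>\<^sup>+y. f y \<partial>density lborel (indicator (g ` A)))"
    by (subst nn_integral_density) (auto simp: mult.commute)
  also have "\<dots> = (\<integral>\<^sup>+x. ennreal \<bar>g' x\<bar> * f (g x) * indicator A x \<partial>lborel)"
    unfolding eq by (subst nn_integral_distr, simp, simp, subst nn_integral_density)
      (auto simp: mult_ac)
  finally show ?thesis .
qed

text \<open>The part of \<open>A\<close> that is mapped into an exceptional null set has integral
  zero against \<open>\<bar>g' x\<bar>\<close>; as this density is positive on \<open>A\<close>,
  that part is null.\<close>

lemma AE_substitution_inj:
  fixes g g' :: "real \<Rightarrow> real"
  assumes [measurable]: "g \<in> borel_measurable borel"
      "g' \<in> borel_measurable borel" "A \<in> sets borel" "g ` A \<in> sets borel"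
    and der: "\<And>x. x \<in> A \<Longrightarrow> (g has_field_derivative g' x) (at x)"
    and inj: "inj_on g A" and nz: "\<And>x. x \<in> A \<Longrightarrow> g' x \<noteq> 0"
  shows "(AE y in lborel. y \<in> g ` A \<longrightarrow> P y) \<Longrightarrow> (AE x in lborel. x \<in> A \<longrightarrow> P (g x))"
proof -
  assume "AE y in lborel. y \<in> g ` A \<longrightarrow> P y"
  then obtain N where N: "{y. \<not> (y \<in> g ` A \<longrightarrow> P y)} \<subseteq> N" "N \<in> null_sets lborel"
    by (auto elim!: AE_E simp: null_sets_def)
  have [measurable]: "N \<in> sets borel" using N(2) by auto
  have "(\<integral>\<^sup>+y. indicator N y * indicator (g ` A) y \<partial>lborel) \<le> (\<integral>\<^sup>+y. indicator N y \<partial>lborel)"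
    by (intro nn_integral_mono) (auto split: split_indicator)
  also have "\<dots> = 0" using N(2) by (simp add: null_sets_def)
  finally have "(\<integral>\<^sup>+x. ennreal \<bar>g' x\<bar> * indicator N (g x) * indicator A x \<partial>lborel) = 0"
    using nn_integral_substitution_inj[OF _ assms(1-6), of "indicator N"] by simp
  then have "AE x in lborel. ennreal \<bar>g' x\<bar> * indicator N (g x) * indicator A x = 0"
    by (subst (asm) nn_integral_0_iff_AE) auto
  then show ?thesis
    by eventually_elim (use N(1) nz in \<open>auto simp: indicator_def split: if_splits\<close>)
qed

text \<open>Fubini for null sets: the indicator of an exceptional set, integrated in polar
  coordinates, vanishes on almost every ray, and the radial density is positive for
  \<open>r > 0\<close>.\<close>

lemma AE_polar:
  assumes "AE x in (lborel :: 'a::euclidean_space measure). P x"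
  shows "AE \<omega> in cone_measure. AE r in lborel. 0 < r \<longrightarrow> P (r *\<^sub>R \<omega> :: 'a)"
proof -
  obtain N where N: "{x. \<not> P x} \<subseteq> N" "N \<in> null_sets (lborel :: 'a measure)"
    using assms by (auto elim!: AE_E simp: null_sets_def)
  have [measurable]: "N \<in> sets borel" using N(2) by auto
  have "(\<integral>\<^sup>+x. indicator N x \<partial>lborel) = 0" using N(2) by (simp add: null_sets_def)
  then have "AE \<omega> in cone_measure. (\<integral>\<^sup>+r. indicator N (r *\<^sub>R \<omega>) * ennreal (real DIM('a) * r ^ (DIM('a) - 1)) * indicator {0<..} r \<partial>lborel) = 0"
    by (subst (asm) nn_integral_polar') (auto simp: nn_integral_0_iff_AE)
  then show ?thesis
  proof eventually_elim
    fix \<omega> :: 'a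
    assume "(\<integral>\<^sup>+r. indicator N (r *\<^sub>R \<omega>) * ennreal (real DIM('a) * r ^ (DIM('a) - 1)) * indicator {0<..} r \<partial>lborel) = 0"
    then have "AE r in lborel. indicator N (r *\<^sub>R \<omega>) * ennreal (real DIM('a) * r ^ (DIM('a) - 1)) * indicator {0<..} r = 0"
      by (subst (asm) nn_integral_0_iff_AE) auto
    then show "AE r in lborel. 0 < r \<longrightarrow> P (r *\<^sub>R \<omega>)"
    proof eventually_elim
      fix r
      assume *: "indicator N (r *\<^sub>R \<omega>) * ennreal (real DIM('a) * r ^ (DIM('a) - 1)) * indicator {0<..} r = 0"
      show "0 < r \<longrightarrow> P (r *\<^sub>R \<omega>)"
      proof
        assume r: "0 < r"
        then have "0 < real DIM('a) * r ^ (DIM('a) - 1)" by simp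
        then have "ennreal (real DIM('a) * r ^ (DIM('a) - 1)) \<noteq> 0" by (simp add: ennreal_eq_0_iff del: of_nat_0_less_iff)
        then show "P (r *\<^sub>R \<omega>)" using * r N(1) by (auto simp: indicator_def split: if_splits)
      qed
    qed
  qed
qed

lemma nn_integral_radial:
  assumes [measurable]: "f \<in> borel_measurable borel"
  shows "(\<integral>\<^sup>+x. f (norm x) \<partial>(lborel :: 'a::euclidean_space measure)) =
    ennreal (real DIM('a) * measure lborel (ball (0::'a) 1)) *
    (\<integral>\<^sup>+r. f r * ennreal (r ^ (DIM('a) - 1)) * indicator {0<..} r \<partial>lborel)"
proof -
  have "(\<integral>\<^sup>+x. f (norm x) \<partial>(lborel :: 'a measure)) =
    (\<integral>\<^sup>+x. (\<integral>\<^sup>+r. f (norm (r *\<^sub>R x)) * ennreal (real DIM('a) * r ^ (DIM('a) - 1)) * indicator {0<..} r \<partial>lborel)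
      \<partial>(cone_measure :: 'a measure))"
    by (rule nn_integral_polar') simp
  also have "\<dots> = (\<integral>\<^sup>+x. ennreal (real DIM('a)) * (\<integral>\<^sup>+r. f r * ennreal (r ^ (DIM('a) - 1)) * indicator {0<..} r \<partial>lborel) \<partial>(cone_measure :: 'a measure))"
  proof (rule nn_integral_cong_AE, use AE_cone_measure_norm in eventually_elim)
    fix x :: 'a assume x: "norm x = 1"
    have e: "ennreal (real DIM('a) * r ^ (DIM('a) - 1)) = ennreal (real DIM('a)) * ennreal (r ^ (DIM('a) - 1))" for r
      by (rule ennreal_mult') simp
    show "(\<integral>\<^sup>+r. f (norm (r *\<^sub>R x)) * ennreal (real DIM('a) * r ^ (DIM('a) - 1)) * indicator {0<..} r \<partial>lborel) =
      ennreal (real DIM('a)) * (\<integral>\<^sup>+r. f r * ennreal (r ^ (DIM('a) - 1)) * indicator {0<..} r \<partial>lborel)"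
      unfolding e by (subst nn_integral_cmult[symmetric], simp, intro nn_integral_cong)
        (use x in \<open>auto simp: mult_ac split: split_indicator\<close>)
  qed
  also have "\<dots> = ennreal (real DIM('a) * measure lborel (ball (0::'a) 1)) *
    (\<integral>\<^sup>+r. f r * ennreal (r ^ (DIM('a) - 1)) * indicator {0<..} r \<partial>lborel)"
    by (simp add: emeasure_cone_measure_UNIV ennreal_mult' mult_ac)
  finally show ?thesis .
qed

text \<open>Leads back from one variable to the space: a null set of radii has measure zero for the
  radial density too. The origin is discarded separately, since \<open>P 0\<close> may fail.\<close>

lemma AE_radial:
  assumes "AE r in lborel. 0 < r \<longrightarrow> P r"
  shows "AE x in (lborel :: 'a::euclidean_space measure). P (norm x)"
proof -
  obtain N where N: "{r. \<not> (0 < r \<longrightarrow> P r)} \<subseteq> N" "N \<in> null_sets (lborel :: real measure)"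
    using assms by (auto elim!: AE_E simp: null_sets_def)
  have [measurable]: "N \<in> sets borel" using N(2) by auto
  have "AE r in lborel. r \<notin> N" using N(2) by (rule AE_not_in)
  then have "(\<integral>\<^sup>+r. indicator N r * ennreal (r ^ (DIM('a) - 1)) * indicator {0<..} r \<partial>lborel) = 0"
    by (subst nn_integral_0_iff_AE) (auto elim: eventually_mono)
  then have "(\<integral>\<^sup>+x. indicator N (norm x) \<partial>(lborel :: 'a measure)) = 0"
    by (subst nn_integral_radial) auto
  then have "AE x in (lborel :: 'a measure). indicator N (norm x) = (0::ennreal)"
    by (subst (asm) nn_integral_0_iff_AE) auto
  moreover have "AE x in lborel. x \<noteq> (0::'a)" by (rule AE_lborel_singleton)
  ultimately show ?thesis
    by eventually_elim (use N(1) in \<open>auto simp: indicator_def subset_iff zero_less_norm_iff[symmetric] simp del: zero_less_norm_iff split: if_splits\<close>)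
qed

section \<open>The Hardy energy of a test function\<close>

lemma grad_eqI:
  assumes "(f has_derivative (\<lambda>h. v \<bullet> h)) (at x)"
  shows "grad f x = v"
proof -
  have "frechet_derivative f (at x) = (\<lambda>h. v \<bullet> h)"
    using frechet_derivative_at[OF assms] by simp
  then show ?thesis by (simp add: grad_def euclidean_representation)
qed

lemma grad_has_derivative:
  assumes "f differentiable (at x)"
  shows "(f has_derivative (\<lambda>h. grad f x \<bullet> h)) (at x)"
proof -
  have d: "(f has_derivative frechet_derivative f (at x)) (at x)"
    using assms by (simp add: frechet_derivative_works)
  then have lin: "linear (frechet_derivative f (at x))" by (rule has_derivative_linear)
  have "frechet_derivative f (at x) h = grad f x \<bullet> h" for h
  proof -
    have "frechet_derivative f (at x) h = frechet_derivative f (at x) (\<Sum>b\<in>Basis. (h \<bullet> b) *\<^sub>R b)"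
      by (simp add: euclidean_representation)
    also have "\<dots> = (\<Sum>b\<in>Basis. (h \<bullet> b) * frechet_derivative f (at x) b)"
      using lin by (simp add: linear_sum linear_scale)
    also have "\<dots> = grad f x \<bullet> h"
      by (simp add: grad_def inner_sum_left inner_commute[of h] mult.commute)
    finally show ?thesis .
  qed
  then show ?thesis using d by (metis (no_types, lifting) ext)
qed

section \<open>Derivatives, supports and bounds of test functions\<close>

lemma test_C_fun: "f \<in> test_functions \<Omega> \<Longrightarrow> C_fun k f"
  by (simp add: test_functions_def)

lemma test_differentiable: "f \<in> test_functions \<Omega> \<Longrightarrow> f differentiable (at x)"
  using test_C_fun[of f \<Omega> "Suc 0"] by simp

lemma test_has_derivative:
  "f \<in> test_functions \<Omega> \<Longrightarrow> (f has_derivative (\<lambda>h. grad f x \<bullet> h)) (at x)"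
  by (rule grad_has_derivative[OF test_differentiable])

lemma test_continuous: "f \<in> test_functions \<Omega> \<Longrightarrow> continuous_on UNIV f"
  using test_C_fun[of f \<Omega> 0] by simp

lemma test_continuous_grad: "f \<in> test_functions \<Omega> \<Longrightarrow> continuous_on UNIV (grad f)"
  using test_C_fun[of f \<Omega> "Suc 0"] unfolding grad_def[abs_def]
  by (auto intro!: continuous_intros)

lemma test_measurable : "f \<in> test_functions \<Omega> \<Longrightarrow> f \<in> borel_measurable borel"
  by (rule borel_measurable_continuous_onI[OF test_continuous])

lemma test_measurable_grad: "f \<in> test_functions \<Omega> \<Longrightarrow> grad f \<in> borel_measurable borel"
  by (rule borel_measurable_continuous_onI[OF test_continuous_grad])

lemma test_diff:
  assumes "f \<in> test_functions \<Omega>" "g \<in> test_functions \<Omega>"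
  shows "(\<lambda>x. f x - g x) \<in> test_functions \<Omega>"
proof -
  have sub: "closure {x. f x - g x \<noteq> 0} \<subseteq> closure {x. f x \<noteq> 0} \<union> closure {x. g x \<noteq> 0}"
    unfolding closure_Un[symmetric] by (rule closure_mono) auto
  have "compact (closure {x. f x \<noteq> 0} \<union> closure {x. g x \<noteq> 0})"
    using assms by (auto simp: test_functions_def)
  then have "compact (closure {x. f x - g x \<noteq> 0})"
    using sub by (meson bounded_subset closed_closure compact_eq_bounded_closed)
  then show ?thesis
    using assms sub by (auto simp: test_functions_def intro: C_fun_diff)
qed

lemma grad_diff:
  assumes "f \<in> test_functions \<Omega>" "g \<in> test_functions \<Omega>"
  shows "grad (\<lambda>x. f x - g x) x = grad f x - grad g x"
  by (rule grad_eqI)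
    (use has_derivative_diff[OF assms[THEN test_has_derivative]] in \<open>simp add: inner_diff_left\<close>)

text \<open>A compact support inside the open ball leaves a margin \<open>R - r\<close>; in the
  logarithmic variable this margin keeps profiles away from \<open>s = 0\<close>.\<close>

lemma test_vanish:
  assumes "f \<in> test_functions (ball 0 R)" "R > 0"
  obtains r where "0 < r" "r < R" "\<And>x. norm x \<ge> r \<Longrightarrow> f x = 0 \<and> grad f x = 0"
proof -
  let ?K = "closure {x. f x \<noteq> 0}"
  have K: "compact ?K" "?K \<subseteq> ball 0 R" using assms by (auto simp: test_functions_def)
  obtain r0 where r0: "r0 < R" "\<And>x. x \<in> ?K \<Longrightarrow> norm x \<le> r0"
  proof (cases "?K = {}")
    case True
    then show ?thesis using assms(2) by (intro that[of 0]) auto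
  next
    case False
    have "continuous_on ?K norm" by (intro continuous_intros)
    then obtain x where x: "x \<in> ?K" "\<And>y. y \<in> ?K \<Longrightarrow> norm y \<le> norm x"
      using continuous_attains_sup[OF K(1) False] by blast
    show ?thesis by (rule that[of "norm x"]) (use x K(2) in auto)
  qed
  \<comment> \<open>Strictly above \<open>r0\<close>, so that points at distance exactly
    \<open>r\<close> lie in the open complement of the support and the gradient vanishes there as
    well.\<close>
  obtain r where r: "max r0 0 < r" "r < R"
    using dense[of "max r0 0" R] r0(1) assms(2) by auto
  show ?thesis
  proof (rule that[of r])
    fix x :: 'a assume "norm x \<ge> r"
    then have x: "x \<in> - ?K" using r0(2)[of x] r(1) by force
    have 0: "f y = 0" if "y \<in> - ?K" for y
      using that closure_subset[of "{x. f x \<noteq> 0}"] by auto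
    have "((\<lambda>x. 0) has_derivative (\<lambda>h. 0 \<bullet> h)) (at x)" by simp
    moreover have "open (- ?K)" by (rule open_Compl[OF closed_closure])
    ultimately have "(f has_derivative (\<lambda>h. 0 \<bullet> h)) (at x)"
      by (rule has_derivative_transform_within_open[OF _ _ x]) (erule 0[symmetric])
    then show "f x = 0 \<and> grad f x = 0" using grad_eqI[of f 0 x] 0[OF x] by simp
  qed (use r in auto)
qed

lemma test_in_ball:
  assumes "f \<in> test_functions \<Omega>"
  obtains R where "R > 0" "f \<in> test_functions (ball 0 R)"
proof -
  have "bounded (closure {x. f x \<noteq> 0})"
    using assms by (auto simp: test_functions_def compact_imp_bounded)
  then obtain R where "R > 0" "closure {x. f x \<noteq> 0} \<subseteq> ball 0 R"
    using bounded_subset_ballD by blast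
  then show ?thesis using assms that by (auto simp: test_functions_def)
qed

lemma bounded_if_vanishing_outside:
  fixes g :: "'a::euclidean_space \<Rightarrow> 'b::real_normed_vector"
  assumes g: "continuous_on UNIV g" and r: "\<And>x. norm x \<ge> r \<Longrightarrow> g x = 0"
  obtains C where "C > 0" "\<And>x. norm (g x) \<le> C"
proof -
  have "compact (g ` cball 0 r)"
    by (rule compact_continuous_image) (auto intro: continuous_on_subset[OF g])
  then obtain C where C: "C > 0" "\<And>x. x \<in> cball 0 r \<Longrightarrow> norm (g x) \<le> C"
    using compact_imp_bounded bounded_pos[of "g ` cball 0 r"] by auto
  have "norm (g x) \<le> C" for x using C r[of x] by (cases "norm x \<ge> r") auto
  then show ?thesis using C(1) that by blast
qed

lemma test_bounded_grad:
  assumes "f \<in> test_functions \<Omega>"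
  obtains C where "C > 0" "\<And>x. norm (grad f x) \<le> C"
proof -
  obtain R where R: "R > 0" "f \<in> test_functions (ball 0 R)" using test_in_ball[OF assms] .
  obtain r where "\<And>x. norm x \<ge> r \<Longrightarrow> f x = 0 \<and> grad f x = 0" using test_vanish[OF R(2,1)] by metis
  then show ?thesis
    using bounded_if_vanishing_outside[OF test_continuous_grad[OF assms], of r] that by blast
qed

lemma test_bounded:
  assumes "f \<in> test_functions \<Omega>"
  obtains C where "C > 0" "\<And>x. \<bar>f x\<bar> \<le> C"
proof -
  obtain R where R: "R > 0" "f \<in> test_functions (ball 0 R)" using test_in_ball[OF assms] .
  obtain r where "\<And>x. norm x \<ge> r \<Longrightarrow> f x = 0 \<and> grad f x = 0" using test_vanish[OF R(2,1)] by metis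
  then show ?thesis
    using bounded_if_vanishing_outside[OF test_continuous[OF assms], of r] that by (auto simp: real_norm_def)
qed

text \<open>Treats both norms at once: \<open>p = 0\<close> is the Dirichlet integral, and
  \<open>p = DIM('a) - 2\<close> is what the Hardy norm becomes after the singular factor is
  removed.\<close>

definition energy :: "real \<Rightarrow> ('a::euclidean_space \<Rightarrow> real) \<Rightarrow> real" where
  "energy p f = (LINT x|lborel. norm x powr (- p) * (norm (grad f x))\<^sup>2)"

lemma energy_nonneg: "0 \<le> energy p f"
  unfolding energy_def by (intro Bochner_Integration.integral_nonneg) auto

text \<open>The gradient is bounded with bounded support, and for \<open>p \<le> DIM('a) - 1\<close>
  the weight times the radial density is a nonnegative power of the radius, hence bounded near the
  origin.\<close>

lemma integrable_energy:
  fixes f :: "'a::euclidean_space \<Rightarrow> real"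
  assumes f: "f \<in> test_functions \<Omega>" and p: "0 \<le> p" "p \<le> real DIM('a) - 1"
  shows "integrable lborel (\<lambda>x. norm x powr (- p) * (norm (grad f x))\<^sup>2)"
proof -
  have [measurable]: "grad f \<in> borel_measurable borel" by (rule test_measurable_grad[OF f])
  obtain R where R: "R > 0" "f \<in> test_functions (ball 0 R)" using test_in_ball[OF f] .
  obtain C where C: "C > 0" "\<And>x. norm (grad f x) \<le> C" using test_bounded_grad[OF f] by metis
  obtain r where r: "r > 0" "\<And>x. norm x \<ge> r \<Longrightarrow> grad f x = 0" using test_vanish[OF R(2,1)] by metis
  let ?n = "DIM('a)" and ?\<omega> = "measure lborel (ball (0::'a) 1)"
  have "(\<integral>\<^sup>+x. ennreal (norm x powr (- p) * (norm (grad f x))\<^sup>2) \<partial>lborel) \<le>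
    (\<integral>\<^sup>+x. ennreal (norm x powr (- p) * C\<^sup>2 * indicator {..r} (norm x)) \<partial>(lborel :: 'a measure))"
  proof (intro nn_integral_mono ennreal_leI)
    fix x :: 'a
    show "norm x powr (- p) * (norm (grad f x))\<^sup>2 \<le> norm x powr (- p) * C\<^sup>2 * indicator {..r} (norm x)"
      using r C by (cases "norm x \<le> r") (auto intro!: mult_left_mono power_mono)
  qed
  also have "\<dots> = ennreal (real ?n * ?\<omega>) * (\<integral>\<^sup>+t. ennreal (t powr (- p) * C\<^sup>2 * indicator {..r} t) * ennreal (t ^ (?n - 1)) * indicator {0<..} t \<partial>lborel)"
    by (rule nn_integral_radial) simp
  also have "\<dots> \<le> ennreal (real ?n * ?\<omega>) * (\<integral>\<^sup>+t. ennreal (C\<^sup>2 * r powr (real ?n - 1 - p)) * indicator {0..r} t \<partial>lborel)"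
  proof (intro mult_left_mono nn_integral_mono)
    fix t :: real
    have "t powr (- p) * t ^ (?n - 1) \<le> r powr (real ?n - 1 - p)" if "0 < t" "t \<le> r"
    proof -
      have "t powr (- p) * t ^ (?n - 1) = t powr (real ?n - 1 - p)"
        using that by (simp add: powr_realpow[symmetric] powr_add[symmetric] of_nat_diff)
      also have "\<dots> \<le> r powr (real ?n - 1 - p)" using that p by (intro powr_mono2) auto
      finally show ?thesis .
    qed
    from mult_left_mono[OF this, of "C\<^sup>2"]
    have "t powr (- p) * (C\<^sup>2 * t ^ (?n - 1)) \<le> C\<^sup>2 * r powr (real ?n - 1 - p)" if "0 < t" "t \<le> r"
      using that by (simp add: mult_ac)
    then show "ennreal (t powr (- p) * C\<^sup>2 * indicator {..r} t) * ennreal (t ^ (?n - 1)) * indicator {0<..} t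
      \<le> ennreal (C\<^sup>2 * r powr (real ?n - 1 - p)) * indicator {0..r} t"
      by (auto simp: ennreal_mult[symmetric] mult_ac intro!: ennreal_leI split: split_indicator)
  qed auto
  also have "\<dots> < \<infinity>"
    using r(1) by (simp add: nn_integral_cmult ennreal_mult_less_top)
  finally show ?thesis
    by (intro integrableI_nonneg) auto
qed

lemma nn_integral_energy:
  fixes f :: "'a::euclidean_space \<Rightarrow> real"
  assumes f: "f \<in> test_functions \<Omega>" and p: "0 \<le> p" "p \<le> real DIM('a) - 1"
  shows "(\<integral>\<^sup>+x. ennreal (norm x powr (- p) * (norm (grad f x))\<^sup>2) \<partial>lborel) = ennreal (energy p f)"
  unfolding energy_def by (rule nn_integral_eq_integral[OF integrable_energy[OF assms]]) auto

lemma dirichlet_norm_eq_energy: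
  fixes f :: "'a::euclidean_space \<Rightarrow> real"
  assumes "f \<in> test_functions \<Omega>"
  shows "dirichlet_norm f = sqrt (energy 0 f)"
proof -
  have [measurable]: "grad f \<in> borel_measurable borel" by (rule test_measurable_grad[OF assms])
  \<comment> \<open>The two integrands may differ at the origin, because
    \<open>0 powr 0 = 0\<close>.\<close>
  have "AE x in lborel. x \<noteq> (0::'a)" by (rule AE_lborel_singleton)
  then have "AE x in lborel. (norm (grad f x))\<^sup>2 = norm x powr (- 0) * (norm (grad f x))\<^sup>2"
    by eventually_elim simp
  then have "(LINT x|lborel. (norm (grad f x))\<^sup>2) = energy 0 f"
    unfolding energy_def by (intro integral_cong_AE) measurable
  then show ?thesis by (simp add: dirichlet_norm_def)
qed

section \<open>Spherical means near the origin and the functional L\<close>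

lemma tendsto_cone_integral:
  fixes f :: "'a::euclidean_space \<Rightarrow> real"
  assumes f: "continuous_on UNIV f" and C: "\<And>x. \<bar>f x\<bar> \<le> C"
  shows "((\<lambda>\<rho>. LINT \<omega>|cone_measure. f (\<rho> *\<^sub>R \<omega>)) \<longlongrightarrow> measure lborel (ball (0::'a) 1) * f 0) (at_right 0)"
proof -
  interpret finite_measure "cone_measure :: 'a measure" by (rule finite_cone_measure)
  have [measurable]: "f \<in> borel_measurable borel" by (rule borel_measurable_continuous_onI[OF f])
  have m: "measure (cone_measure :: 'a measure) UNIV = measure lborel (ball (0::'a) 1)"
    by (simp add: measure_def emeasure_cone_measure_UNIV)
  have "(\<lambda>i. LINT \<omega>|cone_measure. f (X i *\<^sub>R \<omega>)) \<longlonglongrightarrow> (LINT \<omega>|(cone_measure :: 'a measure). f 0)"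
    if X: "X \<longlonglongrightarrow> 0" for X
  proof (rule integral_dominated_convergence[where w = "\<lambda>_. C"])
    have "isCont f 0" using f by (simp add: continuous_on_eq_continuous_at)
    then show "AE \<omega> in cone_measure. (\<lambda>i. f (X i *\<^sub>R \<omega>)) \<longlonglongrightarrow> f 0"
      by (intro AE_I2 isCont_tendsto_compose[of 0 f]) (auto intro!: tendsto_eq_intros X)
  qed (use C in auto)
  then show ?thesis
    unfolding tendsto_at_iff_sequentially by (simp add: m o_def)
qed

lemma surface_measure_eq:
  "surface_measure \<rho> = density (distr cone_measure borel (\<lambda>\<omega>::'a::euclidean_space. \<rho> *\<^sub>R \<omega>))
     (\<lambda>_. ennreal (real DIM('a) * \<rho> ^ (DIM('a) - 1)))"
proof -
  have "(\<lambda>x::'a. (\<rho> / norm x) *\<^sub>R x) = (\<lambda>\<omega>. \<rho> *\<^sub>R \<omega>) \<circ> sgn"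
    by (auto simp: sgn_div_norm divide_inverse)
  then have "distr (restrict_space lborel (ball 0 1)) borel (\<lambda>x::'a. (\<rho> / norm x) *\<^sub>R x) =
    distr cone_measure borel (\<lambda>\<omega>::'a. \<rho> *\<^sub>R \<omega>)"
    unfolding cone_measure_def by (subst distr_distr) auto
  then show ?thesis
    unfolding surface_measure_def by (auto intro!: measure_eqI simp: emeasure_density nn_integral_cmult)
qed

text \<open>The factor \<open>DIM('a) * \<rho> ^ (DIM('a) - 1)\<close> of the surface measure
  cancels in the mean value, and the whole mass of the cone measure lies on the unit sphere.\<close>

lemma radial_part_eq:
  fixes u :: "'a::euclidean_space \<Rightarrow> real"
  assumes [measurable]: "u \<in> borel_measurable borel" and \<rho>: "\<rho> > 0"
  shows "radial_part u \<rho> = (LINT \<omega>|cone_measure. u (\<rho> *\<^sub>R \<omega>)) / measure lborel (ball (0::'a) 1)"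
proof -
  let ?c = "real DIM('a) * \<rho> ^ (DIM('a) - 1)"
  have c: "?c > 0" using \<rho> by simp
  have 1: "(LINT x|surface_measure \<rho>. u x) = ?c * (LINT \<omega>|cone_measure. u (\<rho> *\<^sub>R \<omega>))"
    using c unfolding surface_measure_eq by (subst integral_density) (auto simp: integral_distr)
  have "emeasure (distr cone_measure borel (\<lambda>\<omega>::'a. \<rho> *\<^sub>R \<omega>)) (sphere 0 \<rho>) =
      emeasure (cone_measure :: 'a measure) {\<omega>. norm \<omega> = 1}"
    using \<rho> by (subst emeasure_distr) (auto intro!: arg_cong[of _ _ "emeasure cone_measure"])
  also have "\<dots> = emeasure (cone_measure :: 'a measure) UNIV"
    by (intro emeasure_eq_AE) (use AE_cone_measure_norm in auto)
  finally have 2: "emeasure (surface_measure \<rho> :: 'a measure) (sphere 0 \<rho>) = ennreal (?c * measure lborel (ball (0::'a) 1))"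
    unfolding surface_measure_eq using c
    by (subst emeasure_density, simp, simp, subst nn_integral_cmult_indicator)
      (simp_all add: emeasure_cone_measure_UNIV ennreal_mult'')
  show ?thesis
    unfolding radial_part_def 1 using c \<rho> by (simp add: measure_def[of "surface_measure \<rho>"] 2 del: of_nat_0_less_iff)
qed

text \<open>The ground state substitution: with \<open>a = (N - 2) / 2\<close>, the function
  |x|^(-a) solves \<open>- \<Delta> \<psi> = a^2 * \<psi> / |x|^2\<close> off the origin, so
  factoring it out removes the Hardy potential.\<close>

abbreviation hardy_fun :: "('a::euclidean_space \<Rightarrow> real) \<Rightarrow> 'a \<Rightarrow> real" where
  "hardy_fun f \<equiv> \<lambda>x. norm x powr (- hardy_exp TYPE('a)) * f x"

text \<open>On a sphere of radius \<open>\<rho>\<close> the factor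
  \<open>\<rho> powr hardy_exp\<close> undoes the singular factor, so the limit is that of the
  spherical means of \<open>f\<close>. The right-hand side is written in the form in which the
  boundary term of \<open>hardy_difference\<close> arrives.\<close>

lemma L_fun_hardy:
  fixes f :: "'a::euclidean_space \<Rightarrow> real"
  assumes f: "f \<in> test_functions \<Omega>" and n: "DIM('a) \<ge> 3"
  shows "(L_fun (hardy_fun f))\<^sup>2 =
    hardy_exp TYPE('a) * real DIM('a) * measure lborel (ball (0::'a) 1) * (f 0)\<^sup>2"
proof -
  let ?a = "hardy_exp TYPE('a)" and ?\<omega> = "measure lborel (ball (0::'a) 1)"
  have [measurable]: "f \<in> borel_measurable borel" by (rule test_measurable[OF f])
  obtain C where C: "\<And>x. \<bar>f x\<bar> \<le> C" using test_bounded[OF f] by metis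
  have w: "?\<omega> > 0" by (simp add: content_ball_pos)
  have "((\<lambda>\<rho>. \<rho> powr ?a * radial_part (hardy_fun f) \<rho>) \<longlongrightarrow> f 0) (at_right 0)"
  proof (rule Lim_transform_eventually)
    show "((\<lambda>\<rho>. (LINT \<omega>|cone_measure. f (\<rho> *\<^sub>R \<omega>)) / ?\<omega>) \<longlongrightarrow> f 0) (at_right 0)"
      using tendsto_divide[OF tendsto_cone_integral[OF test_continuous[OF f] C] tendsto_const[of ?\<omega>]] w by simp
    show "\<forall>\<^sub>F \<rho> in at_right 0. (LINT \<omega>|cone_measure. f (\<rho> *\<^sub>R \<omega>)) / ?\<omega> = \<rho> powr ?a * radial_part (hardy_fun f) \<rho>"
    proof (rule eventually_at_rightI[of 0 1])
      fix \<rho> :: real assume "\<rho> \<in> {0<..<1}"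
      then have \<rho>: "\<rho> > 0" by simp
      have "(LINT \<omega>|cone_measure. hardy_fun f (\<rho> *\<^sub>R \<omega>)) = (LINT \<omega>|cone_measure. \<rho> powr (- ?a) * f (\<rho> *\<^sub>R \<omega>))"
      proof (rule integral_cong_AE)
        show "AE \<omega> in cone_measure. hardy_fun f (\<rho> *\<^sub>R \<omega>) = \<rho> powr (- ?a) * f (\<rho> *\<^sub>R \<omega>)"
          using AE_cone_measure_norm by eventually_elim (use \<rho> in auto)
      qed auto
      then show "(LINT \<omega>|cone_measure. f (\<rho> *\<^sub>R \<omega>)) / ?\<omega> = \<rho> powr ?a * radial_part (hardy_fun f) \<rho>"
        using \<rho> by (subst radial_part_eq) (auto simp: powr_minus)
    qed simp
  qed
  then have "Lim (at_right 0) (\<lambda>\<rho>. \<rho> powr ?a * radial_part (hardy_fun f) \<rho>) = f 0"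
    by (rule tendsto_Lim[rotated]) simp
  then have "(L_fun (hardy_fun f))\<^sup>2 = (sqrt (real DIM('a) * (real DIM('a) - 2) / 2 * ?\<omega>))\<^sup>2 * (f 0)\<^sup>2"
    unfolding L_fun_def by (simp add: power_mult_distrib)
  also have "(sqrt (real DIM('a) * (real DIM('a) - 2) / 2 * ?\<omega>))\<^sup>2 = real DIM('a) * (real DIM('a) - 2) / 2 * ?\<omega>"
    using n w by simp
  finally show ?thesis by (simp add: hardy_exp_def)
qed

lemma grad_hardy_fun:
  fixes f :: "'a::euclidean_space \<Rightarrow> real"
  assumes f: "f \<in> test_functions \<Omega>" and x: "x \<noteq> 0"
  shows "grad (hardy_fun f) x = norm x powr (- hardy_exp TYPE('a)) *\<^sub>R grad f x
      - (hardy_exp TYPE('a) * norm x powr (- hardy_exp TYPE('a) - 2) * f x) *\<^sub>R x"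
proof (rule grad_eqI)
  let ?a = "hardy_exp TYPE('a)"
  have 1: "((\<lambda>x. norm x powr (- ?a)) has_derivative (\<lambda>h. (- ?a * norm x powr (- ?a - 1)) * (sgn x \<bullet> h))) (at x)"
    by (rule DERIV_compose_FDERIV[OF has_real_derivative_powr has_derivative_norm[OF x], THEN has_derivative_eq_rhs])
      (use x in \<open>auto simp: inner_commute\<close>)
  have 2: "norm x powr (- ?a - 1) = norm x powr (- ?a - 2) * norm x"
  proof -
    have "- ?a - 1 = (- ?a - 2) + 1" by simp
    then show ?thesis using x by (simp only: powr_add) simp
  qed
  show "(hardy_fun f has_derivative (\<lambda>h. (norm x powr (- ?a) *\<^sub>R grad f x
      - (?a * norm x powr (- ?a - 2) * f x) *\<^sub>R x) \<bullet> h)) (at x)"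
    by (rule has_derivative_mult[OF 1 test_has_derivative[OF f], THEN has_derivative_eq_rhs])
      (use x in \<open>auto simp: 2 inner_diff_left sgn_div_norm algebra_simps\<close>)
qed

text \<open>Expanding the square, the term with \<open>(f x)^2\<close> is exactly the Hardy
  potential and cancels; the cross term is \<open>- a\<close> times |x|^(-N) x . grad(f^2), because
  \<open>2 * a + 2 = N\<close>.\<close>

lemma hardy_identity:
  fixes f :: "'a::euclidean_space \<Rightarrow> real"
  assumes f: "f \<in> test_functions \<Omega>" and x: "x \<noteq> 0"
  shows "(norm (grad (hardy_fun f) x))\<^sup>2 - (hardy_exp TYPE('a))\<^sup>2 * ((hardy_fun f x)\<^sup>2 / (norm x)\<^sup>2) =
    norm x powr (- (real DIM('a) - 2)) * (norm (grad f x))\<^sup>2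
    - hardy_exp TYPE('a) * (norm x powr (- real DIM('a)) * (2 * f x * (x \<bullet> grad f x)))"
proof -
  let ?a = "hardy_exp TYPE('a)" and ?r = "norm x"
  define b where "b = ?r powr (- ?a)"
  have r: "?r > 0" using x by simp
  have b2: "?r powr (- ?a - 2) = b / ?r\<^sup>2"
    using r unfolding b_def by (simp add: powr_diff powr_realpow[symmetric] del: powr_numeral)
  have p1: "?r powr (- (real DIM('a) - 2)) = b\<^sup>2"
  proof -
    have "- (real DIM('a) - 2) = - ?a + - ?a" by (simp add: hardy_exp_def)
    then show ?thesis by (simp only: b_def powr_add power2_eq_square)
  qed
  have p2: "?r powr (- real DIM('a)) = b\<^sup>2 / ?r\<^sup>2"
    using r p1 powr_diff[of ?r "- (real DIM('a) - 2)" 2] by simp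
  have "(norm (grad (hardy_fun f) x))\<^sup>2 = (b *\<^sub>R grad f x - (?a * (b / ?r\<^sup>2) * f x) *\<^sub>R x) \<bullet> (b *\<^sub>R grad f x - (?a * (b / ?r\<^sup>2) * f x) *\<^sub>R x)"
    unfolding grad_hardy_fun[OF assms] b2 b_def[symmetric] by (rule power2_norm_eq_inner)
  also have "\<dots> = b\<^sup>2 * (norm (grad f x))\<^sup>2 - 2 * ?a * (b\<^sup>2 / ?r\<^sup>2) * f x * (x \<bullet> grad f x)
      + (?a * (b / ?r\<^sup>2) * f x)\<^sup>2 * ?r\<^sup>2"
    unfolding power2_norm_eq_inner[of "grad f x"] power2_norm_eq_inner[of x, symmetric] inner_diff_left inner_diff_right
    by (simp add: inner_commute[of "grad f x" x] power2_norm_eq_inner[of x, symmetric] power2_eq_square algebra_simps del: power2_norm_eq_inner)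
  also have "(?a * (b / ?r\<^sup>2) * f x)\<^sup>2 * ?r\<^sup>2 = ?a\<^sup>2 * ((b * f x)\<^sup>2 / ?r\<^sup>2)"
    using r by (simp add: power2_eq_square divide_simps)
  finally show ?thesis
    unfolding p1 p2 b_def[symmetric] by (simp add: algebra_simps)
qed

section \<open>Integration along rays over an annulus\<close>

lemma integral_polar:
  fixes G :: "'a::euclidean_space \<Rightarrow> real"
  assumes G: "integrable lborel G"
  shows "(LINT x|lborel. G x) = (LINT \<omega>|cone_measure. LINT r|lborel.
    (real DIM('a) * r ^ (DIM('a) - 1) * indicator {0<..} r) * G (r *\<^sub>R \<omega>))"
proof -
  interpret finite_measure "cone_measure :: 'a measure" by (rule finite_cone_measure)
  interpret pair_sigma_finite lborel "cone_measure :: 'a measure" ..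
  have [measurable]: "G \<in> borel_measurable borel" using G by (auto dest: borel_measurable_integrable)
  define d where "d = (\<lambda>r. real DIM('a) * r ^ (DIM('a) - 1) * indicator {0<..} (r::real))"
  have d0: "0 \<le> d r" for r by (auto simp: d_def split: split_indicator)
  have [measurable]: "d \<in> borel_measurable borel" by (simp add: d_def)
  have pm: "(polar_measure :: (real \<times> 'a) measure) = density (lborel \<Otimes>\<^sub>M cone_measure) (\<lambda>p. ennreal (d (fst p)))"
    unfolding polar_measure_def by (rule arg_cong2[of _ _ _ _ density])
      (auto simp: d_def case_prod_beta ennreal_mult' ennreal_indicator fun_eq_iff split: split_indicator)
  have [simp]: "sets (polar_measure :: (real \<times> 'a) measure) = sets (borel \<Otimes>\<^sub>M borel)"
    unfolding pm by (auto intro: sets_pair_measure_cong)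
  have m: "(\<lambda>(r, x). r *\<^sub>R x) \<in> measurable (polar_measure :: (real \<times> 'a) measure) borel"
    by (subst measurable_cong_sets[of _ "borel \<Otimes>\<^sub>M borel" borel borel]) auto
  have i: "integrable polar_measure (\<lambda>p. G (fst p *\<^sub>R snd p))"
    using G unfolding lborel_eq_polar by (subst (asm) integrable_distr_eq) (auto simp: m case_prod_beta)
  have i2: "integrable (lborel \<Otimes>\<^sub>M cone_measure) (\<lambda>p. d (fst p) *\<^sub>R G (fst p *\<^sub>R snd p))"
    using i unfolding pm by (subst (asm) integrable_density) (auto simp: d0)
  have "(LINT x|lborel. G x) = (LINT p|polar_measure. G (fst p *\<^sub>R snd p))"
    by (subst lborel_eq_polar, subst integral_distr) (auto simp: m case_prod_beta)
  also have "\<dots> = (LINT p|(lborel \<Otimes>\<^sub>M cone_measure). d (fst p) *\<^sub>R G (fst p *\<^sub>R snd p))"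
    unfolding pm by (subst integral_density) (auto simp: d0)
  also have "\<dots> = (LINT \<omega>|cone_measure. LINT r|lborel. d r * G (r *\<^sub>R \<omega>))"
    using integral_snd[of "\<lambda>r \<omega>. d r * G (r *\<^sub>R \<omega>)"] i2 by (simp add: case_prod_beta')
  finally show ?thesis by (simp add: d_def)
qed

lemma test_ray_derivative:
  assumes "f \<in> test_functions \<Omega>"
  shows "((\<lambda>r. f (r *\<^sub>R \<omega>)) has_real_derivative (\<omega> \<bullet> grad f (r *\<^sub>R \<omega>))) (at r)"
proof -
  have "((\<lambda>r. f (r *\<^sub>R \<omega>)) has_derivative (\<lambda>h. grad f (r *\<^sub>R \<omega>) \<bullet> (h *\<^sub>R \<omega>))) (at r)"
    by (rule has_derivative_compose[OF _ test_has_derivative[OF assms]]) (auto intro!: derivative_eq_intros)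
  then show ?thesis
    by (simp add: has_field_derivative_def inner_commute mult_commute_abs)
qed

context
  fixes f :: "'a::euclidean_space \<Rightarrow> real" and R \<epsilon> :: real
  assumes f: "f \<in> test_functions (ball 0 R)" and eps: "0 < \<epsilon>" "\<epsilon> < R"
begin

lemma annulus_integrable:
  fixes g :: "'a \<Rightarrow> real"
  assumes "continuous_on (- {0}) g"
  shows "set_integrable lborel (ball 0 R - ball 0 \<epsilon>) g"
proof (rule set_integrable_subset[of _ "cball 0 R - ball 0 \<epsilon>"])
  have "continuous_on (cball 0 R - ball 0 \<epsilon>) g"
    by (rule continuous_on_subset[OF assms]) (use eps in auto)
  then show "set_integrable lborel (cball 0 R - ball 0 \<epsilon>) g"
    unfolding set_integrable_def by (intro borel_integrable_compact) (auto intro: compact_diff)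
qed auto

text \<open>On a ray the density r^(N-1) cancels |x|^(-N) x = r^(1-N) \<open>\<omega>\<close>,
  leaving the derivative of f^2 along the ray. The outer endpoint contributes nothing because
  \<open>f\<close> vanishes there; the inner one gives the integral over the sphere of radius
  \<open>\<epsilon>\<close>.\<close>

lemma boundary_term:
  "(LINT x:ball 0 R - ball 0 \<epsilon>|lborel. norm x powr (- real DIM('a)) * (2 * f x * (x \<bullet> grad f x))) =
    - real DIM('a) * (LINT \<omega>|cone_measure. (f (\<epsilon> *\<^sub>R \<omega>))\<^sup>2)"
proof -
  let ?K = "ball (0::'a) R - ball 0 \<epsilon>"
  let ?F = "\<lambda>x. norm x powr (- real DIM('a)) * (2 * f x * (x \<bullet> grad f x))"
  let ?I = "\<lambda>\<omega>. LINT r|lborel. (real DIM('a) * r ^ (DIM('a) - 1) * indicator {0<..} r) * (indicator ?K (r *\<^sub>R \<omega>) *\<^sub>R ?F (r *\<^sub>R \<omega>))"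
  have R: "R > 0" using eps by simp
  obtain r0 where r0: "r0 < R" "\<And>x. norm x \<ge> r0 \<Longrightarrow> f x = 0 \<and> grad f x = 0"
    using test_vanish[OF f R] by metis
  have "set_integrable lborel ?K ?F"
    by (rule annulus_integrable)
      (auto intro!: continuous_intros continuous_on_subset[OF test_continuous[OF f]] continuous_on_subset[OF test_continuous_grad[OF f]])
  then have "(LINT x:?K|lborel. ?F x) = (LINT \<omega>|cone_measure. ?I \<omega>)"
    unfolding set_lebesgue_integral_def set_integrable_def by (rule integral_polar)
  also have "\<dots> = (LINT \<omega>|cone_measure. - real DIM('a) * (f (\<epsilon> *\<^sub>R \<omega>))\<^sup>2)"
  proof (rule integral_cong_AE)
    have [measurable]: "f \<in> borel_measurable borel" "grad f \<in> borel_measurable borel"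
      using test_measurable[OF f] test_measurable_grad[OF f] by auto
    show "(\<lambda>\<omega>. ?I \<omega>) \<in> borel_measurable cone_measure"
    proof -
      define G where "G = (\<lambda>x. indicator ?K x *\<^sub>R ?F x)"
      have [measurable]: "ball (0::'a) R \<in> sets borel" "ball (0::'a) \<epsilon> \<in> sets borel" by auto
      have [measurable]: "G \<in> borel_measurable borel" unfolding G_def by measurable
      have "(\<lambda>\<omega>. LINT r|lborel. (real DIM('a) * r ^ (DIM('a) - 1) * indicator {0<..} r) * G (r *\<^sub>R \<omega>)) \<in> borel_measurable cone_measure"
        by measurable
      then show ?thesis by (simp only: G_def)
    qed
    show "(\<lambda>\<omega>. - real DIM('a) * (f (\<epsilon> *\<^sub>R \<omega>))\<^sup>2) \<in> borel_measurable cone_measure" by measurable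
    show "AE \<omega> in cone_measure. ?I \<omega> =
      - real DIM('a) * (f (\<epsilon> *\<^sub>R \<omega>))\<^sup>2"
      using AE_cone_measure_norm
    proof eventually_elim
      fix \<omega> :: 'a assume w: "norm \<omega> = 1"
      have "(real DIM('a) * r ^ (DIM('a) - 1) * indicator {0<..} r) * (indicator ?K (r *\<^sub>R \<omega>) *\<^sub>R ?F (r *\<^sub>R \<omega>)) =
        (real DIM('a) * (2 * f (r *\<^sub>R \<omega>) * (\<omega> \<bullet> grad f (r *\<^sub>R \<omega>)))) * indicator {\<epsilon>..R} r" for r
      proof (cases "r \<in> {\<epsilon>..<R}")
        case True
        then have r: "r > 0" using eps by auto
        have "r ^ (DIM('a) - 1) * r = r powr real DIM('a)"
          using r by (simp add: powr_realpow power_Suc2[symmetric] del: power_Suc)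
        then have "(r ^ (DIM('a) - 1) * r) * r powr (- real DIM('a)) = 1"
          using r by (simp add: powr_minus)
        then have *: "r ^ (DIM('a) - 1) * (r powr (- real DIM('a)) * (y * (r * z))) = y * z" for y z :: real
          by (metis (no_types, opaque_lifting) mult.assoc mult.commute mult.left_commute mult_1)
        have "indicator ?K (r *\<^sub>R \<omega>) = (1::real)" using True r w by (auto simp: indicator_def)
        then show ?thesis using True r w *[of "2 * f (r *\<^sub>R \<omega>)" "\<omega> \<bullet> grad f (r *\<^sub>R \<omega>)"] by (simp add: mult.assoc)
      next
        case False
        show ?thesis
        proof (cases "r = R")
          \<comment> \<open>The open ball omits \<open>r = R\<close>, whereas the closed interval of
            the fundamental theorem contains it; the integrand vanishes at this point since
            \<open>f\<close> does.\<close>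
          case True
          then have "f (r *\<^sub>R \<omega>) = 0" using r0 w R by (intro conjunct1[OF r0(2)]) auto
          then show ?thesis by simp
        next
          case F2: False
          have "indicator {0<..} r * indicator ?K (r *\<^sub>R \<omega>) = (0::real)"
            using False F2 w eps by (auto simp: indicator_def)
          then show ?thesis using False F2 by (auto simp: indicator_def)
        qed
      qed
      then have "?I \<omega> =
        (LINT r|lborel. (real DIM('a) * (2 * f (r *\<^sub>R \<omega>) * (\<omega> \<bullet> grad f (r *\<^sub>R \<omega>)))) * indicator {\<epsilon>..R} r)"
        by presburger
      also have "\<dots> = real DIM('a) * (f (R *\<^sub>R \<omega>))\<^sup>2 - real DIM('a) * (f (\<epsilon> *\<^sub>R \<omega>))\<^sup>2"
      proof (rule integral_FTC_Icc_real)
        fix r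
        note [derivative_intros] = test_ray_derivative[OF f]
        show "((\<lambda>r. real DIM('a) * (f (r *\<^sub>R \<omega>))\<^sup>2) has_real_derivative real DIM('a) * (2 * f (r *\<^sub>R \<omega>) * (\<omega> \<bullet> grad f (r *\<^sub>R \<omega>)))) (at r)"
          by (auto intro!: derivative_eq_intros)
        show "isCont (\<lambda>r. real DIM('a) * (2 * f (r *\<^sub>R \<omega>) * (\<omega> \<bullet> grad f (r *\<^sub>R \<omega>)))) r"
          by (rule continuous_on_interior[of UNIV])
            (intro continuous_intros continuous_on_compose2[OF test_continuous[OF f]]
              continuous_on_compose2[OF test_continuous_grad[OF f]], auto)
      qed (use eps in auto)
      also have "f (R *\<^sub>R \<omega>) = 0" using r0 w R by (intro conjunct1[OF r0(2)]) auto
      finally show "?I \<omega> =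
        - real DIM('a) * (f (\<epsilon> *\<^sub>R \<omega>))\<^sup>2" by simp
    qed
  qed
  finally show ?thesis by simp
qed

lemma hardy_difference:
  "(LINT x:ball 0 R - ball 0 \<epsilon>|lborel. (norm (grad (hardy_fun f) x))\<^sup>2) -
    (hardy_exp TYPE('a))\<^sup>2 * (LINT x:ball 0 R - ball 0 \<epsilon>|lborel. (hardy_fun f x)\<^sup>2 / (norm x)\<^sup>2) =
  (LINT x:ball 0 R - ball 0 \<epsilon>|lborel. norm x powr (- (real DIM('a) - 2)) * (norm (grad f x))\<^sup>2) +
    hardy_exp TYPE('a) * real DIM('a) * (LINT \<omega>|cone_measure. (f (\<epsilon> *\<^sub>R \<omega>))\<^sup>2)"
proof -
  let ?K = "ball (0::'a) R - ball 0 \<epsilon>"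
  note cont = continuous_on_subset[OF test_continuous[OF f]] continuous_on_subset[OF test_continuous_grad[OF f]]
  have i1: "set_integrable lborel ?K (\<lambda>x. (norm (grad (hardy_fun f) x))\<^sup>2)"
  proof (rule annulus_integrable)
    have "continuous_on (- {0}) (\<lambda>x. norm x powr (- hardy_exp TYPE('a)) *\<^sub>R grad f x
      - (hardy_exp TYPE('a) * norm x powr (- hardy_exp TYPE('a) - 2) * f x) *\<^sub>R x)"
      by (auto intro!: continuous_intros cont)
    then show "continuous_on (- {0}) (\<lambda>x. (norm (grad (hardy_fun f) x))\<^sup>2)"
      by (intro continuous_intros) (simp add: grad_hardy_fun[OF f] cong: continuous_on_cong_simp)
  qed
  have i2: "set_integrable lborel ?K (\<lambda>x. (hardy_fun f x)\<^sup>2 / (norm x)\<^sup>2)"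
    by (rule annulus_integrable) (auto intro!: continuous_intros cont)
  have i3: "set_integrable lborel ?K (\<lambda>x. norm x powr (- (real DIM('a) - 2)) * (norm (grad f x))\<^sup>2)"
    by (rule annulus_integrable) (auto intro!: continuous_intros cont)
  have i4: "set_integrable lborel ?K (\<lambda>x. norm x powr (- real DIM('a)) * (2 * f x * (x \<bullet> grad f x)))"
    by (rule annulus_integrable) (auto intro!: continuous_intros cont)
  have "(LINT x:?K|lborel. (norm (grad (hardy_fun f) x))\<^sup>2) -
      (hardy_exp TYPE('a))\<^sup>2 * (LINT x:?K|lborel. (hardy_fun f x)\<^sup>2 / (norm x)\<^sup>2) =
    (LINT x:?K|lborel. (norm (grad (hardy_fun f) x))\<^sup>2 - (hardy_exp TYPE('a))\<^sup>2 * ((hardy_fun f x)\<^sup>2 / (norm x)\<^sup>2))"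
    by (subst set_integral_diff(2)[OF i1 set_integrable_mult_right[OF i2]]) (simp only: set_integral_mult_right)
  also have "\<dots> = (LINT x:?K|lborel. norm x powr (- (real DIM('a) - 2)) * (norm (grad f x))\<^sup>2
    - hardy_exp TYPE('a) * (norm x powr (- real DIM('a)) * (2 * f x * (x \<bullet> grad f x))))"
  proof (rule set_lebesgue_integral_cong, simp, intro allI impI)
    fix x :: 'a assume "x \<in> ?K"
    then show "(norm (grad (hardy_fun f) x))\<^sup>2 - (hardy_exp TYPE('a))\<^sup>2 * ((hardy_fun f x)\<^sup>2 / (norm x)\<^sup>2) =
      norm x powr (- (real DIM('a) - 2)) * (norm (grad f x))\<^sup>2
      - hardy_exp TYPE('a) * (norm x powr (- real DIM('a)) * (2 * f x * (x \<bullet> grad f x)))"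
      using eps by (intro hardy_identity[OF f]) auto
  qed
  also have "\<dots> = (LINT x:?K|lborel. norm x powr (- (real DIM('a) - 2)) * (norm (grad f x))\<^sup>2)
    - hardy_exp TYPE('a) * (LINT x:?K|lborel. norm x powr (- real DIM('a)) * (2 * f x * (x \<bullet> grad f x)))"
    by (subst set_integral_diff(2)[OF i3 set_integrable_mult_right[OF i4]]) (simp only: set_integral_mult_right)
  finally show ?thesis unfolding boundary_term by (simp add: mult.assoc)
qed

end

text \<open>If \<open>f 0 \<noteq> 0\<close>, both integrals in \<open>H_quad\<close> diverge
  logarithmically, so the limit is taken in the combined form of \<open>hardy_difference\<close>:
  dominated convergence for the weighted energy of the annuli, continuity of \<open>f\<close> at the
  origin for the spheres.\<close>

lemma H_quad_hardy:
  fixes f :: "'a::euclidean_space \<Rightarrow> real"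
  assumes f: "f \<in> test_functions (ball 0 R)" and R: "R > 0" and n: "DIM('a) \<ge> 3"
  shows "H_quad R (hardy_fun f) = energy (real DIM('a) - 2) f"
proof -
  let ?p = "real DIM('a) - 2" and ?\<omega> = "measure lborel (ball (0::'a) 1)" and ?a = "hardy_exp TYPE('a)"
  let ?g = "\<lambda>x. norm x powr (- ?p) * (norm (grad f x))\<^sup>2"
  let ?K = "\<lambda>\<epsilon>. ball (0::'a) R - ball 0 \<epsilon>"
  obtain C where C: "\<And>x. \<bar>f x\<bar> \<le> C" using test_bounded[OF f] by metis
  have ig: "integrable lborel ?g" by (rule integrable_energy[OF f]) (use n in auto)
  have v: "grad f x = 0" if "norm x \<ge> R" for x
    using test_vanish[OF f R] that by (metis order.strict_implies_order order.trans)
  have 1: "((\<lambda>\<epsilon>. LINT x:?K \<epsilon>|lborel. ?g x) \<longlongrightarrow> energy ?p f) (at_right 0)"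
    unfolding tendsto_at_iff_sequentially o_def
  proof (intro allI impI)
    fix X :: "nat \<Rightarrow> real"
    assume X0: "\<forall>i. X i \<in> {0<..} - {0}" and X: "X \<longlonglongrightarrow> 0"
    let ?J = "\<lambda>i x. indicat_real (ball 0 R - ball 0 (X i)) x *\<^sub>R ?g x"
    show "(\<lambda>i. LINT x:ball 0 R - ball 0 (X i)|lborel. ?g x) \<longlonglongrightarrow> energy ?p f"
      unfolding energy_def set_lebesgue_integral_def
    proof (rule integral_dominated_convergence[where w = ?g])
      have "AE x in lborel. x \<noteq> (0::'a)" by (rule AE_lborel_singleton)
      then show "AE x in lborel. (\<lambda>i. ?J i x) \<longlonglongrightarrow> ?g x"
      proof eventually_elim
        fix x :: 'a assume "x \<noteq> 0"
        then have "\<forall>\<^sub>F i in sequentially. X i < norm x"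
          using order_tendstoD(2)[OF X] by simp
        then have "\<forall>\<^sub>F i in sequentially. ?J i x = ?g x"
          by eventually_elim (use v[of x] in \<open>auto simp: indicator_def\<close>)
        then show "(\<lambda>i. ?J i x) \<longlonglongrightarrow> ?g x"
          by (rule tendsto_eventually)
      qed
      show "AE x in lborel. norm (?J i x) \<le> ?g x" for i
        by (auto simp: indicator_def)
      show "(\<lambda>x. ?J i x) \<in> borel_measurable lborel" for i
        by (intro borel_measurable_scaleR borel_measurable_indicator borel_measurable_integrable[OF ig]) auto
    qed (use ig in auto)
  qed
  have 2: "((\<lambda>\<epsilon>. LINT \<omega>|cone_measure. (f (\<epsilon> *\<^sub>R \<omega>))\<^sup>2) \<longlongrightarrow> ?\<omega> * (f 0)\<^sup>2) (at_right 0)"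
  proof (rule tendsto_cone_integral)
    show "continuous_on UNIV (\<lambda>x. (f x)\<^sup>2)" by (intro continuous_intros test_continuous[OF f])
    show "\<bar>(f x)\<^sup>2\<bar> \<le> C\<^sup>2" for x using power_mono[OF C[of x], of 2] by simp
  qed
  have "((\<lambda>\<epsilon>. (LINT x:?K \<epsilon>|lborel. (norm (grad (hardy_fun f) x))\<^sup>2) -
    ?a\<^sup>2 * (LINT x:?K \<epsilon>|lborel. (hardy_fun f x)\<^sup>2 / (norm x)\<^sup>2))
    \<longlongrightarrow> energy ?p f + ?a * real DIM('a) * (?\<omega> * (f 0)\<^sup>2)) (at_right 0)"
  proof (rule Lim_transform_eventually)
    show "((\<lambda>\<epsilon>. (LINT x:?K \<epsilon>|lborel. ?g x) + ?a * real DIM('a) * (LINT \<omega>|cone_measure. (f (\<epsilon> *\<^sub>R \<omega>))\<^sup>2))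
      \<longlongrightarrow> energy ?p f + ?a * real DIM('a) * (?\<omega> * (f 0)\<^sup>2)) (at_right 0)"
      by (intro tendsto_intros 1 2)
    show "\<forall>\<^sub>F \<epsilon> in at_right 0. (LINT x:?K \<epsilon>|lborel. ?g x) + ?a * real DIM('a) * (LINT \<omega>|cone_measure. (f (\<epsilon> *\<^sub>R \<omega>))\<^sup>2) =
      (LINT x:?K \<epsilon>|lborel. (norm (grad (hardy_fun f) x))\<^sup>2) -
      ?a\<^sup>2 * (LINT x:?K \<epsilon>|lborel. (hardy_fun f x)\<^sup>2 / (norm x)\<^sup>2)"
      using R by (intro eventually_at_rightI[of 0 R]) (auto simp: hardy_difference[OF f])
  qed
  from tendsto_Lim[OF _ this] show ?thesis
    unfolding H_quad_def L_fun_hardy[OF f n] by simp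
qed

section \<open>Closability and the norm of a completion\<close>

lemma L2_triangle:
  fixes u v z w :: "'b \<Rightarrow> real"
  assumes int: "integrable M (\<lambda>x. w x * (u x)\<^sup>2)" "integrable M (\<lambda>x. w x * (v x)\<^sup>2)" "integrable M (\<lambda>x. w x * (z x)\<^sup>2)"
    and w: "\<And>x. 0 \<le> w x" and z: "\<And>x. \<bar>z x\<bar> \<le> \<bar>u x\<bar> + \<bar>v x\<bar>"
  shows "sqrt (LINT x|M. w x * (z x)\<^sup>2) \<le> sqrt (LINT x|M. w x * (u x)\<^sup>2) + sqrt (LINT x|M. w x * (v x)\<^sup>2)"
proof (rule field_le_epsilon)
  fix e :: real assume e: "e > 0"
  define I where "I = (\<lambda>f. LINT x|M. w x * (f x)\<^sup>2)"
  have I0: "0 \<le> I f" for f unfolding I_def using w by (intro Bochner_Integration.integral_nonneg) auto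
  \<comment> \<open>\<open>2 * |u| * |v| \<le> B / A * u^2 + A / B * v^2\<close> holds for all
    positive \<open>A\<close> and \<open>B\<close>, and its integrated form is optimal when they are
    the two norms; \<open>e / 2\<close> keeps them away from zero.\<close>
  define A where "A = sqrt (I u) + e / 2"
  define B where "B = sqrt (I v) + e / 2"
  have A: "A > 0" and B: "B > 0"
    using e I0[of u] I0[of v] unfolding A_def B_def by (auto intro!: add_nonneg_pos)
  have Iu: "I u \<le> A\<^sup>2" and Iv: "I v \<le> B\<^sup>2"
    using e I0[of u] I0[of v] power_mono[of "sqrt (I u)" A 2] power_mono[of "sqrt (I v)" B 2]
    unfolding A_def B_def by auto
  have pw: "(z x)\<^sup>2 \<le> (1 + B / A) * (u x)\<^sup>2 + (1 + A / B) * (v x)\<^sup>2" for x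
  proof -
    have "(z x)\<^sup>2 \<le> (\<bar>u x\<bar> + \<bar>v x\<bar>)\<^sup>2" using z[of x] by (metis abs_ge_zero power2_abs power_mono)
    also have "\<dots> = (u x)\<^sup>2 + 2 * (\<bar>u x\<bar> * \<bar>v x\<bar>) + (v x)\<^sup>2" by (simp add: power2_sum)
    also have "2 * (\<bar>u x\<bar> * \<bar>v x\<bar>) \<le> B / A * (u x)\<^sup>2 + A / B * (v x)\<^sup>2"
    proof -
      have "0 \<le> (B * \<bar>u x\<bar> - A * \<bar>v x\<bar>)\<^sup>2 / (A * B)" using A B by simp
      also have "\<dots> = B / A * (u x)\<^sup>2 + A / B * (v x)\<^sup>2 - 2 * (\<bar>u x\<bar> * \<bar>v x\<bar>)"
        using A B by (simp add: power2_diff power_mult_distrib divide_simps) (simp add: algebra_simps power2_eq_square)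
      finally show ?thesis by simp
    qed
    finally show ?thesis by (simp add: algebra_simps)
  qed
  have "I z \<le> (LINT x|M. (1 + B / A) * (w x * (u x)\<^sup>2) + (1 + A / B) * (w x * (v x)\<^sup>2))"
    unfolding I_def
  proof (rule integral_mono)
    show "w x * (z x)\<^sup>2 \<le> (1 + B / A) * (w x * (u x)\<^sup>2) + (1 + A / B) * (w x * (v x)\<^sup>2)" for x
      using mult_left_mono[OF pw[of x] w[of x]] by (simp add: algebra_simps)
  qed (use int in auto)
  also have "\<dots> = (1 + B / A) * I u + (1 + A / B) * I v"
    unfolding I_def using int by simp
  also have "\<dots> \<le> (1 + B / A) * A\<^sup>2 + (1 + A / B) * B\<^sup>2"
    using A B Iu Iv by (intro add_mono mult_left_mono) auto
  also have "\<dots> = (A + B)\<^sup>2"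
    using A B by (simp add: divide_simps power2_eq_square) (simp add: algebra_simps)
  finally have "sqrt (I z) \<le> A + B"
    using A B by (intro real_le_lsqrt) auto
  then show "sqrt (LINT x|M. w x * (z x)\<^sup>2) \<le> sqrt (LINT x|M. w x * (u x)\<^sup>2) + sqrt (LINT x|M. w x * (v x)\<^sup>2) + e"
    by (simp add: A_def B_def I_def)
qed

text \<open>The hypothesis on gradients covers both \<open>f - g\<close> against \<open>f\<close>
  and \<open>g\<close>, and \<open>f\<close> against \<open>f - g\<close> and \<open>g\<close>; the
  completion norm needs the two forms.\<close>

lemma energy_triangle:
  fixes f g h :: "'a::euclidean_space \<Rightarrow> real"
  assumes t: "f \<in> test_functions \<Omega>" "g \<in> test_functions \<Omega>" "h \<in> test_functions \<Omega>"
    and p: "0 \<le> p" "p \<le> real DIM('a) - 1"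
    and h: "\<And>x. norm (grad h x) \<le> norm (grad f x) + norm (grad g x)"
  shows "sqrt (energy p h) \<le> sqrt (energy p f) + sqrt (energy p g)"
  unfolding energy_def by (rule L2_triangle) (use integrable_energy[OF _ p] t h in auto)

lemma nn_integral_le_lim:
  fixes u :: "nat \<Rightarrow> 'b \<Rightarrow> ennreal"
  assumes [measurable]: "\<And>n. u n \<in> borel_measurable M"
    and lim: "AE x in M. (\<lambda>n. u n x) \<longlonglongrightarrow> v x"
    and le: "\<forall>\<^sub>F n in sequentially. (\<integral>\<^sup>+x. u n x \<partial>M) \<le> B"
  shows "(\<integral>\<^sup>+x. v x \<partial>M) \<le> B"
proof -
  have "(\<integral>\<^sup>+x. v x \<partial>M) = (\<integral>\<^sup>+x. liminf (\<lambda>n. u n x) \<partial>M)"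
    by (rule nn_integral_cong_AE, use lim in eventually_elim) (simp add: lim_imp_Liminf)
  also have "\<dots> \<le> liminf (\<lambda>n. \<integral>\<^sup>+x. u n x \<partial>M)" by (rule nn_integral_liminf) simp
  also have "\<dots> \<le> B"
    using Liminf_mono[OF le] by (simp add: Liminf_const)
  finally show ?thesis .
qed

text \<open>Jensen's inequality for the square on an interval of length 1, obtained by integrating
  \<open>(k t - c)^2 \<ge> 0\<close>.\<close>

lemma square_integral_le:
  fixes k :: "real \<Rightarrow> real"
  assumes k: "continuous_on {0..1} k" and c: "(k has_integral c) {0..1}"
  shows "ennreal (c\<^sup>2) \<le> (\<integral>\<^sup>+t. ennreal ((k t)\<^sup>2) * indicator {0..1} t \<partial>lborel)"
proof -
  have 1: "((\<lambda>t. (k t)\<^sup>2) has_integral integral {0..1} (\<lambda>t. (k t)\<^sup>2)) {0..1}"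
    by (intro integrable_integral integrable_continuous_real continuous_intros k)
  have 2: "((\<lambda>t. 2 * c * k t - c\<^sup>2) has_integral (2 * c * c - c\<^sup>2)) {0..1}"
    using has_integral_diff[OF has_integral_mult_right[OF c, of "2 * c"] has_integral_const_real[of "c\<^sup>2" 0 1]] by simp
  have "2 * c * c - c\<^sup>2 \<le> integral {0..1} (\<lambda>t. (k t)\<^sup>2)"
  proof (rule has_integral_le[OF 2 1])
    show "2 * c * k t - c\<^sup>2 \<le> (k t)\<^sup>2" for t
      using zero_le_power2[of "k t - c"] by (simp add: power2_diff algebra_simps)
  qed
  then have "ennreal (c\<^sup>2) \<le> ennreal (integral {0..1} (\<lambda>t. (k t)\<^sup>2))"
    by (intro ennreal_leI) (simp add: power2_eq_square)
  also have "\<dots> = (\<integral>\<^sup>+t. ennreal (indicator {0..1} t * (k t)\<^sup>2) \<partial>lborel)"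
    by (rule nn_integral_has_integral_lebesgue[symmetric, OF _ 1]) auto
  also have "\<dots> = (\<integral>\<^sup>+t. ennreal ((k t)\<^sup>2) * indicator {0..1} t \<partial>lborel)"
    by (intro nn_integral_cong) (auto split: split_indicator)
  finally show ?thesis .
qed

lemma nn_integral_translate:
  fixes F :: "'a::euclidean_space \<Rightarrow> ennreal"
  assumes [measurable]: "F \<in> borel_measurable borel"
  shows "(\<integral>\<^sup>+x. F (c + x) \<partial>lborel) = (\<integral>\<^sup>+x. F x \<partial>lborel)"
proof -
  have "(\<integral>\<^sup>+x. F x \<partial>lborel) = (\<integral>\<^sup>+x. F x \<partial>distr lborel borel ((+) c))"
    by (simp add: lborel_distr_plus)
  also have "\<dots> = (\<integral>\<^sup>+x. F (c + x) \<partial>lborel)" by (subst nn_integral_distr) auto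
  finally show ?thesis by simp
qed

text \<open>
  The weight is only quasi-invariant under translations: cutting out the ball of radius \<open>h\<close>
  makes it change by a factor of at most \<open>2\<^sup>p\<close> under translations by vectors of length \<open>\<le> h\<close>.
\<close>

lemma difference_quotient_energy:
  fixes f :: "'a::euclidean_space \<Rightarrow> real"
  assumes f: "f \<in> test_functions \<Omega>" and b: "b \<in> Basis" and h: "h > 0" and p: "p \<ge> 0"
  shows "(\<integral>\<^sup>+x. ennreal (indicator {x. h < norm x} x * norm x powr (- p) * ((f (h *\<^sub>R b + x) - f x) / h)\<^sup>2) \<partial>lborel)
    \<le> ennreal (2 powr p) * (\<integral>\<^sup>+x. ennreal (norm x powr (- p) * (grad f x \<bullet> b)\<^sup>2) \<partial>lborel)"
proof -
  have [measurable]: "f \<in> borel_measurable borel" "grad f \<in> borel_measurable borel"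
    using test_measurable[OF f] test_measurable_grad[OF f] by auto
  define W where "W = (\<lambda>x::'a. indicat_real {x. h < norm x} x * norm x powr (- p))"
  let ?y = "\<lambda>t x. (t * h) *\<^sub>R b + x"
  have W0: "0 \<le> W x" for x by (simp add: W_def)
  have [measurable]: "W \<in> borel_measurable borel" unfolding W_def by measurable
  define D where "D = (\<lambda>x. (grad f x \<bullet> b)\<^sup>2)"
  have [measurable]: "D \<in> borel_measurable borel" unfolding D_def by measurable
  have D0: "0 \<le> D x" for x by (simp add: D_def)
  have "(\<integral>\<^sup>+x. ennreal (W x * ((f (h *\<^sub>R b + x) - f x) / h)\<^sup>2) \<partial>lborel) \<le>
    (\<integral>\<^sup>+x. (\<integral>\<^sup>+t. ennreal (W x * D (?y t x)) * indicator {0..1} t \<partial>lborel) \<partial>lborel)"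
  proof (rule nn_integral_mono)
    fix x :: 'a
    \<comment> \<open>The difference quotient at \<open>x\<close> is the mean of this directional
      derivative over the segment from \<open>x\<close> to \<open>x + h b\<close>, so Jensen's
      inequality applies.\<close>
    let ?k = "\<lambda>t. grad f (x + t *\<^sub>R (h *\<^sub>R b)) \<bullet> b"
    have ck: "continuous_on {0..1} ?k"
      by (intro continuous_intros continuous_on_compose2[OF test_continuous_grad[OF f]]) auto
    have "((\<lambda>t. f (x + t *\<^sub>R (h *\<^sub>R b)) / h) has_real_derivative ?k t) (at t)" for t
    proof -
      have "((\<lambda>t. f (x + t *\<^sub>R (h *\<^sub>R b))) has_derivative (\<lambda>s. grad f (x + t *\<^sub>R (h *\<^sub>R b)) \<bullet> (s *\<^sub>R (h *\<^sub>R b)))) (at t)"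
        by (rule has_derivative_compose[OF _ test_has_derivative[OF f]]) (auto intro!: derivative_eq_intros)
      then have "((\<lambda>t. f (x + t *\<^sub>R (h *\<^sub>R b))) has_real_derivative (h * ?k t)) (at t)"
        by (simp add: has_field_derivative_def mult_commute_abs mult.assoc mult.left_commute)
      from DERIV_cdivide[OF this, of h] show ?thesis using h by simp
    qed
    then have "(?k has_integral (f (x + 1 *\<^sub>R (h *\<^sub>R b)) / h - f (x + 0 *\<^sub>R (h *\<^sub>R b)) / h)) {0..1}"
      by (intro fundamental_theorem_of_calculus)
        (auto simp: has_real_derivative_iff_has_vector_derivative[symmetric] intro: DERIV_subset)
    then have "(?k has_integral ((f (h *\<^sub>R b + x) - f x) / h)) {0..1}"
      by (simp add: diff_divide_distrib add.commute)
    from square_integral_le[OF ck this]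
    have "ennreal (((f (h *\<^sub>R b + x) - f x) / h)\<^sup>2) \<le> (\<integral>\<^sup>+t. ennreal (D (?y t x)) * indicator {0..1} t \<partial>lborel)"
      by (simp add: D_def add.commute)
    from mult_left_mono[OF this, of "ennreal (W x)"]
    show "ennreal (W x * ((f (h *\<^sub>R b + x) - f x) / h)\<^sup>2) \<le> (\<integral>\<^sup>+t. ennreal (W x * D (?y t x)) * indicator {0..1} t \<partial>lborel)"
      using W0 D0 by (simp add: ennreal_mult nn_integral_cmult[symmetric] mult.assoc)
  qed
  also have "\<dots> = (\<integral>\<^sup>+t. (\<integral>\<^sup>+x. ennreal (W x * D (?y t x)) * indicator {0..1} t \<partial>lborel) \<partial>lborel)"
    by (rule lborel_pair.Fubini') measurable
  also have "\<dots> \<le> (\<integral>\<^sup>+t. ennreal (2 powr p) * (\<integral>\<^sup>+x. ennreal (norm x powr (- p) * D x) \<partial>lborel) * indicator {0..1} (t::real) \<partial>lborel)"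
  proof (rule nn_integral_mono)
    fix t :: real
    show "(\<integral>\<^sup>+x. ennreal (W x * D (?y t x)) * indicator {0..1} t \<partial>lborel) \<le>
      ennreal (2 powr p) * (\<integral>\<^sup>+x. ennreal (norm x powr (- p) * D x) \<partial>lborel) * indicator {0..1} t"
    proof (cases "t \<in> {0..1}")
      case True
      have "W x \<le> 2 powr p * norm (?y t x) powr (- p)" for x
      proof (cases "h < norm x")
        case hx: True
        have nb: "norm ((t * h) *\<^sub>R b) \<le> h" using True h b by (simp add: mult_left_le_one_le)
        have "norm x - norm ((t * h) *\<^sub>R b) \<le> norm (?y t x)" using norm_diff_ineq[of x "(t * h) *\<^sub>R b"] by (simp add: add.commute)
        \<comment> \<open>Positivity is essential: at the origin the weight has the default value 0,
          and monotonicity of the negative power would fail.\<close>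
        then have y: "norm (?y t x) > 0" using nb hx by linarith
        have "norm (?y t x) \<le> norm ((t * h) *\<^sub>R b) + norm x" by (rule norm_triangle_ineq)
        also have "\<dots> \<le> 2 * norm x" using nb hx by simp
        finally have "(2 * norm x) powr (- p) \<le> norm (?y t x) powr (- p)" using y p by (intro powr_mono2') auto
        then have "2 powr p * (2 * norm x) powr (- p) \<le> 2 powr p * norm (?y t x) powr (- p)" by (intro mult_left_mono) auto
        moreover have "2 powr p * (2 * norm x) powr (- p) = norm x powr (- p)"
          by (simp add: powr_mult powr_minus)
        ultimately show ?thesis using hx by (simp add: W_def)
      qed (simp add: W_def)
      then have "W x * D (?y t x) \<le> 2 powr p * (norm (?y t x) powr (- p) * D (?y t x))" for x
        using mult_right_mono[OF _ D0] by (metis mult.assoc)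
      then have "(\<integral>\<^sup>+x. ennreal (W x * D (?y t x)) \<partial>lborel) \<le>
        (\<integral>\<^sup>+x. ennreal (2 powr p) * ennreal (norm (?y t x) powr (- p) * D (?y t x)) \<partial>lborel)"
        using D0 by (intro nn_integral_mono) (simp add: ennreal_mult[symmetric])
      also have "\<dots> = ennreal (2 powr p) * (\<integral>\<^sup>+x. ennreal (norm (?y t x) powr (- p) * D (?y t x)) \<partial>lborel)"
        by (rule nn_integral_cmult) measurable
      also have "(\<integral>\<^sup>+x. ennreal (norm (?y t x) powr (- p) * D (?y t x)) \<partial>lborel) = (\<integral>\<^sup>+x. ennreal (norm x powr (- p) * D x) \<partial>lborel)"
        by (rule nn_integral_translate[of "\<lambda>x. ennreal (norm x powr (- p) * D x)"]) measurable
      finally show ?thesis using True by simp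
    qed simp
  qed
  also have "\<dots> = ennreal (2 powr p) * (\<integral>\<^sup>+x. ennreal (norm x powr (- p) * D x) \<partial>lborel)"
    by (subst nn_integral_cmult_indicator) auto
  finally show ?thesis by (simp add: W_def D_def)
qed

text \<open>Unlike gradients, difference quotients are determined by the pointwise limit. For fixed
  \<open>n\<close> and \<open>h\<close>, letting \<open>m\<close> tend to infinity in the quotients
  of \<open>f n - f m\<close> bounds those of \<open>f n\<close> by the Cauchy tail; letting
  \<open>h\<close> tend to 0 afterwards recovers the partial derivatives. Fatou's lemma is used at
  both limits.\<close>

lemma energy_closable:
  fixes f :: "nat \<Rightarrow> 'a::euclidean_space \<Rightarrow> real"
  assumes f: "\<And>n. f n \<in> test_functions \<Omega>" and p: "0 \<le> p" "p \<le> real DIM('a) - 1"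
    and cauchy: "\<And>e. e > 0 \<Longrightarrow> \<exists>n0. \<forall>m\<ge>n0. \<forall>n\<ge>n0. energy p (\<lambda>x. f m x - f n x) < e"
    and lim: "AE x in lborel. (\<lambda>n. f n x) \<longlonglongrightarrow> 0"
  shows "(\<lambda>n. energy p (f n)) \<longlonglongrightarrow> 0"
proof (rule LIMSEQ_I)
  fix r :: real assume r: "r > 0"
  let ?E = "\<lambda>n b x. ennreal (norm x powr (- p) * (grad (f n) x \<bullet> b)\<^sup>2)"
  \<comment> \<open>Each of the \<open>DIM('a)\<close> coordinate directions contributes at most
    \<open>2 powr p * e\<close>, so the total is \<open>r / 2\<close>.\<close>
  define N where "N = real DIM('a) * 2 powr p"
  have N: "N > 0" by (simp add: N_def)
  define e where "e = r / (2 * N)"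
  have e: "e > 0" using r N by (simp add: e_def)
  have [measurable]: "f n \<in> borel_measurable borel" "grad (f n) \<in> borel_measurable borel" for n
    using test_measurable[OF f] test_measurable_grad[OF f] by auto
  obtain n0 where n0: "\<And>m n. m \<ge> n0 \<Longrightarrow> n \<ge> n0 \<Longrightarrow> energy p (\<lambda>x. f m x - f n x) < e"
    using cauchy[OF e] by blast
  have comp: "(\<integral>\<^sup>+x. ?E n b x \<partial>lborel) \<le> ennreal (2 powr p * e)"
    if n: "n \<ge> n0" and b: "b \<in> Basis" for n b
  proof -
    define Q where "Q = (\<lambda>g h x. indicator {x. h < norm x} x * norm x powr (- p) * ((g (h *\<^sub>R b + x) - g x) / h)\<^sup>2 :: real)"
    have Qm: "Q g h \<in> borel_measurable borel" if [measurable]: "g \<in> borel_measurable borel" for g h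
      unfolding Q_def by measurable
    have Qe: "(\<integral>\<^sup>+x. ennreal (Q (f n) h x) \<partial>lborel) \<le> ennreal (2 powr p * e)" if h: "h > 0" for h
    proof -
      let ?q = "\<lambda>m x. Q (\<lambda>x. f n x - f m x) h x"
      show ?thesis
      proof (rule nn_integral_le_lim[where u = "\<lambda>m x. ennreal (?q m x)"])
        show "(\<lambda>x. ennreal (?q m x)) \<in> borel_measurable lborel" for m
          using Qm[of "\<lambda>x. f n x - f m x" h] by simp
        \<comment> \<open>Null sets are translation invariant, so the sequence also converges at
          \<open>h b + x\<close> for almost every \<open>x\<close>.\<close>
        have "AE x in distr lborel borel ((+) (h *\<^sub>R b)). (\<lambda>n. f n x) \<longlonglongrightarrow> 0"
          by (subst lborel_distr_plus) (rule lim)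
        then have "AE x in lborel. (\<lambda>n. f n (h *\<^sub>R b + x)) \<longlonglongrightarrow> 0"
          by (rule AE_distrD[rotated]) simp
        then show "AE x in lborel. (\<lambda>m. ennreal (?q m x)) \<longlonglongrightarrow> ennreal (Q (f n) h x)"
          using lim
        proof eventually_elim
          fix x assume 1: "(\<lambda>n. f n (h *\<^sub>R b + x)) \<longlonglongrightarrow> 0" and 2: "(\<lambda>n. f n x) \<longlonglongrightarrow> 0"
          have "(\<lambda>m. ?q m x) \<longlonglongrightarrow>
            indicator {x. h < norm x} x * norm x powr (- p) * (((f n (h *\<^sub>R b + x) - 0) - (f n x - 0)) / h)\<^sup>2"
            unfolding Q_def using h by (intro tendsto_intros 1 2) auto
          then show "(\<lambda>m. ennreal (?q m x)) \<longlonglongrightarrow> ennreal (Q (f n) h x)"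
            by (intro tendsto_ennrealI) (simp add: Q_def)
        qed
        show "\<forall>\<^sub>F m in sequentially. (\<integral>\<^sup>+x. ennreal (?q m x) \<partial>lborel) \<le> ennreal (2 powr p * e)"
          using eventually_ge_at_top[of n0]
        proof eventually_elim
          fix m assume m: "n0 \<le> m"
          let ?g = "\<lambda>x. f n x - f m x"
          have g: "?g \<in> test_functions \<Omega>" by (rule test_diff[OF f f])
          have [measurable]: "grad ?g \<in> borel_measurable borel" by (rule test_measurable_grad[OF g])
          have "(\<integral>\<^sup>+x. ennreal (Q ?g h x) \<partial>lborel) \<le> ennreal (2 powr p) * (\<integral>\<^sup>+x. ennreal (norm x powr (- p) * (grad ?g x \<bullet> b)\<^sup>2) \<partial>lborel)"
            unfolding Q_def by (rule difference_quotient_energy[OF g b h p(1)])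
          also have "\<dots> \<le> ennreal (2 powr p) * (\<integral>\<^sup>+x. ennreal (norm x powr (- p) * (norm (grad ?g x))\<^sup>2) \<partial>lborel)"
          proof (intro mult_left_mono nn_integral_mono ennreal_leI)
            fix x
            have "(grad ?g x \<bullet> b)\<^sup>2 \<le> (norm (grad ?g x))\<^sup>2"
              using Basis_le_norm[OF b, of "grad ?g x"] by (metis abs_ge_zero power2_abs power_mono)
            then show "(grad ?g x \<bullet> b)\<^sup>2 \<le> (norm (grad ?g x))\<^sup>2" .
          qed auto
          also have "\<dots> = ennreal (2 powr p * energy p ?g)"
            unfolding nn_integral_energy[OF g p] by (rule ennreal_mult[symmetric]) (auto simp: energy_nonneg)
          also have "\<dots> \<le> ennreal (2 powr p * e)"
            using n0[OF n m] by (intro ennreal_leI mult_left_mono) auto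
          finally show "(\<integral>\<^sup>+x. ennreal (Q ?g h x) \<partial>lborel) \<le> ennreal (2 powr p * e)" .
        qed
      qed
    qed
    show ?thesis
    proof (rule nn_integral_le_lim[where u = "\<lambda>j x. ennreal (Q (f n) (inverse (real (Suc j))) x)"])
      show "(\<lambda>x. ennreal (Q (f n) (inverse (real (Suc j))) x)) \<in> borel_measurable lborel" for j
        using Qm[of "f n"] by simp
      have "AE x in lborel. x \<noteq> (0::'a)" by (rule AE_lborel_singleton)
      then show "AE x in lborel. (\<lambda>j. ennreal (Q (f n) (inverse (real (Suc j))) x)) \<longlonglongrightarrow> ?E n b x"
      proof eventually_elim
        fix x :: 'a assume x: "x \<noteq> 0"
        let ?h = "\<lambda>j. inverse (real (Suc j))"
        have "((\<lambda>t. f n (x + t *\<^sub>R b)) has_derivative (\<lambda>s. grad (f n) (x + 0 *\<^sub>R b) \<bullet> (s *\<^sub>R b))) (at 0)"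
          by (rule has_derivative_compose[OF _ test_has_derivative[OF f]]) (auto intro!: derivative_eq_intros)
        then have "((\<lambda>t. f n (x + t *\<^sub>R b)) has_real_derivative (grad (f n) x \<bullet> b)) (at 0)"
          by (simp add: has_field_derivative_def mult_commute_abs)
        then have "((\<lambda>t. (f n (t *\<^sub>R b + x) - f n x) / t) \<longlongrightarrow> grad (f n) x \<bullet> b) (at 0)"
          by (simp add: DERIV_def add.commute)
        moreover have "filterlim ?h (at 0) sequentially"
          using LIMSEQ_inverse_real_of_nat by (auto simp: filterlim_at)
        ultimately have "(\<lambda>j. (f n (?h j *\<^sub>R b + x) - f n x) / ?h j) \<longlonglongrightarrow> grad (f n) x \<bullet> b"
          by (rule filterlim_compose)
        then have "(\<lambda>j. norm x powr (- p) * ((f n (?h j *\<^sub>R b + x) - f n x) / ?h j)\<^sup>2) \<longlonglongrightarrow> norm x powr (- p) * (grad (f n) x \<bullet> b)\<^sup>2"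
          by (intro tendsto_intros)
        moreover have "\<forall>\<^sub>F j in sequentially. norm x powr (- p) * ((f n (?h j *\<^sub>R b + x) - f n x) / ?h j)\<^sup>2 = Q (f n) (?h j) x"
        proof -
          have "\<forall>\<^sub>F j in sequentially. ?h j < norm x"
            using order_tendstoD(2)[OF LIMSEQ_inverse_real_of_nat] x by simp
          then show ?thesis by eventually_elim (simp add: Q_def)
        qed
        ultimately have "(\<lambda>j. Q (f n) (?h j) x) \<longlonglongrightarrow> norm x powr (- p) * (grad (f n) x \<bullet> b)\<^sup>2"
          by (rule Lim_transform_eventually)
        then show "(\<lambda>j. ennreal (Q (f n) (?h j) x)) \<longlonglongrightarrow> ?E n b x"
          by (rule tendsto_ennrealI)
      qed
      show "\<forall>\<^sub>F j in sequentially. (\<integral>\<^sup>+x. ennreal (Q (f n) (inverse (real (Suc j))) x) \<partial>lborel) \<le> ennreal (2 powr p * e)"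
        by (intro always_eventually allI Qe) simp
    qed
  qed
  show "\<exists>no. \<forall>n\<ge>no. norm (energy p (f n) - 0) < r"
  proof (intro exI allI impI)
    fix n assume n: "n \<ge> n0"
    have "ennreal (energy p (f n)) = (\<integral>\<^sup>+x. (\<Sum>b\<in>Basis. ?E n b x) \<partial>lborel)"
      unfolding nn_integral_energy[OF f p, symmetric]
    proof (rule nn_integral_cong)
      fix x :: 'a
      have "(norm (grad (f n) x))\<^sup>2 = (\<Sum>b\<in>Basis. (grad (f n) x \<bullet> b)\<^sup>2)"
        by (subst power2_norm_eq_inner, subst euclidean_inner) (simp add: power2_eq_square)
      then show "ennreal (norm x powr (- p) * (norm (grad (f n) x))\<^sup>2) = (\<Sum>b\<in>Basis. ?E n b x)"
        by (simp add: sum_ennreal sum_distrib_left)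
    qed
    also have "\<dots> = (\<Sum>b\<in>Basis. \<integral>\<^sup>+x. ?E n b x \<partial>lborel)"
      by (rule nn_integral_sum) measurable
    also have "\<dots> \<le> (\<Sum>b\<in>(Basis :: 'a set). ennreal (2 powr p * e))"
      using comp[OF n] by (intro sum_mono)
    also have "\<dots> = ennreal (real DIM('a) * (2 powr p * e))"
      unfolding sum_constant ennreal_of_nat_eq_real_of_nat
      by (rule ennreal_mult[symmetric]) (use e in auto)
    also have "real DIM('a) * (2 powr p * e) = r / 2"
      by (simp add: e_def N_def)
    finally show "norm (energy p (f n) - 0) < r" using r energy_nonneg[of p "f n"] by simp
  qed
qed

text \<open>This gives the \<open>THE\<close> in \<open>fun_completion_norm\<close> its value. By
  the reverse triangle inequality the norms along an approximating sequence form a Cauchy sequence;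
  the difference of two such sequences for one \<open>u\<close> is Cauchy and tends to 0 almost
  everywhere, so \<open>closable\<close> identifies the limits.\<close>

lemma fun_completion_norm_tendsto:
  fixes q :: "('b \<Rightarrow> real) \<Rightarrow> real"
  assumes diff: "\<And>f g. f \<in> V \<Longrightarrow> g \<in> V \<Longrightarrow> (\<lambda>x. f x - g x) \<in> V"
    and tri: "\<And>f g. f \<in> V \<Longrightarrow> g \<in> V \<Longrightarrow> q (\<lambda>x. f x - g x) \<le> q f + q g"
    and tri': "\<And>f g. f \<in> V \<Longrightarrow> g \<in> V \<Longrightarrow> q f \<le> q (\<lambda>x. f x - g x) + q g"
    and closable: "\<And>s. (\<And>n. s n \<in> V) \<Longrightarrow>
      (\<And>e. e > 0 \<Longrightarrow> \<exists>n0. \<forall>m\<ge>n0. \<forall>n\<ge>n0. q (\<lambda>x. s m x - s n x) < e) \<Longrightarrow>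
      (AE x in M. (\<lambda>n. s n x) \<longlonglongrightarrow> 0) \<Longrightarrow> (\<lambda>n. q (s n)) \<longlonglongrightarrow> 0"
    and s: "approximates M q V s u"
  shows "(\<lambda>n. q (s n)) \<longlonglongrightarrow> fun_completion_norm M q V u"
proof -
  have V: "s n \<in> V" for n using s by (simp add: approximates_def)
  have "Cauchy (\<lambda>n. q (s n))"
  proof (rule CauchyI)
    fix e :: real assume "e > 0"
    then obtain n0 where n0: "\<And>m n. m \<ge> n0 \<Longrightarrow> n \<ge> n0 \<Longrightarrow> q (\<lambda>x. s m x - s n x) < e"
      using s unfolding approximates_def by blast
    have "norm (q (s m) - q (s n)) < e" if "m \<ge> n0" "n \<ge> n0" for m n
      using n0[OF that] n0[OF that(2,1)] tri'[OF V[of m] V[of n]] tri'[OF V[of n] V[of m]] by auto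
    then show "\<exists>n0. \<forall>m\<ge>n0. \<forall>n\<ge>n0. norm (q (s m) - q (s n)) < e" by blast
  qed
  then obtain l where l: "(\<lambda>n. q (s n)) \<longlonglongrightarrow> l" using Cauchy_convergent convergentD by blast
  have zero: "(\<lambda>n. q (\<lambda>x. s n x - t n x)) \<longlonglongrightarrow> 0"
    if s: "approximates M q V s u" and t: "approximates M q V t u" for s t
  proof (rule closable)
    have S: "s n \<in> V" and T: "t n \<in> V" for n using s t by (simp_all add: approximates_def)
    show "(\<lambda>x. s n x - t n x) \<in> V" for n by (rule diff[OF S T])
    have "AE x in M. (\<lambda>n. s n x) \<longlonglongrightarrow> u x" "AE x in M. (\<lambda>n. t n x) \<longlonglongrightarrow> u x"
      using s t by (simp_all add: approximates_def)
    then show "AE x in M. (\<lambda>n. s n x - t n x) \<longlonglongrightarrow> 0"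
      by eventually_elim (auto intro!: tendsto_eq_intros)
    fix e :: real assume "e > 0"
    then have "e / 2 > 0" by simp
    then obtain n1 n2 where n1: "\<And>m n. m \<ge> n1 \<Longrightarrow> n \<ge> n1 \<Longrightarrow> q (\<lambda>x. s m x - s n x) < e / 2"
      and n2: "\<And>m n. m \<ge> n2 \<Longrightarrow> n \<ge> n2 \<Longrightarrow> q (\<lambda>x. t m x - t n x) < e / 2"
      using s t unfolding approximates_def by meson
    show "\<exists>n0. \<forall>m\<ge>n0. \<forall>n\<ge>n0. q (\<lambda>x. (s m x - t m x) - (s n x - t n x)) < e"
    proof (intro exI[of _ "max n1 n2"] allI impI)
      fix m n assume mn: "m \<ge> max n1 n2" "n \<ge> max n1 n2"
      have "(\<lambda>x. (s m x - t m x) - (s n x - t n x)) = (\<lambda>x. (s m x - s n x) - (t m x - t n x))"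
        by (auto simp: fun_eq_iff)
      then have "q (\<lambda>x. (s m x - t m x) - (s n x - t n x)) \<le> q (\<lambda>x. s m x - s n x) + q (\<lambda>x. t m x - t n x)"
        using tri[OF diff[OF S[of m] S[of n]] diff[OF T[of m] T[of n]]] by simp
      also have "\<dots> < e" using n1[of m n] n2[of m n] mn by simp
      finally show "q (\<lambda>x. (s m x - t m x) - (s n x - t n x)) < e" .
    qed
  qed
  have "fun_completion_norm M q V u = l"
    unfolding fun_completion_norm_def
  proof (rule the_equality)
    show "\<exists>s. approximates M q V s u \<and> (\<lambda>n. q (s n)) \<longlonglongrightarrow> l" using s l by blast
    fix l' assume "\<exists>s. approximates M q V s u \<and> (\<lambda>n. q (s n)) \<longlonglongrightarrow> l'"
    then obtain t where t: "approximates M q V t u" "(\<lambda>n. q (t n)) \<longlonglongrightarrow> l'" by blast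
    have T: "t n \<in> V" for n using t by (simp add: approximates_def)
    have "(\<lambda>n. q (s n) - q (t n)) \<longlonglongrightarrow> 0"
    proof (rule tendsto_sandwich[OF _ _ _ zero[OF s t(1)]])
      show "\<forall>\<^sub>F n in sequentially. q (s n) - q (t n) \<le> q (\<lambda>x. s n x - t n x)"
        using tri'[OF V T] by (simp add: algebra_simps)
      \<comment> \<open>The assumptions do not include symmetry of \<open>q\<close>, so the lower
        bound comes from the reversed difference.\<close>
      show "\<forall>\<^sub>F n in sequentially. - q (\<lambda>x. t n x - s n x) \<le> q (s n) - q (t n)"
        using tri'[OF T V] by (simp add: algebra_simps)
      show "(\<lambda>n. - q (\<lambda>x. t n x - s n x)) \<longlonglongrightarrow> 0"
        using tendsto_minus[OF zero[OF t(1) s]] by simp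
    qed
    then have "l - l' = 0"
      using LIMSEQ_unique tendsto_diff[OF l t(2)] by blast
    then show "l' = l" by simp
  qed
  then show ?thesis using l by simp
qed

section \<open>The two completion norms as limits along any approximating sequence\<close>

lemma D12_norm_tendsto:
  assumes "approximates lebesgue dirichlet_norm (test_functions UNIV) s (w :: 'a::euclidean_space \<Rightarrow> real)"
  shows "(\<lambda>n. dirichlet_norm (s n)) \<longlonglongrightarrow> D12_norm w"
  unfolding D12_norm_def
proof (rule fun_completion_norm_tendsto[OF _ _ _ _ assms])
  have p: "0 \<le> (0::real)" "0 \<le> real DIM('a) - 1" by (simp_all add: DIM_ge_Suc0 Suc_leI)
  fix f g :: "'a \<Rightarrow> real" assume fg: "f \<in> test_functions UNIV" "g \<in> test_functions UNIV"
  show "(\<lambda>x. f x - g x) \<in> test_functions UNIV" by (rule test_diff[OF fg])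
  note * = fg[THEN dirichlet_norm_eq_energy] dirichlet_norm_eq_energy[OF test_diff[OF fg]]
  show "dirichlet_norm (\<lambda>x. f x - g x) \<le> dirichlet_norm f + dirichlet_norm g"
    unfolding * by (rule energy_triangle[OF fg test_diff[OF fg] p]) (simp add: grad_diff[OF fg] norm_triangle_ineq4)
  show "dirichlet_norm f \<le> dirichlet_norm (\<lambda>x. f x - g x) + dirichlet_norm g"
    unfolding * by (rule energy_triangle[OF test_diff[OF fg] fg(2,1) p]) (simp add: grad_diff[OF fg] norm_triangle_sub add.commute)
next
  have p: "0 \<le> (0::real)" "0 \<le> real DIM('a) - 1" by (simp_all add: DIM_ge_Suc0 Suc_leI)
  fix s :: "nat \<Rightarrow> 'a \<Rightarrow> real"
  assume s: "\<And>n. s n \<in> test_functions UNIV"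
    and c: "\<And>e. e > 0 \<Longrightarrow> \<exists>n0. \<forall>m\<ge>n0. \<forall>n\<ge>n0. dirichlet_norm (\<lambda>x. s m x - s n x) < e"
    and l: "AE x in lebesgue. (\<lambda>n. s n x) \<longlonglongrightarrow> 0"
  have "(\<lambda>n. energy 0 (s n)) \<longlonglongrightarrow> 0"
  proof (rule energy_closable[OF s p])
    fix e :: real assume "e > 0"
    then obtain n0 where "\<And>m n. m \<ge> n0 \<Longrightarrow> n \<ge> n0 \<Longrightarrow> dirichlet_norm (\<lambda>x. s m x - s n x) < sqrt e"
      using c[of "sqrt e"] by (auto simp: real_sqrt_gt_zero)
    then show "\<exists>n0. \<forall>m\<ge>n0. \<forall>n\<ge>n0. energy 0 (\<lambda>x. s m x - s n x) < e"
      by (auto simp: dirichlet_norm_eq_energy[OF test_diff[OF s s]])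
  next
    show "AE x in lborel. (\<lambda>n. s n x) \<longlonglongrightarrow> 0" using l by (simp add: AE_completion_iff)
  qed
  from tendsto_real_sqrt[OF this] show "(\<lambda>n. dirichlet_norm (s n)) \<longlonglongrightarrow> 0"
    by (simp add: dirichlet_norm_eq_energy[OF s])
qed

lemma H_denseE:
  assumes "u \<in> H_dense R"
  obtains f where "f \<in> test_functions (ball 0 R)" "u = hardy_fun f"
  using assms by (auto simp: H_dense_def)

lemma H_norm_tendsto:
  fixes u :: "'a::euclidean_space \<Rightarrow> real"
  assumes n: "DIM('a) \<ge> 3" and R: "R > 0"
    and s: "approximates (lebesgue_on (ball 0 R)) (\<lambda>u. sqrt (H_quad R u)) (H_dense R) s u"
  shows "(\<lambda>n. sqrt (H_quad R (s n))) \<longlonglongrightarrow> H_norm R u"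
  unfolding H_norm_def
proof (rule fun_completion_norm_tendsto[OF _ _ _ _ s])
  have p: "0 \<le> real DIM('a) - 2" "real DIM('a) - 2 \<le> real DIM('a) - 1" using n by auto
  have d: "(\<lambda>x. hardy_fun \<phi> x - hardy_fun \<psi> x) = hardy_fun (\<lambda>x. \<phi> x - \<psi> x)" for \<phi> \<psi> :: "'a \<Rightarrow> real"
    by (auto simp: algebra_simps)
  {
    fix f g :: "'a \<Rightarrow> real" assume f: "f \<in> H_dense R" and g: "g \<in> H_dense R"
    obtain \<phi> where f': "\<phi> \<in> test_functions (ball 0 R)" "f = hardy_fun \<phi>" by (rule H_denseE[OF f])
    obtain \<psi> where g': "\<psi> \<in> test_functions (ball 0 R)" "g = hardy_fun \<psi>" by (rule H_denseE[OF g])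
    note fg = f'(1) g'(1) and e = f'(2) g'(2)
    show "(\<lambda>x. f x - g x) \<in> H_dense R"
      using test_diff[OF fg] unfolding e d by (auto simp: H_dense_def)
    note * = fg[THEN H_quad_hardy[OF _ R n]] H_quad_hardy[OF test_diff[OF fg] R n]
    show "sqrt (H_quad R (\<lambda>x. f x - g x)) \<le> sqrt (H_quad R f) + sqrt (H_quad R g)"
      unfolding e d * by (rule energy_triangle[OF fg test_diff[OF fg] p]) (simp add: grad_diff[OF fg] norm_triangle_ineq4)
    show "sqrt (H_quad R f) \<le> sqrt (H_quad R (\<lambda>x. f x - g x)) + sqrt (H_quad R g)"
      unfolding e d * by (rule energy_triangle[OF test_diff[OF fg] fg(2,1) p]) (simp add: grad_diff[OF fg] norm_triangle_sub add.commute)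
  next
    fix s :: "nat \<Rightarrow> 'a \<Rightarrow> real"
    assume s: "\<And>n. s n \<in> H_dense R"
      and c: "\<And>e. e > 0 \<Longrightarrow> \<exists>n0. \<forall>m\<ge>n0. \<forall>n\<ge>n0. sqrt (H_quad R (\<lambda>x. s m x - s n x)) < e"
      and l: "AE x in lebesgue_on (ball 0 R). (\<lambda>n. s n x) \<longlonglongrightarrow> 0"
    have "\<forall>n. \<exists>f. f \<in> test_functions (ball 0 R) \<and> s n = hardy_fun f" using s by (blast elim: H_denseE)
    then obtain f where f: "\<And>n. f n \<in> test_functions (ball 0 R)" and sf: "\<And>n. s n = hardy_fun (f n)" by metis
    have "(\<lambda>n. energy (real DIM('a) - 2) (f n)) \<longlonglongrightarrow> 0"
    proof (rule energy_closable[OF f p])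
      fix e :: real assume "e > 0"
      then obtain n0 where "\<And>m n. m \<ge> n0 \<Longrightarrow> n \<ge> n0 \<Longrightarrow> sqrt (H_quad R (\<lambda>x. s m x - s n x)) < sqrt e"
        using c[of "sqrt e"] by (auto simp: real_sqrt_gt_zero)
      then show "\<exists>n0. \<forall>m\<ge>n0. \<forall>n\<ge>n0. energy (real DIM('a) - 2) (\<lambda>x. f m x - f n x) < e"
        unfolding sf d H_quad_hardy[OF test_diff[OF f f] R n] by auto
    next
      \<comment> \<open>Closability asks for convergence on the whole space: inside the ball the
        singular factor is divided out away from the origin, and outside it every \<open>f n\<close>
        vanishes.\<close>
      have "AE x in lborel. x \<in> ball 0 R \<longrightarrow> (\<lambda>n. s n x) \<longlonglongrightarrow> 0"
        using l by (simp add: AE_restrict_space_iff AE_completion_iff)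
      moreover have "AE x in lborel. x \<noteq> (0::'a)" by (rule AE_lborel_singleton)
      ultimately show "AE x in lborel. (\<lambda>n. f n x) \<longlonglongrightarrow> 0"
      proof eventually_elim
        fix x :: 'a
        assume x: "x \<in> ball 0 R \<longrightarrow> (\<lambda>n. s n x) \<longlonglongrightarrow> 0" "x \<noteq> 0"
        show "(\<lambda>n. f n x) \<longlonglongrightarrow> 0"
        proof (cases "x \<in> ball 0 R")
          case True
          have "(\<lambda>n. norm x powr hardy_exp TYPE('a) * s n x) \<longlonglongrightarrow> norm x powr hardy_exp TYPE('a) * 0"
            using x True by (intro tendsto_intros) auto
          then show ?thesis using x by (simp add: sf powr_minus)
        next
          case False
          have "f n x = 0" for n
            using test_vanish[OF f R] False by (metis mem_ball_0 not_less order.strict_trans2 order_less_imp_le)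
          then show ?thesis by simp
        qed
      qed
    qed
    from tendsto_real_sqrt[OF this] show "(\<lambda>n. sqrt (H_quad R (s n))) \<longlonglongrightarrow> 0"
      by (simp add: sf H_quad_hardy[OF f R n])
  }
qed

section \<open>Radial test functions with a prescribed profile\<close>

definition bump_profile :: "(real \<Rightarrow> real) \<Rightarrow> bool" where
  "bump_profile h \<longleftrightarrow> (\<forall>k. D_fun UNIV k h) \<and> (\<exists>\<alpha> \<beta>. 0 < \<alpha> \<and> \<alpha> < \<beta> \<and> (\<forall>s. s \<notin> {\<alpha>..\<beta>} \<longrightarrow> h s = 0))"

text \<open>The V of the overview when \<open>h\<close> is V'. For \<open>s < 0\<close> the interval
  is empty and the value is 0, which is right for points outside the ball.\<close>

definition primitive :: "(real \<Rightarrow> real) \<Rightarrow> real \<Rightarrow> real" where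
  "primitive h s = integral {0..s} h"

lemma bump_profile_continuous: "bump_profile h \<Longrightarrow> continuous_on A h"
  unfolding bump_profile_def by (metis D_fun.simps(1) continuous_on_subset subset_UNIV)

lemma primitive_eq_0:
  assumes "\<And>s. s < \<alpha> \<Longrightarrow> h s = 0" "s \<le> \<alpha>"
  shows "primitive h s = 0"
proof -
  have "integral {0..s} h = integral {0..s} (\<lambda>_. 0)"
    by (rule integral_spike[where S = "{\<alpha>}"]) (use assms in auto)
  then show ?thesis by (simp add: primitive_def)
qed

lemma primitive_const:
  assumes h: "continuous_on UNIV h" "\<And>s. s > \<beta> \<Longrightarrow> h s = 0" and s: "0 \<le> \<beta>" "\<beta> \<le> s"
  shows "primitive h s = primitive h \<beta>"
proof -
  have "integral {\<beta>..s} h = integral {\<beta>..s} (\<lambda>_. 0)"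
    by (rule integral_spike[where S = "{\<beta>}"]) (use assms in auto)
  moreover have "integral {0..\<beta>} h + integral {\<beta>..s} h = integral {0..s} h"
    using s by (intro Henstock_Kurzweil_Integration.integral_combine integrable_continuous_real continuous_on_subset[OF h(1)]) auto
  ultimately show ?thesis by (simp add: primitive_def)
qed

text \<open>The fundamental theorem on \<open>{0..s + 1}\<close> is one-sided at its left end. Below
  \<open>\<alpha>\<close>, however, the primitive vanishes identically, and this covers all
  \<open>s \<le> 0\<close>.\<close>

lemma primitive_deriv:
  assumes h: "continuous_on UNIV h" "\<And>s. s < \<alpha> \<Longrightarrow> h s = 0" and \<alpha>: "0 < \<alpha>"
  shows "(primitive h has_real_derivative h s) (at s)"
proof (cases "s < \<alpha>")
  case True
  have "((\<lambda>_. 0) has_real_derivative h s) (at s)" using h(2)[OF True] by simp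
  then show ?thesis
    by (rule has_field_derivative_transform_within_open[of _ _ _ "{..<\<alpha>}"])
      (use True primitive_eq_0[OF h(2)] in auto)
next
  case False
  have "((\<lambda>u. integral {0..u} h) has_real_derivative h s) (at s within {0..s + 1})"
    using False \<alpha> by (intro integral_has_real_derivative continuous_on_subset[OF h(1)]) auto
  then have "((\<lambda>u. integral {0..u} h) has_real_derivative h s) (at s within {0<..<s + 1})"
    by (rule DERIV_subset) auto
  then show ?thesis
    using False \<alpha> by (simp add: primitive_def[abs_def] at_within_open[of s "{0<..<s + 1}"])
qed

text \<open>Common source of the functions on the ball and on the whole space. Here
  \<open>\<tau>\<close> expresses the profile variable through \<open>q = |x|^2\<close>, so that
  \<open>C_fun_radial\<close> applies; up to \<open>q0\<close> the profile has reached its final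
  constant, and from \<open>q1\<close> on it is still zero, which gives compact support.\<close>

lemma radial_test_function:
  fixes \<tau> \<tau>' :: "real \<Rightarrow> real"
  assumes h: "\<And>k. D_fun UNIV k h" "\<And>s. s \<notin> {\<alpha>..\<beta>} \<Longrightarrow> h s = 0" and \<alpha>: "0 < \<alpha>" "\<alpha> < \<beta>"
    and \<tau>: "\<And>k. D_fun {0<..} k \<tau>" and \<tau>': "\<And>q. q > 0 \<Longrightarrow> (\<tau> has_real_derivative \<tau>' q) (at q)"
    and q0: "q0 > 0" "\<And>q. 0 < q \<Longrightarrow> q \<le> q0 \<Longrightarrow> \<beta> \<le> \<tau> q"
    and q1: "\<And>q. q \<ge> q1 \<Longrightarrow> \<tau> q \<le> \<alpha>" "0 < q1" "q1 < r\<^sup>2" "0 < r"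
  obtains f :: "'a::euclidean_space \<Rightarrow> real" where "f \<in> test_functions (ball 0 r)"
    "\<And>x. x \<noteq> 0 \<Longrightarrow> f x = primitive h (\<tau> ((norm x)\<^sup>2))"
    "\<And>x. x \<noteq> 0 \<Longrightarrow> grad f x = (2 * h (\<tau> ((norm x)\<^sup>2)) * \<tau>' ((norm x)\<^sup>2)) *\<^sub>R x"
proof -
  have hc: "continuous_on UNIV h" using h(1)[of 0] by simp
  \<comment> \<open>Freezing the constant for \<open>q < q0\<close> extends the profile smoothly
    through \<open>q \<le> 0\<close>, where nothing is known about \<open>\<tau>\<close>.\<close>
  define G where "G = (\<lambda>q. if q < q0 then primitive h \<beta> else primitive h (\<tau> q))"
  have dH: "(primitive h has_real_derivative h s) (at s)" for s
    by (rule primitive_deriv[OF hc _ \<alpha>(1)]) (use h in auto)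
  have H: "D_fun UNIV k (primitive h)" for k
  proof (rule D_fun_SucD)
    show "D_fun UNIV (Suc k) (primitive h)" by (rule D_fun_SucI[OF _ dH h(1)]) auto
  qed
  have G1: "G q = primitive h (\<tau> q)" if "q > 0" for q
  proof (cases "q < q0")
    case True
    then have "primitive h (\<tau> q) = primitive h \<beta>"
      using primitive_const[OF hc, of \<beta> "\<tau> q"] h(2) q0(2)[OF that] \<alpha> by auto
    then show ?thesis by (simp add: G_def True)
  qed (simp add: G_def)
  have "D_fun ({..<q0} \<union> {0<..}) k G" for k
  proof (rule D_fun_Un)
    show "D_fun {..<q0} k G"
      by (rule D_fun_cong[OF _ _ D_fun_const[of _ _ "primitive h \<beta>"]]) (auto simp: G_def)
    show "D_fun {0<..} k G"
      by (rule D_fun_cong[OF _ _ D_fun_compose[OF _ \<tau> H]]) (auto simp: G1)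
  qed auto
  moreover have "{..<q0} \<union> {0<..} = (UNIV :: real set)" using q0(1) by auto
  ultimately have GD: "D_fun UNIV k G" for k by simp
  define f where "f = (\<lambda>x::'a. G (x \<bullet> x))"
  have C: "C_fun k f" for k unfolding f_def by (rule C_fun_radial[OF GD])
  have "f x = 0" if "norm x \<ge> sqrt q1" for x
  proof -
    have "x \<bullet> x \<ge> q1" using that q1(2) power_mono[of "sqrt q1" "norm x" 2] by (simp add: power2_norm_eq_inner)
    moreover from this have "0 < x \<bullet> x" using q1(2) by (rule less_le_trans[rotated])
    ultimately have "f x = primitive h (\<tau> (x \<bullet> x))" "\<tau> (x \<bullet> x) \<le> \<alpha>"
      unfolding f_def using G1[of "x \<bullet> x"] q1(1)[of "x \<bullet> x"] by auto
    then show ?thesis using primitive_eq_0[of \<alpha> h] h(2) by auto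
  qed
  then have "{x. f x \<noteq> 0} \<subseteq> cball 0 (sqrt q1)" by force
  then have cl: "closure {x. f x \<noteq> 0} \<subseteq> cball 0 (sqrt q1)" by (simp add: closure_minimal)
  moreover have "sqrt q1 < r" using q1(3,4) real_less_lsqrt[of r q1] by (simp add: q1(2) less_imp_le)
  ultimately have "closure {x. f x \<noteq> 0} \<subseteq> ball 0 r" by force
  moreover have "compact (closure {x. f x \<noteq> 0})"
    using cl by (meson bounded_cball bounded_subset closed_closure compact_eq_bounded_closed)
  ultimately have test: "f \<in> test_functions (ball 0 r)" using C by (simp add: test_functions_def)
  show ?thesis
  proof (rule that[OF test])
    fix x :: 'a assume x: "x \<noteq> 0"
    then have q: "x \<bullet> x > 0" by simp
    show "f x = primitive h (\<tau> ((norm x)\<^sup>2))" unfolding f_def G1[OF q] power2_norm_eq_inner ..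
    have "((\<lambda>q. primitive h (\<tau> q)) has_real_derivative h (\<tau> (x \<bullet> x)) * \<tau>' (x \<bullet> x)) (at (x \<bullet> x))"
      by (rule DERIV_chain2[OF dH \<tau>'[OF q]])
    then have "(G has_real_derivative h (\<tau> (x \<bullet> x)) * \<tau>' (x \<bullet> x)) (at (x \<bullet> x))"
      by (rule has_field_derivative_transform_within_open[of _ _ _ "{0<..}"]) (use q G1 in auto)
    then have "(f has_derivative (\<lambda>v. h (\<tau> (x \<bullet> x)) * \<tau>' (x \<bullet> x) * (2 * (x \<bullet> v)))) (at x)"
      unfolding f_def
      by (rule DERIV_compose_FDERIV[THEN has_derivative_eq_rhs]) (auto intro!: derivative_eq_intros simp: inner_commute)
    then show "grad f x = (2 * h (\<tau> ((norm x)\<^sup>2)) * \<tau>' ((norm x)\<^sup>2)) *\<^sub>R x"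
      by (intro grad_eqI) (simp add: power2_norm_eq_inner mult_ac)
  qed
qed

lemma log_test_function:
  assumes h: "bump_profile h" and R: "R > 0"
  obtains f :: "'a::euclidean_space \<Rightarrow> real" where "f \<in> test_functions (ball 0 R)"
    "\<And>x. x \<noteq> 0 \<Longrightarrow> f x = primitive h (- ln (norm x / R))"
    "\<And>x. x \<noteq> 0 \<Longrightarrow> grad f x = (- h (- ln (norm x / R)) / (norm x)\<^sup>2) *\<^sub>R x"
proof -
  obtain \<alpha> \<beta> where ab: "0 < \<alpha>" "\<alpha> < \<beta>" "\<And>s. s \<notin> {\<alpha>..\<beta>} \<Longrightarrow> h s = 0" and D: "\<And>k. D_fun UNIV k h"
    using h unfolding bump_profile_def by blast
  \<comment> \<open>This is \<open>- ln (sqrt q / R)\<close>. It takes the values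
    \<open>\<beta>\<close> and \<open>\<alpha>\<close> at \<open>R^2 * exp (- 2 * \<beta>)\<close>
    and \<open>R^2 * exp (- 2 * \<alpha>)\<close>, the thresholds used below.\<close>
  let ?\<tau> = "\<lambda>q. ln R + (-1/2) * ln q"
  have t: "?\<tau> ((norm x)\<^sup>2) = - ln (norm x / R)" if "x \<noteq> 0" for x :: 'a
    using that R by (simp add: ln_div ln_realpow)
  show ?thesis
  proof (rule radial_test_function[OF D ab(3,1,2), of ?\<tau> "\<lambda>q. - 1 / (2 * q)" "R\<^sup>2 * exp (- 2 * \<beta>)" "R\<^sup>2 * exp (- 2 * \<alpha>)" R])
    show "D_fun {0<..} k ?\<tau>" for k by (intro D_fun_add D_fun_mult D_fun_const D_fun_ln) auto
    show "(?\<tau> has_real_derivative - 1 / (2 * q)) (at q)" if "q > 0" for q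
      using that by (auto intro!: derivative_eq_intros)
    show "\<beta> \<le> ?\<tau> q" if "0 < q" "q \<le> R\<^sup>2 * exp (- 2 * \<beta>)" for q
    proof -
      have "ln q \<le> ln (R\<^sup>2 * exp (- 2 * \<beta>))" using that R by (intro ln_mono) auto
      then show ?thesis using R by (simp add: ln_mult ln_realpow)
    qed
    show "?\<tau> q \<le> \<alpha>" if "R\<^sup>2 * exp (- 2 * \<alpha>) \<le> q" for q
    proof -
      have "ln (R\<^sup>2 * exp (- 2 * \<alpha>)) \<le> ln q" using that R by (intro ln_mono) (auto intro: less_le_trans[rotated])
      then show ?thesis using R by (simp add: ln_mult ln_realpow)
    qed
    fix f :: "'a \<Rightarrow> real"
    assume f: "f \<in> test_functions (ball 0 R)"
      "\<And>x. x \<noteq> 0 \<Longrightarrow> f x = primitive h (?\<tau> ((norm x)\<^sup>2))"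
      "\<And>x. x \<noteq> 0 \<Longrightarrow> grad f x = (2 * h (?\<tau> ((norm x)\<^sup>2)) * (- 1 / (2 * (norm x)\<^sup>2))) *\<^sub>R x"
    show ?thesis
    proof (rule that[OF f(1)])
      fix x :: 'a assume x: "x \<noteq> 0"
      show "f x = primitive h (- ln (norm x / R))" using f(2)[OF x] unfolding t[OF x] .
      show "grad f x = (- h (- ln (norm x / R)) / (norm x)\<^sup>2) *\<^sub>R x" using f(3)[OF x] unfolding t[OF x] by simp
    qed
  qed (use R ab in auto)
qed

lemma power_test_function:
  assumes h: "bump_profile h" and m: "m > 0"
  obtains f :: "'a::euclidean_space \<Rightarrow> real" where "f \<in> test_functions UNIV"
    "\<And>x. x \<noteq> 0 \<Longrightarrow> f x = primitive h (norm x powr (- m))"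
    "\<And>x. x \<noteq> 0 \<Longrightarrow> grad f x = (- m * h (norm x powr (- m)) * norm x powr (- m - 2)) *\<^sub>R x"
proof -
  obtain \<alpha> \<beta> where ab: "0 < \<alpha>" "\<alpha> < \<beta>" "\<And>s. s \<notin> {\<alpha>..\<beta>} \<Longrightarrow> h s = 0" and D: "\<And>k. D_fun UNIV k h"
    using h unfolding bump_profile_def by blast
  \<comment> \<open>With \<open>q = |x|^2\<close> this is \<open>|x| powr (- m)\<close>; the
    thresholds \<open>\<beta> powr (- 2 / m)\<close> and \<open>\<alpha> powr (- 2 / m)\<close>
    solve \<open>?\<tau> q = \<beta>\<close> and \<open>?\<tau> q = \<alpha>\<close>. The summand 1
    in the radius below only makes it strictly larger than the support requires.\<close>
  let ?\<tau> = "\<lambda>q::real. q powr (- m / 2)"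
  have sq: "(norm x)\<^sup>2 = norm x powr 2" if "x \<noteq> 0" for x :: 'a
    using that by (simp add: powr_numeral)
  have t: "?\<tau> ((norm x)\<^sup>2) = norm x powr (- m)" if "x \<noteq> 0" for x :: 'a
    using that by (simp add: sq powr_powr del: powr_numeral)
  have inv: "(a powr (- 2 / m)) powr (- m / 2) = a" if "a > 0" for a
    using that m by (simp add: powr_powr)
  show ?thesis
  proof (rule radial_test_function[OF D ab(3,1,2), of ?\<tau> "\<lambda>q. (- m / 2) * q powr (- m / 2 - 1)" "\<beta> powr (- 2 / m)" "\<alpha> powr (- 2 / m)" "sqrt (\<alpha> powr (- 2 / m) + 1)"])
    show "D_fun {0<..} k ?\<tau>" for k by (rule D_fun_powr)
    show "(?\<tau> has_real_derivative (- m / 2) * q powr (- m / 2 - 1)) (at q)" if "q > 0" for q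
      using that by (rule has_real_derivative_powr)
    show "\<beta> \<le> ?\<tau> q" if "0 < q" "q \<le> \<beta> powr (- 2 / m)" for q
      using powr_mono2'[of "- m / 2" q "\<beta> powr (- 2 / m)"] that m inv[of \<beta>] ab by simp
    show "?\<tau> q \<le> \<alpha>" if "\<alpha> powr (- 2 / m) \<le> q" for q
      using powr_mono2'[of "- m / 2" "\<alpha> powr (- 2 / m)" q] that m inv[of \<alpha>] ab by simp
    fix f :: "'a \<Rightarrow> real"
    assume f: "f \<in> test_functions (ball 0 (sqrt (\<alpha> powr (- 2 / m) + 1)))"
      "\<And>x. x \<noteq> 0 \<Longrightarrow> f x = primitive h (?\<tau> ((norm x)\<^sup>2))"
      "\<And>x. x \<noteq> 0 \<Longrightarrow> grad f x = (2 * h (?\<tau> ((norm x)\<^sup>2)) * ((- m / 2) * ((norm x)\<^sup>2) powr (- m / 2 - 1))) *\<^sub>R x"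
    show ?thesis
    proof (rule that)
      show "f \<in> test_functions UNIV" using f(1) by (simp add: test_functions_def)
      fix x :: 'a assume x: "x \<noteq> 0"
      show "f x = primitive h (norm x powr (- m))" using f(2)[OF x] unfolding t[OF x] .
      have e: "((norm x)\<^sup>2) powr (- m / 2 - 1) = norm x powr (- m - 2)"
      proof -
        have "2 * (- m / 2 - 1) = - m - 2" by (simp add: algebra_simps)
        then show ?thesis unfolding sq[OF x] powr_powr by (rule arg_cong)
      qed
      show "grad f x = (- m * h (norm x powr (- m)) * norm x powr (- m - 2)) *\<^sub>R x"
        using f(3)[OF x] unfolding t[OF x] e by simp
    qed
  qed (use ab in \<open>auto intro: add_pos_pos\<close>)
qed

text \<open>The weight r^(2-N), the squared gradient k^2 / r^2 and the density r^(N-1) multiply to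
  k^2 / r, and dr / r is ds for \<open>s = - ln (r / R)\<close>.\<close>

lemma energy_log_profile:
  fixes f :: "'a::euclidean_space \<Rightarrow> real"
  assumes f: "f \<in> test_functions \<Omega>" and n: "DIM('a) \<ge> 2" and R: "R > 0"
    and [measurable]: "k \<in> borel_measurable borel"
    and g: "\<And>x. x \<noteq> 0 \<Longrightarrow> grad f x = (- k (- ln (norm x / R)) / (norm x)\<^sup>2) *\<^sub>R x"
  shows "ennreal (energy (real DIM('a) - 2) f) =
    ennreal (real DIM('a) * measure lborel (ball (0::'a) 1)) * (\<integral>\<^sup>+s. ennreal ((k s)\<^sup>2) \<partial>lborel)"
proof -
  let ?n = "DIM('a)" and ?c = "ennreal (real DIM('a) * measure lborel (ball (0::'a) 1))"
  let ?A = "\<lambda>r. ennreal (r powr (- real ?n) * (k (- ln (r / R)))\<^sup>2) * ennreal (r ^ (?n - 1)) * indicator {0<..} r"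
  let ?B = "\<lambda>r. ennreal \<bar>- 1 / r\<bar> * ennreal ((k (- ln (r / R)))\<^sup>2) * indicator {0<..} r"
  let ?C = "\<lambda>x::'a. ennreal (norm x powr (- real ?n) * (k (- ln (norm x / R)))\<^sup>2)"
  let ?L = "\<lambda>r. - ln (r / R)"
  have "ennreal (energy (real ?n - 2) f) = (\<integral>\<^sup>+x. ennreal (norm x powr (- (real ?n - 2)) * (norm (grad f x))\<^sup>2) \<partial>lborel)"
    by (rule nn_integral_energy[OF f, symmetric]) (use n in auto)
  also have "\<dots> = (\<integral>\<^sup>+x. ?C x \<partial>(lborel :: 'a measure))"
  proof (rule nn_integral_cong_AE)
    have "AE x in lborel. x \<noteq> (0::'a)" by (rule AE_lborel_singleton)
    then show "AE x in lborel. ennreal (norm x powr (- (real ?n - 2)) * (norm (grad f x))\<^sup>2) =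
      ?C x"
    proof eventually_elim
      fix x :: 'a assume x: "x \<noteq> 0"
      have "norm x powr (- real ?n) = norm x powr (- (real ?n - 2)) / (norm x)\<^sup>2"
        using x powr_diff[of "norm x" "- (real ?n - 2)" 2] by simp
      then show "ennreal (norm x powr (- (real ?n - 2)) * (norm (grad f x))\<^sup>2) =
        ?C x"
        using x by (simp add: g power_mult_distrib power_divide power2_eq_square)
    qed
  qed
  also have "\<dots> = ?c * (\<integral>\<^sup>+r. ?A r \<partial>lborel)"
    by (rule nn_integral_radial) measurable
  also have "(\<integral>\<^sup>+r. ?A r \<partial>lborel) =
    (\<integral>\<^sup>+r. ?B r \<partial>lborel)"
  proof (rule nn_integral_cong)
    fix r :: real
    have *: "r powr (- real ?n) * r ^ (?n - 1) = 1 / r" if "r > 0"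
    proof -
      have "r powr (- real ?n) * r ^ (?n - 1) = r powr (- real ?n + real (?n - 1))"
        by (simp only: powr_add powr_realpow[OF that])
      also have "- real ?n + real (?n - 1) = -1" using n by simp
      finally show ?thesis using that by (simp add: powr_minus divide_inverse)
    qed
    have "r powr (- real ?n) * (k (- ln (r / R)))\<^sup>2 * r ^ (?n - 1) = \<bar>- 1 / r\<bar> * (k (- ln (r / R)))\<^sup>2" if "r > 0"
    proof -
      have "r powr (- real ?n) * (k (- ln (r / R)))\<^sup>2 * r ^ (?n - 1) = (r powr (- real ?n) * r ^ (?n - 1)) * (k (- ln (r / R)))\<^sup>2"
        by (simp only: mult_ac)
      also have "\<dots> = \<bar>- 1 / r\<bar> * (k (- ln (r / R)))\<^sup>2" unfolding *[OF that] using that by simp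
      finally show ?thesis .
    qed
    then show "?A r =
      ?B r"
      by (simp add: ennreal_mult[symmetric] split: split_indicator)
  qed
  also have "\<dots> = (\<integral>\<^sup>+s. ennreal ((k s)\<^sup>2) * indicator (?L ` {0<..}) s \<partial>lborel)"
  proof (rule nn_integral_substitution_inj[symmetric])
    have "s \<in> ?L ` {0<..}" for s
      by (rule image_eqI[of _ _ "R * exp (- s)"]) (use R in auto)
    then have im: "?L ` {0<..} = UNIV" by auto
    show "?L ` {0<..} \<in> sets borel" unfolding im by simp
    show "((\<lambda>r. - ln (r / R)) has_real_derivative - 1 / r) (at r)" if "r \<in> {0<..}" for r
      using that R by (auto intro!: derivative_eq_intros)
    show "inj_on (\<lambda>r. - ln (r / R)) {0<..}" using R by (auto simp: inj_on_def)
  qed measurable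
  also have "\<dots> = (\<integral>\<^sup>+s. ennreal ((k s)\<^sup>2) \<partial>lborel)"
  proof (rule nn_integral_cong)
    fix s :: real
    have "s \<in> ?L ` {0<..}"
      by (rule image_eqI[of _ _ "R * exp (- s)"]) (use R in auto)
    then show "ennreal ((k s)\<^sup>2) * indicator (?L ` {0<..}) s = ennreal ((k s)\<^sup>2)" by simp
  qed
  finally show ?thesis .
qed

lemma powr_neg_image: "m > 0 \<Longrightarrow> (\<lambda>t::real. t powr (- m)) ` {0<..} = {0<..}"
proof (intro equalityI subsetI)
  fix s :: real assume "m > 0" "s \<in> {0<..}"
  then show "s \<in> (\<lambda>t. t powr (- m)) ` {0<..}"
    by (intro image_eqI[of _ _ "s powr (- 1 / m)"]) (auto simp: powr_powr)
qed auto

text \<open>The squared gradient m^2 k^2 t^(-2m-2) times the density t^(m+1) is m k^2 |ds/dt| for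
  \<open>s = t powr (- m)\<close>, which leaves one factor \<open>m\<close>. As \<open>s\<close>
  covers only the positive half-line, \<open>k0\<close> supplies the rest of the line.\<close>

lemma energy_power_profile:
  fixes f :: "'a::euclidean_space \<Rightarrow> real"
  assumes f: "f \<in> test_functions \<Omega>" and m: "m = real DIM('a) - 2" "m > 0"
    and [measurable]: "k \<in> borel_measurable borel" and k0: "\<And>s. s \<le> 0 \<Longrightarrow> k s = 0"
    and g: "\<And>x. x \<noteq> 0 \<Longrightarrow> grad f x = (- m * k (norm x powr (- m)) * norm x powr (- m - 2)) *\<^sub>R x"
  shows "ennreal (energy 0 f) =
    ennreal (m * (real DIM('a) * measure lborel (ball (0::'a) 1))) * (\<integral>\<^sup>+s. ennreal ((k s)\<^sup>2) \<partial>lborel)"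
proof -
  let ?n = "DIM('a)" and ?c = "real DIM('a) * measure lborel (ball (0::'a) 1)"
  let ?u = "\<lambda>t::real. t powr (- m)"
  let ?A = "\<lambda>t. ennreal (m\<^sup>2 * (k (?u t))\<^sup>2 * (t powr (- m - 1))\<^sup>2) * ennreal (t ^ (?n - 1)) * indicator {0<..} t"
  let ?B = "\<lambda>t. ennreal \<bar>- m * t powr (- m - 1)\<bar> * ennreal ((k (?u t))\<^sup>2) * indicator {0<..} t"
  have "ennreal (energy 0 f) = (\<integral>\<^sup>+x. ennreal (norm x powr (- 0) * (norm (grad f x))\<^sup>2) \<partial>lborel)"
    by (rule nn_integral_energy[OF f, symmetric]) (use m in auto)
  also have "\<dots> = (\<integral>\<^sup>+x. ennreal (m\<^sup>2 * (k (?u (norm x)))\<^sup>2 * (norm x powr (- m - 1))\<^sup>2) \<partial>(lborel :: 'a measure))"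
  proof (rule nn_integral_cong_AE)
    have "AE x in lborel. x \<noteq> (0::'a)" by (rule AE_lborel_singleton)
    then show "AE x in lborel. ennreal (norm x powr (- 0) * (norm (grad f x))\<^sup>2) = ennreal (m\<^sup>2 * (k (?u (norm x)))\<^sup>2 * (norm x powr (- m - 1))\<^sup>2)"
    proof eventually_elim
      fix x :: 'a assume x: "x \<noteq> 0"
      have "- m - 1 = (- m - 2) + 1" by simp
      then have "norm x powr (- m - 1) = norm x powr ((- m - 2) + 1)" by (rule arg_cong)
      also have "\<dots> = norm x powr (- m - 2) * norm x" using x by (simp only: powr_add) simp
      finally show "ennreal (norm x powr (- 0) * (norm (grad f x))\<^sup>2) = ennreal (m\<^sup>2 * (k (?u (norm x)))\<^sup>2 * (norm x powr (- m - 1))\<^sup>2)"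
        using x by (simp add: g power_mult_distrib)
    qed
  qed
  also have "\<dots> = ennreal ?c * (\<integral>\<^sup>+t. ?A t \<partial>lborel)"
    by (rule nn_integral_radial) measurable
  also have "(\<integral>\<^sup>+t. ?A t \<partial>lborel) =
    (\<integral>\<^sup>+t. ennreal m * (?B t) \<partial>lborel)"
  proof (rule nn_integral_cong)
    fix t :: real
    have *: "t powr (- m - 1) * t ^ (?n - 1) = 1" if "t > 0"
    proof -
      have "t powr (- m - 1) * t ^ (?n - 1) = t powr ((- m - 1) + real (?n - 1))"
        by (simp only: powr_add powr_realpow[OF that])
      also have "(- m - 1) + real (?n - 1) = 0" using m by (simp add: of_nat_diff)
      finally show ?thesis using that by simp
    qed
    have "m\<^sup>2 * (k (?u t))\<^sup>2 * (t powr (- m - 1))\<^sup>2 * t ^ (?n - 1) = m * (\<bar>- m * t powr (- m - 1)\<bar> * (k (?u t))\<^sup>2)" if "t > 0"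
    proof -
      have "m\<^sup>2 * (k (?u t))\<^sup>2 * (t powr (- m - 1))\<^sup>2 * t ^ (?n - 1) =
        (t powr (- m - 1) * t ^ (?n - 1)) * (m * (m * t powr (- m - 1) * (k (?u t))\<^sup>2))"
        by (simp only: power2_eq_square mult_ac)
      also have "\<dots> = m * (\<bar>- m * t powr (- m - 1)\<bar> * (k (?u t))\<^sup>2)"
        unfolding *[OF that] using m(2) by (simp add: abs_mult)
      finally show ?thesis .
    qed
    then show "?A t =
      ennreal m * (?B t)"
      using m(2) by (simp add: ennreal_mult[symmetric] split: split_indicator)
  qed
  also have "\<dots> = ennreal m * (\<integral>\<^sup>+t. ?B t \<partial>lborel)"
    by (rule nn_integral_cmult) measurable
  also have "(\<integral>\<^sup>+t. ?B t \<partial>lborel) =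
    (\<integral>\<^sup>+s. ennreal ((k s)\<^sup>2) * indicator (?u ` {0<..}) s \<partial>lborel)"
  proof (rule nn_integral_substitution_inj[symmetric])
    show "?u ` {0<..} \<in> sets borel" unfolding powr_neg_image[OF m(2)] by simp
    show "(?u has_real_derivative - m * t powr (- m - 1)) (at t)" if "t \<in> {0<..}" for t
      using that by (intro has_real_derivative_powr) auto
    show "inj_on ?u {0<..}" using m(2) by (intro inj_on_inverseI[where g = "\<lambda>s. s powr (- 1 / m)"]) (auto simp: powr_powr)
  qed measurable
  also have "\<dots> = (\<integral>\<^sup>+s. ennreal ((k s)\<^sup>2) \<partial>lborel)"
    unfolding powr_neg_image[OF m(2)] by (rule nn_integral_cong) (auto simp: k0 split: split_indicator)
  finally show ?thesis
    using m(2) by (simp add: ennreal_mult' mult_ac)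
qed

section \<open>Profiles along rays\<close>

abbreviation sqnorm :: "(real \<Rightarrow> real) \<Rightarrow> ennreal" where
  "sqnorm f \<equiv> \<integral>\<^sup>+s. ennreal ((f s)\<^sup>2) \<partial>lborel"

lemma sqnorm_add_le:
  assumes [measurable]: "f \<in> borel_measurable borel" "g \<in> borel_measurable borel"
  shows "sqnorm (\<lambda>s. f s + g s) \<le> 2 * sqnorm f + 2 * sqnorm g"
proof -
  have "sqnorm (\<lambda>s. f s + g s) \<le> (\<integral>\<^sup>+s. 2 * ennreal ((f s)\<^sup>2) + 2 * ennreal ((g s)\<^sup>2) \<partial>lborel)"
  proof (rule nn_integral_mono)
    fix s :: real
    have "(f s + g s)\<^sup>2 \<le> 2 * (f s)\<^sup>2 + 2 * (g s)\<^sup>2"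
      using zero_le_power2[of "f s - g s"] by (simp add: power2_sum power2_diff)
    then have "ennreal ((f s + g s)\<^sup>2) \<le> ennreal (2 * (f s)\<^sup>2 + 2 * (g s)\<^sup>2)" by (rule ennreal_leI)
    also have "\<dots> = 2 * ennreal ((f s)\<^sup>2) + 2 * ennreal ((g s)\<^sup>2)"
      by (simp add: ennreal_plus ennreal_mult)
    finally show "ennreal ((f s + g s)\<^sup>2) \<le> 2 * ennreal ((f s)\<^sup>2) + 2 * ennreal ((g s)\<^sup>2)" .
  qed
  also have "\<dots> = 2 * sqnorm f + 2 * sqnorm g"
    by (simp add: nn_integral_add nn_integral_cmult)
  finally show ?thesis .
qed

text \<open>From \<open>\<bar>d\<bar> \<le> \<eta> + d^2 / \<eta>\<close>, integrated. The bound is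
  cruder than Cauchy-Schwarz, but it tends to 0 with \<open>\<eta>\<close> for each fixed
  \<open>s\<close>, which is what pointwise convergence of primitives asks for.\<close>

lemma integral_le_sqnorm:
  assumes d: "continuous_on UNIV d" and I: "sqnorm d \<le> ennreal (\<eta>\<^sup>2)" and \<eta>: "\<eta> > 0" and s: "s \<ge> 0"
  shows "\<bar>integral {0..s} d\<bar> \<le> (s + 1) * \<eta>"
proof -
  have d': "continuous_on {0..s} d" by (rule continuous_on_subset[OF d]) simp
  have i2: "(\<lambda>t. (d t)\<^sup>2) integrable_on {0..s}"
    by (intro integrable_continuous_real continuous_intros d')
  have "ennreal (integral {0..s} (\<lambda>t. (d t)\<^sup>2)) = (\<integral>\<^sup>+t. ennreal (indicator {0..s} t * (d t)\<^sup>2) \<partial>lborel)"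
    by (rule nn_integral_has_integral_lebesgue[symmetric, OF _ integrable_integral[OF i2]]) auto
  also have "\<dots> \<le> sqnorm d" by (intro nn_integral_mono ennreal_leI) (auto split: split_indicator)
  also have "\<dots> \<le> ennreal (\<eta>\<^sup>2)" by (rule I)
  finally have 1: "integral {0..s} (\<lambda>t. (d t)\<^sup>2) \<le> \<eta>\<^sup>2" by (simp add: ennreal_le_iff)
  have i3: "((\<lambda>t. \<eta> + (d t)\<^sup>2 / \<eta>) has_integral (s * \<eta> + integral {0..s} (\<lambda>t. (d t)\<^sup>2) / \<eta>)) {0..s}"
    using has_integral_add[OF has_integral_const_real[of \<eta> 0 s] has_integral_divide[OF integrable_integral[OF i2], of \<eta>]] s by simp
  have "norm (integral {0..s} d) \<le> integral {0..s} (\<lambda>t. \<eta> + (d t)\<^sup>2 / \<eta>)"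
  proof (rule integral_norm_bound_integral[OF integrable_continuous_real[OF d'] has_integral_integrable[OF i3]])
    fix t
    have "2 * (\<bar>d t\<bar> * \<eta>) \<le> \<eta>\<^sup>2 + (d t)\<^sup>2"
      using zero_le_power2[of "\<bar>d t\<bar> - \<eta>"] by (simp add: power2_diff algebra_simps)
    moreover have "0 \<le> \<bar>d t\<bar> * \<eta>" using \<eta> by simp
    ultimately have "\<bar>d t\<bar> * \<eta> \<le> \<eta>\<^sup>2 + (d t)\<^sup>2" by linarith
    then show "norm (d t) \<le> \<eta> + (d t)\<^sup>2 / \<eta>" using \<eta> by (simp add: field_simps power2_eq_square)
  qed
  also have "\<dots> = s * \<eta> + integral {0..s} (\<lambda>t. (d t)\<^sup>2) / \<eta>" by (rule integral_unique[OF i3])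
  also have "\<dots> \<le> s * \<eta> + \<eta>\<^sup>2 / \<eta>" using 1 \<eta> by (intro add_left_mono divide_right_mono) auto
  also have "\<dots> = (s + 1) * \<eta>" using \<eta> by (simp add: power2_eq_square algebra_simps)
  finally show ?thesis by simp
qed

section \<open>Approximation by smooth profiles of compact support\<close>

lemma flat_exp_pos: "flat_exp j x > 0 \<longleftrightarrow> x > 0"
  by (simp add: flat_exp_def)

lemma flat_exp_0_bounds: "0 \<le> flat_exp 0 x" "flat_exp 0 x \<le> 1"
  by (auto simp: flat_exp_def)

text \<open>
  Dividing by a smooth bump before applying Weierstrass and multiplying by it afterwards makes the
  polynomial approximation compactly supported.
\<close>

lemma bump_profile_approx_compact:
  fixes v :: "real \<Rightarrow> real"
  assumes v: "continuous_on UNIV v" "\<And>s. s \<notin> {\<delta>..M} \<Longrightarrow> v s = 0" and \<delta>: "0 < \<delta>" "\<delta> < M" and \<eta>: "\<eta> > 0"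
  obtains h where "bump_profile h" "\<And>s. \<bar>h s - v s\<bar> \<le> \<eta>" "\<And>s. s \<notin> {0..M+1} \<Longrightarrow> h s = 0"
proof -
  define B where "B = (\<lambda>s. flat_exp 0 (s + (- \<delta> / 2)) * flat_exp 0 ((M + 1) + (-1) * s))"
  have BD: "D_fun UNIV k B" for k
    unfolding B_def by (intro D_fun_mult D_fun_compose[OF _ _ D_fun_flat_exp] D_fun_add D_fun_ident D_fun_const) auto
  have Bc: "continuous_on A B" for A using BD[of 0] continuous_on_subset by auto
  have B01: "0 \<le> B s" "B s \<le> 1" for s
    unfolding B_def using flat_exp_0_bounds by (auto intro!: mult_nonneg_nonneg mult_le_one)
  have Bpos: "B s > 0" if "s \<in> {\<delta>..M}" for s
    unfolding B_def using that \<delta> by (intro mult_pos_pos) (auto simp: flat_exp_pos)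
  have B0: "B s = 0" if "s \<notin> {\<delta>/2..M+1}" for s
    using that by (auto simp: B_def flat_exp_def)
  obtain s0 where s0: "s0 \<in> {\<delta>..M}" "\<And>s. s \<in> {\<delta>..M} \<Longrightarrow> B s0 \<le> B s"
    using continuous_attains_inf[of "{\<delta>..M}" B] Bc \<delta> by auto
  define c where "c = B s0"
  have c: "c > 0" using Bpos[OF s0(1)] by (simp add: c_def)
  \<comment> \<open>On \<open>{\<delta>..M}\<close> the maximum equals \<open>B s\<close>, and
    elsewhere \<open>v\<close> vanishes; hence \<open>k * B = v\<close>, while the denominator never
    drops below \<open>c\<close> and \<open>k\<close> is continuous.\<close>
  define k where "k = (\<lambda>s. v s / max (B s) c)"
  have kB: "k s * B s = v s" for s
  proof (cases "s \<in> {\<delta>..M}")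
    case True
    then show ?thesis using s0(2)[OF True] c Bpos[OF True] by (simp add: k_def c_def max_absorb1)
  qed (simp add: k_def v(2))
  have "continuous_on {0..M+1} k"
    unfolding k_def using c by (intro continuous_intros Bc continuous_on_subset[OF v(1)]) auto
  then obtain p where p: "real_polynomial_function p" "\<And>s. s \<in> {0..M+1} \<Longrightarrow> \<bar>k s - p s\<bar> < \<eta>"
    using Stone_Weierstrass_real_polynomial_function[of "{0..M+1}" k \<eta>] \<eta> by auto
  show ?thesis
  proof (rule that[of "\<lambda>s. p s * B s"])
    show "bump_profile (\<lambda>s. p s * B s)"
      unfolding bump_profile_def
    proof (intro conjI allI exI)
      show "D_fun UNIV k (\<lambda>s. p s * B s)" for k
        by (intro D_fun_mult D_fun_real_polynomial p BD) auto
      show "0 < \<delta> / 2" "\<delta> / 2 < M + 1" using \<delta> by auto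
      show "s \<notin> {\<delta>/2..M+1} \<longrightarrow> p s * B s = 0" for s using B0 by simp
    qed
    show "p s * B s = 0" if "s \<notin> {0..M+1}" for s using B0[of s] that \<delta> by auto
    show "\<bar>p s * B s - v s\<bar> \<le> \<eta>" for s
    proof (cases "s \<in> {0..M+1}")
      case True
      have "\<bar>p s * B s - v s\<bar> = \<bar>k s - p s\<bar> * B s"
        unfolding kB[symmetric] using B01(1)[of s] by (simp add: abs_mult left_diff_distrib[symmetric] abs_minus_commute)
      also have "\<dots> \<le> \<eta> * 1" using p(2)[OF True] B01[of s] \<eta> by (intro mult_mono) auto
      finally show ?thesis by simp
    next
      case False
      then show ?thesis using B0[of s] v(2)[of s] \<delta> \<eta> by auto
    qed
  qed
qed

text \<open>Exponential decay makes the tail beyond \<open>M\<close> cheap: it costs at most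
  \<open>C^2 * exp (- 2 * M) / 2\<close> in the squared norm. What remains has compact support and
  is approximated uniformly, which on a bounded interval controls the squared norm.\<close>

lemma bump_profile_approx:
  fixes v :: "real \<Rightarrow> real"
  assumes v: "continuous_on UNIV v" "\<And>s. s \<le> \<delta> \<Longrightarrow> v s = 0" "\<And>s. \<bar>v s\<bar> \<le> C * exp (- s)"
    and \<delta>: "0 < \<delta>" and e: "e > 0"
  obtains h where "bump_profile h" "sqnorm (\<lambda>s. h s - v s) \<le> ennreal e"
proof -
  have "((\<lambda>M. C\<^sup>2 * exp (- 2 * M)) \<longlongrightarrow> C\<^sup>2 * 0) at_top"
    by (intro tendsto_intros filterlim_compose[OF exp_at_bot] filterlim_tendsto_neg_mult_at_bot[OF tendsto_const] filterlim_ident) auto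
  then have "\<forall>\<^sub>F M in at_top. C\<^sup>2 * exp (- 2 * M) < e / 2"
    by (rule order_tendstoD(2)) (use e in simp)
  then obtain M where M: "M \<ge> \<delta> + 1" "C\<^sup>2 * exp (- 2 * M) < e / 2"
    using eventually_conj[OF eventually_ge_at_top[of "\<delta> + 1"], THEN eventually_happens] by fastforce
  \<comment> \<open>A continuous cutoff, 1 up to \<open>M\<close> and 0 from \<open>M + 1\<close>
    on. The uniform approximation adds another unit, so its support ends at
    \<open>M + 2\<close>.\<close>
  define \<theta> where "\<theta> = (\<lambda>s. max 0 (min 1 (M + 1 - s)))"
  \<comment> \<open>Chosen so that the uniform error, squared, doubled and multiplied by the length
    \<open>M + 2\<close>, is \<open>e / 2\<close>; the doubled tail stays below the other
    half.\<close>
  define \<eta> where "\<eta> = sqrt (e / (4 * (M + 2)))"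
  have M2: "M + 2 > 0" using M \<delta> by simp
  have \<eta>: "\<eta> > 0" unfolding \<eta>_def using e M2 by simp
  have "\<eta>\<^sup>2 = e / (4 * (M + 2))" unfolding \<eta>_def using e M2 by simp
  then have \<eta>2: "2 * \<eta>\<^sup>2 * (M + 2) = e / 2" using M2 by (simp add: divide_simps) (simp add: algebra_simps)
  have c: "continuous_on UNIV (\<lambda>s. v s * \<theta> s)"
    unfolding \<theta>_def by (intro continuous_intros v(1))
  have z: "v s * \<theta> s = 0" if "s \<notin> {\<delta>..M+1}" for s
    using that v(2)[of s] by (auto simp: \<theta>_def)
  obtain h where h: "bump_profile h" "\<And>s. \<bar>h s - v s * \<theta> s\<bar> \<le> \<eta>" "\<And>s. s \<notin> {0..M+1+1} \<Longrightarrow> h s = 0"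
    by (rule bump_profile_approx_compact[OF c z \<delta> _ \<eta>]) (use M in auto)
  have [measurable]: "h \<in> borel_measurable borel" "v \<in> borel_measurable borel"
    using bump_profile_continuous[OF h(1)] v(1) by (auto intro: borel_measurable_continuous_onI)
  have [measurable]: "\<theta> \<in> borel_measurable borel" unfolding \<theta>_def by measurable
  have "sqnorm (\<lambda>s. (h s - v s * \<theta> s) + (v s * \<theta> s - v s)) \<le> 2 * sqnorm (\<lambda>s. h s - v s * \<theta> s) + 2 * sqnorm (\<lambda>s. v s * \<theta> s - v s)"
    by (rule sqnorm_add_le) measurable
  also have "sqnorm (\<lambda>s. h s - v s * \<theta> s) \<le> (\<integral>\<^sup>+s. ennreal (\<eta>\<^sup>2) * indicator {0..M+2} s \<partial>lborel)"
  proof (rule nn_integral_mono)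
    fix s
    show "ennreal ((h s - v s * \<theta> s)\<^sup>2) \<le> ennreal (\<eta>\<^sup>2) * indicator {0..M+2} s"
    proof (cases "s \<in> {0..M+2}")
      case True
      then show ?thesis using power_mono[OF h(2)[of s], of 2] by (auto intro!: ennreal_leI)
    next
      case False
      then show ?thesis using h(3)[of s] z[of s] \<delta> by auto
    qed
  qed
  also have "\<dots> = ennreal (\<eta>\<^sup>2 * (M + 2))" using M \<delta> by (simp add: nn_integral_cmult_indicator ennreal_mult)
  also have "sqnorm (\<lambda>s. v s * \<theta> s - v s) \<le> (\<integral>\<^sup>+s. ennreal (C\<^sup>2 * exp (- 2 * s)) * indicator {M..} s \<partial>lborel)"
  proof (rule nn_integral_mono)
    fix s
    show "ennreal ((v s * \<theta> s - v s)\<^sup>2) \<le> ennreal (C\<^sup>2 * exp (- 2 * s)) * indicator {M..} s"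
    proof (cases "s < M")
      case True
      then show ?thesis by (simp add: \<theta>_def)
    next
      case False
      have "\<bar>v s * \<theta> s - v s\<bar> = \<bar>v s\<bar> * \<bar>\<theta> s - 1\<bar>" by (simp add: abs_mult[symmetric] algebra_simps)
      also have "\<dots> \<le> (C * exp (- s)) * 1"
        by (intro mult_mono v(3)) (auto simp: \<theta>_def intro: order_trans[OF abs_ge_zero v(3)])
      finally have "\<bar>v s * \<theta> s - v s\<bar> \<le> C * exp (- s)" by simp
      from power_mono[OF this, of 2] have "(v s * \<theta> s - v s)\<^sup>2 \<le> (C * exp (- s))\<^sup>2" by simp
      also have "\<dots> = C\<^sup>2 * exp (- 2 * s)" by (simp add: power_mult_distrib exp_double[symmetric])
      finally show ?thesis using False by (simp add: ennreal_leI)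
    qed
  qed
  also have "\<dots> = ennreal (0 - (- (C\<^sup>2 * exp (- 2 * M) / 2)))"
  proof (rule nn_integral_FTC_atLeast)
    show "((\<lambda>s. - (C\<^sup>2 * exp (- 2 * s) / 2)) has_real_derivative C\<^sup>2 * exp (- 2 * s)) (at s)" for s
      by (auto intro!: derivative_eq_intros)
    have "((\<lambda>s. - (C\<^sup>2 * exp (- 2 * s) / 2)) \<longlongrightarrow> - (C\<^sup>2 * 0 / 2)) at_top"
      by (intro tendsto_intros filterlim_compose[OF exp_at_bot] filterlim_tendsto_neg_mult_at_bot[OF tendsto_const] filterlim_ident) auto
    then show "((\<lambda>s. - (C\<^sup>2 * exp (- 2 * s) / 2)) \<longlongrightarrow> 0) at_top" by simp
  qed auto
  finally have "sqnorm (\<lambda>s. h s - v s) \<le> 2 * ennreal (\<eta>\<^sup>2 * (M + 2)) + 2 * ennreal (C\<^sup>2 * exp (- 2 * M) / 2)"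
    by (simp add: add_mono mult_left_mono)
  also have "\<dots> = ennreal (2 * \<eta>\<^sup>2 * (M + 2) + C\<^sup>2 * exp (- 2 * M))"
  proof -
    have "2 * ennreal x = ennreal (2 * x)" for x by (simp add: ennreal_mult')
    then show ?thesis using M2 by (simp add: ennreal_plus[symmetric] mult.assoc del: ennreal_plus)
  qed
  also have "\<dots> \<le> ennreal e" using M \<eta>2 by (intro ennreal_leI) simp
  finally show ?thesis by (rule that[OF h(1)])
qed

text \<open>The derivative with respect to \<open>s\<close> of \<open>f\<close> at the point of
  radius \<open>R * exp (- s)\<close> on the ray through \<open>\<omega>\<close>.\<close>

definition ray_profile :: "real \<Rightarrow> ('a::euclidean_space \<Rightarrow> real) \<Rightarrow> 'a \<Rightarrow> real \<Rightarrow> real" where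
  "ray_profile R f \<omega> s = - (R * exp (- s)) * (\<omega> \<bullet> grad f ((R * exp (- s)) *\<^sub>R \<omega>))"

lemma ray_profile_continuous:
  "f \<in> test_functions \<Omega> \<Longrightarrow> continuous_on UNIV (ray_profile R f \<omega>)"
  unfolding ray_profile_def[abs_def]
  by (intro continuous_intros continuous_on_compose2[OF test_continuous_grad]) auto

lemma ray_profile_diff:
  "f \<in> test_functions \<Omega> \<Longrightarrow> g \<in> test_functions \<Omega> \<Longrightarrow>
    ray_profile R (\<lambda>x. f x - g x) \<omega> s = ray_profile R f \<omega> s - ray_profile R g \<omega> s"
  by (simp add: ray_profile_def grad_diff inner_diff_right algebra_simps)

text \<open>The margin between the support of \<open>f\<close> and the sphere makes the profile
  vanish up to \<open>ln (R / r)\<close>. At the other end it need not vanish, but the bounded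
  gradient makes it decay like \<open>exp (- s)\<close>.\<close>

lemma ray_profile_approx:
  fixes f :: "'a::euclidean_space \<Rightarrow> real"
  assumes f: "f \<in> test_functions (ball 0 R)" and R: "R > 0" and \<omega>: "norm \<omega> = 1" and e: "e > 0"
  obtains h where "bump_profile h" "sqnorm (\<lambda>s. h s - ray_profile R f \<omega> s) \<le> ennreal e"
proof -
  obtain r where r: "0 < r" "r < R" "\<And>x. norm x \<ge> r \<Longrightarrow> f x = 0 \<and> grad f x = 0" using test_vanish[OF f R] by metis
  obtain C where C: "C > 0" "\<And>x. norm (grad f x) \<le> C" using test_bounded_grad[OF f] by metis
  show ?thesis
  proof (rule bump_profile_approx[OF ray_profile_continuous[OF f] _ _ _ e])
    show "0 < ln (R / r)" using r by simp
    show "ray_profile R f \<omega> s = 0" if "s \<le> ln (R / r)" for s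
    proof -
      have "exp (- ln (R / r)) \<le> exp (- s)" using that by simp
      then have "r \<le> R * exp (- s)" using r R by (simp add: exp_minus field_simps)
      then have "grad f ((R * exp (- s)) *\<^sub>R \<omega>) = 0" using R \<omega> by (intro conjunct2[OF r(3)]) (simp add: abs_mult)
      then show ?thesis by (simp add: ray_profile_def)
    qed
    show "\<bar>ray_profile R f \<omega> s\<bar> \<le> (R * C) * exp (- s)" for s
    proof -
      have "\<bar>\<omega> \<bullet> grad f ((R * exp (- s)) *\<^sub>R \<omega>)\<bar> \<le> C"
        using Cauchy_Schwarz_ineq2[of \<omega> "grad f ((R * exp (- s)) *\<^sub>R \<omega>)"] \<omega> C(2)[of "(R * exp (- s)) *\<^sub>R \<omega>"] by simp
      then have "(R * exp (- s)) * \<bar>\<omega> \<bullet> grad f ((R * exp (- s)) *\<^sub>R \<omega>)\<bar> \<le> (R * exp (- s)) * C"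
        using R by (intro mult_left_mono) auto
      then show ?thesis using R by (simp add: ray_profile_def abs_mult mult_ac)
    qed
  qed (rule that)
qed

lemma primitive_ray_profile:
  fixes f :: "'a::euclidean_space \<Rightarrow> real"
  assumes f: "f \<in> test_functions (ball 0 R)" and R: "R > 0" and \<omega>: "norm \<omega> = 1" and s: "s \<ge> 0"
  shows "primitive (ray_profile R f \<omega>) s = f ((R * exp (- s)) *\<^sub>R \<omega>)"
proof -
  obtain r where r: "r < R" "\<And>x. norm x \<ge> r \<Longrightarrow> f x = 0 \<and> grad f x = 0" using test_vanish[OF f R] by metis
  have d: "((\<lambda>s. f ((R * exp (- s)) *\<^sub>R \<omega>)) has_real_derivative ray_profile R f \<omega> t) (at t)" for t
  proof -
    have "((\<lambda>s. R * exp (- s)) has_real_derivative - (R * exp (- t))) (at t)"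
      by (auto intro!: derivative_eq_intros)
    from DERIV_chain2[OF test_ray_derivative[OF f, of \<omega>] this]
    show ?thesis by (simp add: ray_profile_def mult_ac)
  qed
  have "(ray_profile R f \<omega> has_integral (f ((R * exp (- s)) *\<^sub>R \<omega>) - f ((R * exp (- 0)) *\<^sub>R \<omega>))) {0..s}"
    using s d by (intro fundamental_theorem_of_calculus)
      (auto simp: has_real_derivative_iff_has_vector_derivative[symmetric] intro: DERIV_subset)
  moreover have "f ((R * exp (- 0)) *\<^sub>R \<omega>) = 0"
    using r(1) \<omega> R by (intro conjunct1[OF r(2)]) auto
  ultimately show ?thesis by (simp add: primitive_def integral_unique)
qed

text \<open>With \<open>r = R * exp (- s)\<close> the left side becomes the integral of r
  (\<open>\<omega>\<close> . grad f)^2, and r = r^(2-N) r^(N-1) is the weight times the radial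
  density. Dropping the angular part of the gradient and the factor \<open>DIM('a) \<ge> 1\<close>
  gives the inequality.\<close>

lemma ray_profile_energy:
  fixes f :: "'a::euclidean_space \<Rightarrow> real"
  assumes f: "f \<in> test_functions \<Omega>" and n: "DIM('a) \<ge> 2" and R: "R > 0"
  shows "(\<integral>\<^sup>+\<omega>. sqnorm (ray_profile R f \<omega>) \<partial>cone_measure) \<le> ennreal (energy (real DIM('a) - 2) f)"
proof -
  let ?n = "DIM('a)"
  let ?I = "\<lambda>\<omega>. \<integral>\<^sup>+r. ennreal (norm (r *\<^sub>R \<omega>) powr (- (real ?n - 2)) * (norm (grad f (r *\<^sub>R \<omega>)))\<^sup>2) * ennreal (real ?n * r ^ (?n - 1)) * indicator {0<..} r \<partial>lborel"
  have [measurable]: "grad f \<in> borel_measurable borel" by (rule test_measurable_grad[OF f])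
  have im: "(\<lambda>s. R * exp (- s)) ` UNIV = {0<..}"
  proof (intro equalityI subsetI)
    fix r :: real assume "r \<in> {0<..}"
    then show "r \<in> (\<lambda>s. R * exp (- s)) ` UNIV"
      using R by (intro image_eqI[of _ _ "- ln (r / R)"]) auto
  qed (use R in auto)
  have "(\<integral>\<^sup>+\<omega>. sqnorm (ray_profile R f \<omega>) \<partial>cone_measure) \<le>
    (\<integral>\<^sup>+\<omega>. ?I \<omega>
      \<partial>cone_measure)"
  proof (rule nn_integral_mono_AE, use AE_cone_measure_norm in eventually_elim)
    fix \<omega> :: 'a assume \<omega>: "norm \<omega> = 1"
    have "sqnorm (ray_profile R f \<omega>) = (\<integral>\<^sup>+s. ennreal \<bar>- (R * exp (- s))\<bar> * ennreal ((R * exp (- s)) * (\<omega> \<bullet> grad f ((R * exp (- s)) *\<^sub>R \<omega>))\<^sup>2) * indicator UNIV s \<partial>lborel)"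
      using R by (intro nn_integral_cong) (simp add: ray_profile_def ennreal_mult[symmetric] power_mult_distrib power2_eq_square mult_ac)
    also have "\<dots> = (\<integral>\<^sup>+r. ennreal (r * (\<omega> \<bullet> grad f (r *\<^sub>R \<omega>))\<^sup>2) * indicator ((\<lambda>s. R * exp (- s)) ` UNIV) r \<partial>lborel)"
    proof (rule nn_integral_substitution_inj[symmetric])
      show "(\<lambda>s. R * exp (- s)) ` UNIV \<in> sets borel" unfolding im by simp
      show "((\<lambda>s. R * exp (- s)) has_real_derivative - (R * exp (- s))) (at s)" for s
        by (auto intro!: derivative_eq_intros)
      show "inj (\<lambda>s. R * exp (- s))" using R by (auto simp: inj_on_def)
    qed measurable
    also have "\<dots> \<le> ?I \<omega>"
      unfolding im
    proof (rule nn_integral_mono)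
      fix r :: real
      have "r * (\<omega> \<bullet> grad f (r *\<^sub>R \<omega>))\<^sup>2 \<le> norm (r *\<^sub>R \<omega>) powr (- (real ?n - 2)) * (norm (grad f (r *\<^sub>R \<omega>)))\<^sup>2 * (real ?n * r ^ (?n - 1))" if r: "r > 0"
      proof -
        have "r powr (- (real ?n - 2)) * r ^ (?n - 1) = r powr (- (real ?n - 2) + real (?n - 1))"
          by (simp only: powr_add powr_realpow[OF r])
        also have "- (real ?n - 2) + real (?n - 1) = 1" using n by simp
        finally have *: "r powr (- (real ?n - 2)) * r ^ (?n - 1) = r" using r by simp
        have "\<bar>\<omega> \<bullet> grad f (r *\<^sub>R \<omega>)\<bar> \<le> norm (grad f (r *\<^sub>R \<omega>))"
          using Cauchy_Schwarz_ineq2[of \<omega> "grad f (r *\<^sub>R \<omega>)"] \<omega> by simp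
        then have "(\<omega> \<bullet> grad f (r *\<^sub>R \<omega>))\<^sup>2 \<le> (norm (grad f (r *\<^sub>R \<omega>)))\<^sup>2"
          by (metis abs_ge_zero power2_abs power_mono)
        then have "r * (\<omega> \<bullet> grad f (r *\<^sub>R \<omega>))\<^sup>2 \<le> r * (real ?n * (norm (grad f (r *\<^sub>R \<omega>)))\<^sup>2)"
        proof (intro mult_left_mono)
          assume "(\<omega> \<bullet> grad f (r *\<^sub>R \<omega>))\<^sup>2 \<le> (norm (grad f (r *\<^sub>R \<omega>)))\<^sup>2"
          also have "\<dots> = 1 * (norm (grad f (r *\<^sub>R \<omega>)))\<^sup>2" by simp
          also have "\<dots> \<le> real ?n * (norm (grad f (r *\<^sub>R \<omega>)))\<^sup>2" using n by (intro mult_right_mono) auto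
          finally show "(\<omega> \<bullet> grad f (r *\<^sub>R \<omega>))\<^sup>2 \<le> real ?n * (norm (grad f (r *\<^sub>R \<omega>)))\<^sup>2" .
        qed (use r in auto)
        also have "\<dots> = (r powr (- (real ?n - 2)) * r ^ (?n - 1)) * (real ?n * (norm (grad f (r *\<^sub>R \<omega>)))\<^sup>2)"
          unfolding * ..
        also have "\<dots> = norm (r *\<^sub>R \<omega>) powr (- (real ?n - 2)) * (norm (grad f (r *\<^sub>R \<omega>)))\<^sup>2 * (real ?n * r ^ (?n - 1))"
          using r \<omega> by (simp add: mult_ac)
        finally show ?thesis .
      qed
      then show "ennreal (r * (\<omega> \<bullet> grad f (r *\<^sub>R \<omega>))\<^sup>2) * indicator {0<..} r \<le>
        ennreal (norm (r *\<^sub>R \<omega>) powr (- (real ?n - 2)) * (norm (grad f (r *\<^sub>R \<omega>)))\<^sup>2) * ennreal (real ?n * r ^ (?n - 1)) * indicator {0<..} r"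
        by (cases "r > 0") (simp_all add: ennreal_mult[symmetric] ennreal_leI del: norm_scaleR)
    qed
    finally show "sqnorm (ray_profile R f \<omega>) \<le> ?I \<omega>" .
  qed
  also have "\<dots> = (\<integral>\<^sup>+x. ennreal (norm x powr (- (real ?n - 2)) * (norm (grad f x))\<^sup>2) \<partial>lborel)"
    by (rule nn_integral_polar'[symmetric]) measurable
  also have "\<dots> = ennreal (energy (real ?n - 2) f)"
    by (rule nn_integral_energy[OF f]) (use n in auto)
  finally show ?thesis .
qed

lemma sqnorm_ray_profile_measurable:
  fixes f :: "'a::euclidean_space \<Rightarrow> real"
  assumes f: "f \<in> test_functions \<Omega>"
  shows "(\<lambda>\<omega>. sqnorm (ray_profile R f \<omega>)) \<in> borel_measurable cone_measure"
proof -
  have [measurable]: "grad f \<in> borel_measurable borel" by (rule test_measurable_grad[OF f])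
  show ?thesis unfolding ray_profile_def by measurable
qed

text \<open>The ratio 1/4 beats the factor 2 of \<open>sqnorm_add_le\<close>; the constant
  \<open>4 * D\<close> reproduces itself because
  \<open>2 * (4 * D) / 4 + 2 * D = 4 * D\<close>.\<close>

lemma sqnorm_telescope:
  fixes h :: "nat \<Rightarrow> real \<Rightarrow> real"
  assumes [measurable]: "\<And>k. h k \<in> borel_measurable borel" and D: "D \<ge> 0"
    and step: "\<And>k. sqnorm (\<lambda>s. h (Suc k) s - h k s) \<le> ennreal (D * (1/4) ^ k)"
  shows "sqnorm (\<lambda>s. h (k + j) s - h k s) \<le> ennreal (4 * D * (1/4) ^ k)"
proof (induction j arbitrary: k)
  case 0
  then show ?case by simp
next
  case (Suc j)
  have t: "2 * ennreal x = ennreal (2 * x)" for x by (simp add: ennreal_mult')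
  have "sqnorm (\<lambda>s. (h (Suc k + j) s - h (Suc k) s) + (h (Suc k) s - h k s)) \<le>
    2 * sqnorm (\<lambda>s. h (Suc k + j) s - h (Suc k) s) + 2 * sqnorm (\<lambda>s. h (Suc k) s - h k s)"
    by (rule sqnorm_add_le) measurable
  also have "\<dots> \<le> 2 * ennreal (4 * D * (1/4) ^ Suc k) + 2 * ennreal (D * (1/4) ^ k)"
    by (intro add_mono mult_left_mono Suc.IH step) auto
  also have "\<dots> = ennreal (4 * D * (1/4) ^ k)"
    unfolding t using D by (subst ennreal_plus[symmetric]) auto
  finally show ?case by simp
qed

text \<open>
  Along a fast subsequence the restrictions of the \<open>\<phi> k\<close> to almost every ray converge, so a single
  well-chosen ray already gives the profile of the radial limit and no spherical averages are needed.
\<close>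

lemma profile_selection:
  fixes \<phi> :: "nat \<Rightarrow> 'a::euclidean_space \<Rightarrow> real" and v0 :: "real \<Rightarrow> real"
  assumes \<phi>: "\<And>k. \<phi> k \<in> test_functions (ball 0 R)" and n: "DIM('a) \<ge> 2" and R: "R > 0"
    and cauchy: "\<forall>e>0. \<exists>n0. \<forall>m\<ge>n0. \<forall>n\<ge>n0. energy (real DIM('a) - 2) (\<lambda>x. \<phi> m x - \<phi> n x) < e"
    and lim: "AE x in lborel. x \<in> ball 0 R \<longrightarrow> (\<lambda>k. \<phi> k x) \<longlonglongrightarrow> v0 (norm x)"
  shows "\<exists>h B. (\<forall>k. bump_profile (h k)) \<and> 0 < B \<and>
    (\<forall>k m n. k \<le> m \<longrightarrow> k \<le> n \<longrightarrow> sqnorm (\<lambda>s. h m s - h n s) \<le> ennreal (B * (1/4) ^ k)) \<and>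
    (AE s in lborel. 0 < s \<longrightarrow> (\<lambda>k. primitive (h k) s) \<longlonglongrightarrow> v0 (R * exp (- s)))"
proof -
  let ?p = "real DIM('a) - 2"
  \<comment> \<open>The rate 1/8 is split as 1/4 times 1/2: multiplied by \<open>4 ^ k\<close> the
    energies are still summable, and finiteness of the weighted sum on a ray then yields the rate
    1/4 there.\<close>
  have "\<forall>k. \<exists>n0. \<forall>m\<ge>n0. \<forall>n\<ge>n0. energy ?p (\<lambda>x. \<phi> m x - \<phi> n x) < (1/8) ^ k"
    using cauchy by simp
  then obtain N where N: "\<And>k m n. m \<ge> N k \<Longrightarrow> n \<ge> N k \<Longrightarrow> energy ?p (\<lambda>x. \<phi> m x - \<phi> n x) < (1/8) ^ k"
    by metis
  \<comment> \<open>The sum forces \<open>r k \<ge> N k\<close>, and the summand \<open>k\<close>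
    makes \<open>r\<close> strictly increasing.\<close>
  define r where "r = (\<lambda>k. (\<Sum>i\<le>k. N i) + k)"
  have r: "strict_mono r" by (rule strict_mono_Suc_iff[THEN iffD2]) (simp add: r_def)
  have rN: "r k \<ge> N k" for k unfolding r_def by (rule trans_le_add1) (auto intro: member_le_sum)
  define g where "g = (\<lambda>k x. \<phi> (r (Suc k)) x - \<phi> (r k) x)"
  have g: "g k \<in> test_functions (ball 0 R)" for k unfolding g_def by (rule test_diff[OF \<phi> \<phi>])
  have gE: "energy ?p (g k) \<le> (1/8) ^ k" for k
    unfolding g_def using N[of k "r (Suc k)" "r k"] rN[of k] strict_monoD[OF r, of k "Suc k"] by simp
  let ?X = "\<lambda>k \<omega>. sqnorm (ray_profile R (g k) \<omega>)"
  note [measurable] = sqnorm_ray_profile_measurable[OF g]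
  have "(\<integral>\<^sup>+\<omega>. (\<Sum>k. ennreal (4 ^ k) * ?X k \<omega>) \<partial>cone_measure) = (\<Sum>k. ennreal (4 ^ k) * (\<integral>\<^sup>+\<omega>. ?X k \<omega> \<partial>cone_measure))"
    by (subst nn_integral_suminf) (simp_all add: nn_integral_cmult)
  also have "\<dots> \<le> (\<Sum>k. ennreal ((1/2) ^ k))"
  proof (rule suminf_le)
    fix k
    have "ennreal (4 ^ k) * (\<integral>\<^sup>+\<omega>. ?X k \<omega> \<partial>cone_measure) \<le> ennreal (4 ^ k) * ennreal ((1/8) ^ k)"
      by (intro mult_left_mono order_trans[OF ray_profile_energy[OF g n R]] ennreal_leI gE) auto
    also have "\<dots> = ennreal ((1/2) ^ k)" by (simp add: ennreal_mult[symmetric] power_mult_distrib[symmetric])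
    finally show "ennreal (4 ^ k) * (\<integral>\<^sup>+\<omega>. ?X k \<omega> \<partial>cone_measure) \<le> ennreal ((1/2) ^ k)" .
  qed auto
  also have "\<dots> = ennreal (\<Sum>k. (1/2) ^ k)" by (rule suminf_ennreal2) (auto intro: summable_geometric)
  finally have "(\<integral>\<^sup>+\<omega>. (\<Sum>k. ennreal (4 ^ k) * ?X k \<omega>) \<partial>cone_measure) \<noteq> \<infinity>"
    by (auto simp: top_unique)
  then have "AE \<omega> in cone_measure. (\<Sum>k. ennreal (4 ^ k) * ?X k \<omega>) \<noteq> \<infinity>"
    by (intro nn_integral_noteq_infinite) auto
  moreover note AE_cone_measure_norm AE_polar[OF lim]
  ultimately have "AE \<omega> in cone_measure. (\<Sum>k. ennreal (4 ^ k) * ?X k \<omega>) \<noteq> \<infinity> \<and> norm \<omega> = 1 \<and>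
    (AE t in lborel. 0 < t \<longrightarrow> t *\<^sub>R \<omega> \<in> ball 0 R \<longrightarrow> (\<lambda>k. \<phi> k (t *\<^sub>R \<omega>)) \<longlonglongrightarrow> v0 (norm (t *\<^sub>R \<omega>)))"
    by eventually_elim blast
  \<comment> \<open>The cone measure is not zero, so a property of almost every direction holds for
    at least one.\<close>
  moreover have "ae_filter (cone_measure :: 'a measure) \<noteq> bot"
    unfolding ae_filter_eq_bot_iff by (simp add: emeasure_cone_measure_UNIV content_ball_pos)
  ultimately obtain \<omega> :: 'a where fin: "(\<Sum>k. ennreal (4 ^ k) * ?X k \<omega>) \<noteq> \<infinity>" and \<omega>: "norm \<omega> = 1"
    and AEt: "AE t in lborel. 0 < t \<longrightarrow> t *\<^sub>R \<omega> \<in> ball 0 R \<longrightarrow> (\<lambda>k. \<phi> k (t *\<^sub>R \<omega>)) \<longlonglongrightarrow> v0 (norm (t *\<^sub>R \<omega>))"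
    using eventually_happens' by blast
  obtain C where C: "C \<ge> 0" "(\<Sum>k. ennreal (4 ^ k) * ?X k \<omega>) = ennreal C"
    using fin by (cases "\<Sum>k. ennreal (4 ^ k) * ?X k \<omega>") auto
  have X: "?X k \<omega> \<le> ennreal (C * (1/4) ^ k)" for k
  proof -
    have "ennreal (4 ^ k) * ?X k \<omega> \<le> ennreal C"
      unfolding C(2)[symmetric] using sum_le_suminf[of "\<lambda>k. ennreal (4 ^ k) * ?X k \<omega>" "{k}"] by simp
    then have "ennreal ((1/4) ^ k) * (ennreal (4 ^ k) * ?X k \<omega>) \<le> ennreal ((1/4) ^ k) * ennreal C"
      by (intro mult_left_mono) auto
    moreover have "ennreal ((1/4) ^ k) * ennreal (4 ^ k) = 1"
      by (simp add: ennreal_mult[symmetric] power_mult_distrib[symmetric])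
    then have "ennreal ((1/4) ^ k) * (ennreal (4 ^ k) * ?X k \<omega>) = ?X k \<omega>"
      by (simp only: mult.assoc[symmetric] mult_1_left)
    moreover have "ennreal ((1/4) ^ k) * ennreal C = ennreal (C * (1/4) ^ k)"
      using C(1) by (subst ennreal_mult[symmetric]) (auto simp: mult.commute)
    ultimately show ?thesis by (simp only:)
  qed
  let ?v = "\<lambda>k. ray_profile R (\<phi> (r k)) \<omega>"
  have "\<exists>h. bump_profile h \<and> sqnorm (\<lambda>s. h s - ?v k s) \<le> ennreal ((1/4) ^ k)" for k
    by (rule ray_profile_approx[OF \<phi>[of "r k"] R \<omega>, of "(1/4) ^ k"]) auto
  then obtain h where h: "\<And>k. bump_profile (h k)" and hv: "\<And>k. sqnorm (\<lambda>s. h k s - ?v k s) \<le> ennreal ((1/4) ^ k)"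
    by metis
  have hc: "continuous_on A (h k)" for A k by (rule bump_profile_continuous[OF h])
  have vc: "continuous_on A (?v k)" for A k
    by (rule continuous_on_subset[OF ray_profile_continuous[OF \<phi>]]) simp
  have [measurable]: "h k \<in> borel_measurable borel" "?v k \<in> borel_measurable borel" for k
    using hc vc by (auto intro: borel_measurable_continuous_onI)
  have t: "2 * ennreal x = ennreal (2 * x)" for x by (simp add: ennreal_mult')
  \<comment> \<open>Passing from \<open>h k\<close> to \<open>h (Suc k)\<close> through the two ray
    profiles costs at most 2/4 + 4 * C + 4 in units of \<open>(1/4) ^ k\<close>.\<close>
  define D where "D = 6 + 4 * C"
  have D: "D \<ge> 0" using C by (simp add: D_def)
  have step: "sqnorm (\<lambda>s. h (Suc k) s - h k s) \<le> ennreal (D * (1/4) ^ k)" for k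
  proof -
    let ?a = "\<lambda>s. h (Suc k) s - ?v (Suc k) s" and ?b = "\<lambda>s. ?v (Suc k) s - ?v k s" and ?c = "\<lambda>s. ?v k s - h k s"
    have b: "sqnorm ?b \<le> ennreal (C * (1/4) ^ k)"
      using X[of k] unfolding g_def ray_profile_diff[OF \<phi> \<phi>] .
    have c: "sqnorm ?c \<le> ennreal ((1/4) ^ k)" using hv[of k] by (simp only: power2_commute)
    have "sqnorm (\<lambda>s. ?a s + (?b s + ?c s)) \<le> 2 * sqnorm ?a + 2 * sqnorm (\<lambda>s. ?b s + ?c s)"
      by (rule sqnorm_add_le) measurable
    also have "\<dots> \<le> 2 * sqnorm ?a + 2 * (2 * sqnorm ?b + 2 * sqnorm ?c)"
      by (intro add_left_mono mult_left_mono sqnorm_add_le) auto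
    also have "\<dots> \<le> 2 * ennreal ((1/4) ^ Suc k) + 2 * (2 * ennreal (C * (1/4) ^ k) + 2 * ennreal ((1/4) ^ k))"
      by (intro add_mono mult_left_mono hv b c) auto
    also have "\<dots> = ennreal (2 * (1/4) ^ Suc k + 2 * (2 * (C * (1/4) ^ k) + 2 * (1/4) ^ k))"
      unfolding t using C(1) by (subst ennreal_plus[symmetric], simp, simp, unfold t, subst ennreal_plus[symmetric]) auto
    also have "\<dots> \<le> ennreal (D * (1/4) ^ k)"
      by (intro ennreal_leI) (simp add: D_def algebra_simps)
    finally show ?thesis by simp
  qed
  have tel: "sqnorm (\<lambda>s. h m s - h n s) \<le> ennreal ((4 * D + 1) * (1/4) ^ k)" if "k \<le> n" "n \<le> m" for k m n
  proof -
    have "sqnorm (\<lambda>s. h m s - h n s) \<le> ennreal (4 * D * (1/4) ^ n)"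
      using sqnorm_telescope[OF _ D step, of n "m - n"] that by simp
    also have "\<dots> \<le> ennreal ((4 * D + 1) * (1/4) ^ k)"
      using D that by (intro ennreal_leI mult_mono power_decreasing) auto
    finally show ?thesis .
  qed
  show ?thesis
  proof (intro exI[of _ h] exI[of _ "4 * D + 1"] conjI allI impI h)
    show "4 * D + 1 > 0" using D by simp
    show "sqnorm (\<lambda>s. h m s - h n s) \<le> ennreal ((4 * D + 1) * (1/4) ^ k)" if "k \<le> m" "k \<le> n" for k m n
    proof (cases "n \<le> m")
      case True
      then show ?thesis using tel that by simp
    next
      case False
      then show ?thesis using tel[of k m n] that by (subst power2_commute) simp
    qed
    have im: "(\<lambda>s. R * exp (- s)) ` {0<..} = {0<..<R}"
    proof (intro equalityI subsetI)
      fix t assume "t \<in> {0<..<R}"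
      then show "t \<in> (\<lambda>s. R * exp (- s)) ` {0<..}"
        using R by (intro image_eqI[of _ _ "- ln (t / R)"]) (auto simp: ln_less_zero_iff divide_less_eq)
    qed (use R in auto)
    have "AE s in lborel. s \<in> {0<..} \<longrightarrow> (\<lambda>k. \<phi> k ((R * exp (- s)) *\<^sub>R \<omega>)) \<longlonglongrightarrow> v0 (R * exp (- s))"
    proof (rule AE_substitution_inj[where g' = "\<lambda>s. - (R * exp (- s))"])
      show "AE t in lborel. t \<in> (\<lambda>s. R * exp (- s)) ` {0<..} \<longrightarrow> (\<lambda>k. \<phi> k (t *\<^sub>R \<omega>)) \<longlonglongrightarrow> v0 t"
        unfolding im using AEt by eventually_elim (use \<omega> in auto)
      show "(\<lambda>s. R * exp (- s)) ` {0<..} \<in> sets borel" unfolding im by simp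
      show "((\<lambda>s. R * exp (- s)) has_real_derivative - (R * exp (- s))) (at s)" for s
        by (auto intro!: derivative_eq_intros)
      show "inj_on (\<lambda>s. R * exp (- s)) {0<..}" using R by (auto simp: inj_on_def)
      show "- (R * exp (- s)) \<noteq> 0" for s using R by simp
    qed measurable
    then show "AE s in lborel. 0 < s \<longrightarrow> (\<lambda>k. primitive (h k) s) \<longlonglongrightarrow> v0 (R * exp (- s))"
    proof eventually_elim
      fix s assume *: "s \<in> {0<..} \<longrightarrow> (\<lambda>k. \<phi> k ((R * exp (- s)) *\<^sub>R \<omega>)) \<longlonglongrightarrow> v0 (R * exp (- s))"
      show "0 < s \<longrightarrow> (\<lambda>k. primitive (h k) s) \<longlonglongrightarrow> v0 (R * exp (- s))"
      proof
        assume s: "0 < s"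
        then have "(\<lambda>k. \<phi> k ((R * exp (- s)) *\<^sub>R \<omega>)) \<longlonglongrightarrow> v0 (R * exp (- s))" using * by simp
        from LIMSEQ_subseq_LIMSEQ[OF this r]
        have 1: "(\<lambda>k. primitive (?v k) s) \<longlonglongrightarrow> v0 (R * exp (- s))"
          using s by (simp add: primitive_ray_profile[OF \<phi> R \<omega>] o_def)
        \<comment> \<open>Closeness \<open>(1/4) ^ k\<close> in the squared norm gives closeness of
          order \<open>(1/2) ^ k\<close> of the primitives at each \<open>s\<close>, so
          \<open>h k\<close> inherits the pointwise limit of the ray profiles.\<close>
        have "(\<lambda>k. primitive (h k) s - primitive (?v k) s) \<longlonglongrightarrow> 0"
        proof (rule Lim_null_comparison)
          have "\<bar>primitive (h k) s - primitive (?v k) s\<bar> \<le> (s + 1) * (1/2) ^ k" for k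
          proof -
            have "primitive (h k) s - primitive (?v k) s = integral {0..s} (\<lambda>s. h k s - ?v k s)"
              unfolding primitive_def
              by (intro Henstock_Kurzweil_Integration.integral_diff[symmetric] integrable_continuous_real hc vc)
            moreover have "\<bar>integral {0..s} (\<lambda>s. h k s - ?v k s)\<bar> \<le> (s + 1) * (1/2) ^ k"
            proof (rule integral_le_sqnorm)
              show "continuous_on UNIV (\<lambda>s. h k s - ?v k s)" by (intro continuous_intros hc vc)
              have "((1/2) ^ k)\<^sup>2 = (1/4 :: real) ^ k" by (simp add: power2_eq_square power_mult_distrib[symmetric])
              then show "sqnorm (\<lambda>s. h k s - ?v k s) \<le> ennreal (((1/2) ^ k)\<^sup>2)" using hv[of k] by simp
            qed (use s in auto)
            ultimately show ?thesis by simp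
          qed
          then show "\<forall>\<^sub>F k in sequentially. norm (primitive (h k) s - primitive (?v k) s) \<le> (s + 1) * (1/2) ^ k"
            by simp
          have "(\<lambda>k. (s + 1) * (1/2) ^ k) \<longlonglongrightarrow> (s + 1) * 0"
            by (intro tendsto_intros LIMSEQ_power_zero) auto
          then show "(\<lambda>k. (s + 1) * (1/2) ^ k) \<longlonglongrightarrow> 0" by simp
        qed
        from tendsto_add[OF this 1] show "(\<lambda>k. primitive (h k) s) \<longlonglongrightarrow> v0 (R * exp (- s))" by simp
      qed
    qed
  qed
qed

section \<open>Transplanting one sequence of profiles to the ball and to the whole space\<close>

lemma approximates_sqrtI:
  assumes V: "\<And>n. s n \<in> V"
    and q: "\<And>m n. q (\<lambda>x. s m x - s n x) = sqrt (E m n)"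
    and E: "\<And>k m n. k \<le> m \<Longrightarrow> k \<le> n \<Longrightarrow> E m n \<le> A * (1/4) ^ k"
    and lim: "AE x in M. (\<lambda>n. s n x) \<longlonglongrightarrow> u x"
  shows "approximates M q V s u"
  unfolding approximates_def
proof (intro conjI allI impI V lim)
  fix e :: real assume e: "e > 0"
  have "(\<lambda>k. A * (1/4) ^ k) \<longlonglongrightarrow> A * 0" by (intro tendsto_intros LIMSEQ_power_zero) auto
  then have "\<forall>\<^sub>F k in sequentially. A * (1/4) ^ k < e\<^sup>2"
    by (rule order_tendstoD(2)) (use e in simp)
  then obtain k where k: "A * (1/4) ^ k < e\<^sup>2" by (auto simp: eventually_sequentially)
  have "q (\<lambda>x. s m x - s n x) < e" if "m \<ge> k" "n \<ge> k" for m n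
    unfolding q using E[OF that] k e by (intro real_less_lsqrt) auto
  then show "\<exists>n0. \<forall>m\<ge>n0. \<forall>n\<ge>n0. q (\<lambda>x. s m x - s n x) < e" by blast
qed

theorem corollary1p1:
  fixes R :: real
    and u :: "'a::euclidean_space \<Rightarrow> real"
    and U W :: "real \<Rightarrow> real"
    and w :: "'a \<Rightarrow> real"
  assumes "DIM('a) \<ge> 3"
    and "R > 0"
    and "u \<in> H_radial R"
    and "radial_profile (lebesgue_on (ball 0 R)) u U"
    and "\<And>r. 0 < r \<Longrightarrow> r < R \<Longrightarrow>
           W ((- ln (r / R)) powr (- 1 / (real DIM('a) - 2))) = r powr ((real DIM('a) - 2) / 2) * U r"
    and "\<And>y. w y = W (norm y)"
  shows "w \<in> D12_radial \<and> (H_norm R u)\<^sup>2 = 1 / (real DIM('a) - 2) * (D12_norm w)\<^sup>2"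
proof -
  note n = assms(1) and R = assms(2)
  define m where "m = real DIM('a) - 2"
  have m: "m > 0" using n by (simp add: m_def)
  let ?a = "hardy_exp TYPE('a)"
  let ?c = "real DIM('a) * measure lborel (ball (0::'a) 1)"
  have a: "?a = m / 2" by (simp add: hardy_exp_def m_def)
  \<comment> \<open>The profile of the limit of the test functions, that is, of \<open>u\<close>
    with the singular factor removed; by hypothesis it is also \<open>W\<close> read in the variable
    \<open>r\<close>.\<close>
  define v0 where "v0 = (\<lambda>r. r powr (m / 2) * U r)"
  have AE0: "AE x in lborel. x \<noteq> (0::'a)" by (rule AE_lborel_singleton)
  have AEb: "(AE x in lebesgue_on (ball (0::'a) R). P x) \<longleftrightarrow> (AE x in lborel. x \<in> ball 0 R \<longrightarrow> P x)" for P
    by (simp add: AE_restrict_space_iff AE_completion_iff)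
  have hd: "(\<lambda>x. hardy_fun \<phi> x - hardy_fun \<psi> x) = hardy_fun (\<lambda>x. \<phi> x - \<psi> x)" for \<phi> \<psi> :: "'a \<Rightarrow> real"
    by (auto simp: algebra_simps)
  have uU: "AE x in lborel. x \<in> ball 0 R \<longrightarrow> u x = U (norm x)"
    using assms(4) unfolding radial_profile_def AEb .

  obtain s where s: "approximates (lebesgue_on (ball 0 R)) (\<lambda>u. sqrt (H_quad R u)) (H_dense R) s u"
    using assms(3) by (auto simp: H_radial_def H_space_def fun_completion_def)
  then have "\<forall>k. \<exists>f. f \<in> test_functions (ball 0 R) \<and> s k = hardy_fun f"
    unfolding approximates_def by (blast elim: H_denseE)
  then obtain \<phi> where \<phi>: "\<And>k. \<phi> k \<in> test_functions (ball 0 R)" and s\<phi>: "\<And>k. s k = hardy_fun (\<phi> k)" by metis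
  have "AE x in lborel. x \<in> ball 0 R \<longrightarrow> (\<lambda>k. s k x) \<longlonglongrightarrow> u x"
    using s unfolding approximates_def AEb by blast
  then have lim\<phi>: "AE x in lborel. x \<in> ball 0 R \<longrightarrow> (\<lambda>k. \<phi> k x) \<longlonglongrightarrow> v0 (norm x)"
    using uU AE0
  proof eventually_elim
    fix x :: 'a
    assume x: "x \<in> ball 0 R \<longrightarrow> (\<lambda>k. s k x) \<longlonglongrightarrow> u x" "x \<in> ball 0 R \<longrightarrow> u x = U (norm x)" "x \<noteq> 0"
    show "x \<in> ball 0 R \<longrightarrow> (\<lambda>k. \<phi> k x) \<longlonglongrightarrow> v0 (norm x)"
    proof
      assume "x \<in> ball 0 R"
      have e: "norm x powr ?a * s k x = \<phi> k x" for k using x(3) by (simp add: s\<phi> powr_minus)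
      from \<open>x \<in> ball 0 R\<close> have "(\<lambda>k. norm x powr ?a * s k x) \<longlonglongrightarrow> norm x powr ?a * U (norm x)"
        using x by (intro tendsto_intros) auto
      then show "(\<lambda>k. \<phi> k x) \<longlonglongrightarrow> v0 (norm x)"
        unfolding e by (simp only: v0_def a)
    qed
  qed
  have cauchy: "\<forall>e>0. \<exists>n0. \<forall>k\<ge>n0. \<forall>l\<ge>n0. energy (real DIM('a) - 2) (\<lambda>x. \<phi> k x - \<phi> l x) < e"
  proof (intro allI impI)
    fix e :: real assume "e > 0"
    then have "sqrt e > 0" by simp
    then obtain n0 where "\<And>k l. k \<ge> n0 \<Longrightarrow> l \<ge> n0 \<Longrightarrow> sqrt (H_quad R (\<lambda>x. s k x - s l x)) < sqrt e"
      using s unfolding approximates_def by meson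
    then show "\<exists>n0. \<forall>k\<ge>n0. \<forall>l\<ge>n0. energy (real DIM('a) - 2) (\<lambda>x. \<phi> k x - \<phi> l x) < e"
      unfolding s\<phi> hd H_quad_hardy[OF test_diff[OF \<phi> \<phi>] R n] by auto
  qed
  have n2: "DIM('a) \<ge> 2" using n by simp
  obtain h B where h': "\<forall>k. bump_profile (h k)" and B: "B > 0"
    and hB': "\<forall>k i j. k \<le> i \<longrightarrow> k \<le> j \<longrightarrow> sqnorm (\<lambda>s. h i s - h j s) \<le> ennreal (B * (1/4) ^ k)"
    and hlim: "AE s in lborel. 0 < s \<longrightarrow> (\<lambda>k. primitive (h k) s) \<longlonglongrightarrow> v0 (R * exp (- s))"
    using profile_selection[OF \<phi> n2 R cauchy lim\<phi>] by (elim exE conjE)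
  have h: "bump_profile (h k)" for k using h' by blast
  have hB: "sqnorm (\<lambda>s. h i s - h j s) \<le> ennreal (B * (1/4) ^ k)" if "k \<le> i" "k \<le> j" for k i j
    using hB' that by blast
  have [measurable]: "h k \<in> borel_measurable borel" for k
    using bump_profile_continuous[OF h] by (rule borel_measurable_continuous_onI)
  have h0: "h k s = 0" if "s \<le> 0" for k s
    using h[of k] that unfolding bump_profile_def by force

  have "\<forall>k. \<exists>f :: 'a \<Rightarrow> real. f \<in> test_functions (ball 0 R) \<and>
      (\<forall>x. x \<noteq> 0 \<longrightarrow> f x = primitive (h k) (- ln (norm x / R))) \<and>
      (\<forall>x. x \<noteq> 0 \<longrightarrow> grad f x = (- h k (- ln (norm x / R)) / (norm x)\<^sup>2) *\<^sub>R x)"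
    by (rule allI, rule log_test_function[OF h R]) blast
  then obtain f :: "nat \<Rightarrow> 'a \<Rightarrow> real" where f: "\<And>k. f k \<in> test_functions (ball 0 R)"
      and fv: "\<And>k x. x \<noteq> 0 \<Longrightarrow> f k x = primitive (h k) (- ln (norm x / R))"
      and fg: "\<And>k x. x \<noteq> 0 \<Longrightarrow> grad (f k) x = (- h k (- ln (norm x / R)) / (norm x)\<^sup>2) *\<^sub>R x"
    by metis
  have "\<forall>k. \<exists>f :: 'a \<Rightarrow> real. f \<in> test_functions UNIV \<and>
      (\<forall>x. x \<noteq> 0 \<longrightarrow> f x = primitive (h k) (norm x powr (- m))) \<and>
      (\<forall>x. x \<noteq> 0 \<longrightarrow> grad f x = (- m * h k (norm x powr (- m)) * norm x powr (- m - 2)) *\<^sub>R x)"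
    by (rule allI, rule power_test_function[OF h m]) blast
  then obtain g :: "nat \<Rightarrow> 'a \<Rightarrow> real" where g: "\<And>k. g k \<in> test_functions UNIV"
      and gv: "\<And>k x. x \<noteq> 0 \<Longrightarrow> g k x = primitive (h k) (norm x powr (- m))"
      and gg: "\<And>k x. x \<noteq> 0 \<Longrightarrow> grad (g k) x = (- m * h k (norm x powr (- m)) * norm x powr (- m - 2)) *\<^sub>R x"
    by metis

  have Ef: "ennreal (energy m (f k)) = ennreal ?c * sqnorm (h k)" for k
    unfolding m_def by (rule energy_log_profile[OF f n2 R _ fg]) measurable
  have Eg: "ennreal (energy 0 (g k)) = ennreal (m * ?c) * sqnorm (h k)" for k
    by (rule energy_power_profile[OF g m_def m _ h0 gg]) measurable
  \<comment> \<open>The profile of \<open>f i - f j\<close> is \<open>h i - h j\<close>; the energy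
    formulas apply to it because they start from the form of the gradient, not from a bump
    profile.\<close>
  have Efd: "energy m (\<lambda>x. f i x - f j x) \<le> ?c * B * (1/4) ^ k" if "k \<le> i" "k \<le> j" for i j k
  proof -
    have "ennreal (energy m (\<lambda>x. f i x - f j x)) = ennreal ?c * sqnorm (\<lambda>s. h i s - h j s)"
      unfolding m_def
      by (rule energy_log_profile[OF test_diff[OF f f] n2 R])
        (measurable, simp add: grad_diff[OF f f] fg scaleR_left_diff_distrib[symmetric] diff_divide_distrib)
    also have "\<dots> \<le> ennreal ?c * ennreal (B * (1/4) ^ k)" by (intro mult_left_mono hB that) auto
    also have "\<dots> = ennreal (?c * B * (1/4) ^ k)" using B by (subst ennreal_mult[symmetric]) (auto simp: mult_ac)
    finally show ?thesis using B by (subst (asm) ennreal_le_iff) auto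
  qed
  have Egd: "energy 0 (\<lambda>x. g i x - g j x) \<le> m * ?c * B * (1/4) ^ k" if "k \<le> i" "k \<le> j" for i j k
  proof -
    have "grad (\<lambda>x. g i x - g j x) x =
      (- m * (h i (norm x powr (- m)) - h j (norm x powr (- m))) * norm x powr (- m - 2)) *\<^sub>R x" if "x \<noteq> 0" for x
      unfolding grad_diff[OF g g] gg[OF that] scaleR_left_diff_distrib[symmetric]
      by (simp only: left_diff_distrib right_diff_distrib)
    then have "ennreal (energy 0 (\<lambda>x. g i x - g j x)) = ennreal (m * ?c) * sqnorm (\<lambda>s. h i s - h j s)"
      by (intro energy_power_profile[OF test_diff[OF g g] m_def m]) (simp_all add: h0)
    also have "\<dots> \<le> ennreal (m * ?c) * ennreal (B * (1/4) ^ k)" by (intro mult_left_mono hB that) auto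
    also have "\<dots> = ennreal (m * ?c * B * (1/4) ^ k)" using B m by (subst ennreal_mult[symmetric]) (auto simp: mult_ac)
    finally show ?thesis using B m by (subst (asm) ennreal_le_iff) auto
  qed

  \<comment> \<open>Almost everywhere convergence in \<open>s > 0\<close> is pulled back to the
    radii in \<open>{0<..<R}\<close> and then to the points of the ball.\<close>
  have imR: "(\<lambda>r. - ln (r / R)) ` {0<..<R} = {0<..}"
  proof (intro equalityI subsetI)
    fix s :: real assume "s \<in> {0<..}"
    then show "s \<in> (\<lambda>r. - ln (r / R)) ` {0<..<R}"
      using R by (intro image_eqI[of _ _ "R * exp (- s)"]) auto
  qed (use R in \<open>auto simp: ln_less_zero_iff divide_less_eq\<close>)
  have "AE r in lborel. r \<in> {0<..<R} \<longrightarrow> (\<lambda>k. primitive (h k) (- ln (r / R))) \<longlonglongrightarrow> v0 (R * exp (- (- ln (r / R))))"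
  proof (rule AE_substitution_inj[where g' = "\<lambda>r. - 1 / r"])
    show "AE s in lborel. s \<in> (\<lambda>r. - ln (r / R)) ` {0<..<R} \<longrightarrow> (\<lambda>k. primitive (h k) s) \<longlonglongrightarrow> v0 (R * exp (- s))"
      unfolding imR using hlim by simp
    show "(\<lambda>r. - ln (r / R)) ` {0<..<R} \<in> sets borel" unfolding imR by simp
    show "((\<lambda>r. - ln (r / R)) has_real_derivative - 1 / r) (at r)" if "r \<in> {0<..<R}" for r
      using that by (auto intro!: derivative_eq_intros)
    show "inj_on (\<lambda>r. - ln (r / R)) {0<..<R}" by (auto simp: inj_on_def)
    show "- 1 / r \<noteq> 0" if "r \<in> {0<..<R}" for r using that by auto
  qed measurable
  then have "AE r in lborel. 0 < r \<longrightarrow> r < R \<longrightarrow> (\<lambda>k. primitive (h k) (- ln (r / R))) \<longlonglongrightarrow> v0 r"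
    by eventually_elim (use R in auto)
  from AE_radial[OF this]
  have limf: "AE x in lborel. norm (x::'a) < R \<longrightarrow> (\<lambda>k. primitive (h k) (- ln (norm x / R))) \<longlonglongrightarrow> v0 (norm x)" .
  have appf: "approximates (lebesgue_on (ball 0 R)) (\<lambda>u. sqrt (H_quad R u)) (H_dense R) (\<lambda>k. hardy_fun (f k)) u"
  proof (rule approximates_sqrtI[OF _ _ Efd])
    show "hardy_fun (f k) \<in> H_dense R" for k using f by (auto simp: H_dense_def)
    show "sqrt (H_quad R (\<lambda>x. hardy_fun (f i) x - hardy_fun (f j) x)) = sqrt (energy m (\<lambda>x. f i x - f j x))" for i j
      unfolding hd H_quad_hardy[OF test_diff[OF f f] R n] m_def ..
    show "AE x in lebesgue_on (ball 0 R). (\<lambda>k. hardy_fun (f k) x) \<longlonglongrightarrow> u x"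
      unfolding AEb using limf uU AE0
    proof eventually_elim
      fix x :: 'a
      assume x: "norm x < R \<longrightarrow> (\<lambda>k. primitive (h k) (- ln (norm x / R))) \<longlonglongrightarrow> v0 (norm x)"
        "x \<in> ball 0 R \<longrightarrow> u x = U (norm x)" "x \<noteq> 0"
      show "x \<in> ball 0 R \<longrightarrow> (\<lambda>k. hardy_fun (f k) x) \<longlonglongrightarrow> u x"
      proof
        assume xR: "x \<in> ball 0 R"
        then have "(\<lambda>k. hardy_fun (f k) x) \<longlonglongrightarrow> norm x powr (- ?a) * v0 (norm x)"
          using x by (intro tendsto_intros) (simp add: fv)
        also have "norm x powr (- ?a) * v0 (norm x) = u x"
          using x xR by (simp add: v0_def a powr_minus)
        finally show "(\<lambda>k. hardy_fun (f k) x) \<longlonglongrightarrow> u x" .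
      qed
    qed
  qed

  have "AE t in lborel. t \<in> {0<..} \<longrightarrow> (\<lambda>k. primitive (h k) (t powr (- m))) \<longlonglongrightarrow> v0 (R * exp (- (t powr (- m))))"
  proof (rule AE_substitution_inj[where g' = "\<lambda>t. - m * t powr (- m - 1)"])
    show "AE s in lborel. s \<in> (\<lambda>t. t powr (- m)) ` {0<..} \<longrightarrow> (\<lambda>k. primitive (h k) s) \<longlonglongrightarrow> v0 (R * exp (- s))"
      unfolding powr_neg_image[OF m] using hlim by simp
    show "(\<lambda>t. t powr (- m)) ` {0<..} \<in> sets (borel :: real measure)" unfolding powr_neg_image[OF m] by simp
    show "((\<lambda>t. t powr (- m)) has_real_derivative - m * t powr (- m - 1)) (at t)" if "t \<in> {0<..}" for t
      using that by (intro has_real_derivative_powr) auto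
    show "inj_on (\<lambda>t::real. t powr (- m)) {0<..}"
      using m by (intro inj_on_inverseI[where g = "\<lambda>s. s powr (- 1 / m)"]) (auto simp: powr_powr)
    show "- m * t powr (- m - 1) \<noteq> 0" if "t \<in> {0<..}" for t using that m by auto
  qed measurable
  \<comment> \<open>Every \<open>t > 0\<close> comes from a radius strictly between 0 and
    \<open>R\<close>, so the hypothesis on \<open>W\<close> determines it on the whole positive
    half-line; the remaining value \<open>W 0\<close> concerns the origin alone.\<close>
  moreover have "v0 (R * exp (- (t powr (- m)))) = W t" if t: "t > 0" for t
  proof -
    let ?r = "R * exp (- (t powr (- m)))"
    have "W ((- ln (?r / R)) powr (- 1 / m)) = ?r powr (m / 2) * U ?r"
      unfolding m_def by (rule assms(5)) (use R t in auto)
    moreover have "(- ln (?r / R)) powr (- 1 / m) = t" using R t m by (simp add: powr_powr)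
    ultimately show ?thesis by (simp add: v0_def)
  qed
  ultimately have "AE t in lborel. 0 < t \<longrightarrow> (\<lambda>k. primitive (h k) (t powr (- m))) \<longlonglongrightarrow> W t"
    by (auto elim!: eventually_mono)
  from AE_radial[OF this]
  have limg: "AE x in lborel. (\<lambda>k. primitive (h k) (norm (x::'a) powr (- m))) \<longlonglongrightarrow> W (norm x)" .
  have appg: "approximates lebesgue dirichlet_norm (test_functions UNIV) g w"
  proof (rule approximates_sqrtI[OF g _ Egd])
    show "dirichlet_norm (\<lambda>x. g i x - g j x) = sqrt (energy 0 (\<lambda>x. g i x - g j x))" for i j
      by (rule dirichlet_norm_eq_energy[OF test_diff[OF g g]])
    show "AE x in lebesgue. (\<lambda>k. g k x) \<longlonglongrightarrow> w x"
      unfolding AE_completion_iff using limg AE0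
      by eventually_elim (simp add: gv assms(6))
  qed

  have D: "w \<in> D12_radial"
    using appg assms(6) by (auto simp: D12_radial_def D12_def fun_completion_def radial_profile_def)
  \<comment> \<open>Both energies are multiples of the same integral of \<open>(h k)^2\<close>, so
    the ratio \<open>m\<close> is exact for each \<open>k\<close> and passes to the limit.\<close>
  have e: "energy 0 (g k) = m * energy m (f k)" for k
  proof -
    have "ennreal (energy 0 (g k)) = ennreal (m * energy m (f k))"
      using m by (simp add: Eg Ef ennreal_mult' mult.assoc)
    then show ?thesis using m by (simp add: energy_nonneg)
  qed
  have "(\<lambda>k. sqrt (energy m (f k))) \<longlonglongrightarrow> H_norm R u"
    using H_norm_tendsto[OF n R appf] by (simp add: H_quad_hardy[OF f R n] m_def)
  from tendsto_power[OF this, of 2] have 1: "(\<lambda>k. energy m (f k)) \<longlonglongrightarrow> (H_norm R u)\<^sup>2"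
    by (simp add: energy_nonneg)
  have "(\<lambda>k. sqrt (energy 0 (g k))) \<longlonglongrightarrow> D12_norm w"
    using D12_norm_tendsto[OF appg] by (simp add: dirichlet_norm_eq_energy[OF g])
  from tendsto_power[OF this, of 2] have 2: "(\<lambda>k. energy 0 (g k)) \<longlonglongrightarrow> (D12_norm w)\<^sup>2"
    by (simp add: energy_nonneg)
  have "(D12_norm w)\<^sup>2 = m * (H_norm R u)\<^sup>2"
    by (rule LIMSEQ_unique[OF 2]) (unfold e, intro tendsto_intros 1)
  then show ?thesis using D m by (simp add: m_def)
qed

end
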